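(* Directed LCVS problems and directed LCVP problems are solvable in XP time parameterized by bi-mim-width when a branch decomposition is given. That is: (a) For all fixed finite or co-finite sets $\sigma^+,\sigma^-,\rho^+,\rho^-\subseteq\mathbb{N}$ and for either choice of optimization (minimum or maximum), there are a function $f:\mathbb{N}\to\mathbb{N}$ and an algorithm that, given a digraph $G$ on $n$ vertices together with a branch decomposition of $G$ of bi-mim-width $w$, solves the $(\sigma^+,\sigma^-,\rho^+,\rho^-)$-problem on $G$ in time $O(n^{f(w)})$. (b) For every fixed positive integer $q$ and every fixed $(q\times q)$-matrix $D$ whose entries are pairs of finite or co-finite subsets of $\mathbb{N}$, there are a function $f:\mathbb{N}\to\mathbb{N}$ and an algorithm that, given a digraph $G$ on $n$ vertices together with a branch decomposition of $G$ of bi-mim-width $w$, solves the directed LCVP problem represented by $D$ on $G$ in time $O(n^{f(w)})$.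
   Context: $\mathbb{N}$ contains $0$. All digraphs are finite, have no multiple edges, and may have loops; $E(G)\subseteq V(G)\times V(G)$, and $(u,v)$ is an edge from $u$ to $v$. $N^+(v)$ and $N^-(v)$ are the sets of out-neighbors and in-neighbors of $v$. Directed LCVS problem (the $(\sigma^+,\sigma^-,\rho^+,\rho^-)$-problem): given a digraph $G$, find a set $S\subseteq V(G)$ of minimum (respectively maximum) size such that for every $v\in S$, $|N^+(v)\cap S|\in\sigma^+$ and $|N^-(v)\cap S|\in\sigma^-$, and for every $v\in V(G)\setminus S$, $|N^+(v)\cap S|\in\rho^+$ and $|N^-(v)\cap S|\in\rho^-$ (or report that no such set exists). Directed LCVP problem represented by $D$, with $D[i,j]=(\mu^+_{i,j},\mu^-_{i,j})$: given a digraph $G$, decide whether $V(G)$ has a partition into $X_1,\dots,X_q$ (parts may be empty) such that for all $i,j\in\{1,\dots,q\}$ and all $v\in X_i$, $|N^+(v)\cap X_j|\in\mu^+_{i,j}$ and $|N^-(v)\cap X_j|\in\mu^-_{i,j}$. Bi-mim-width: for disjoint $A,B\subseteq V(G)$, $G[A\to B]$ is the bipartite digraph on vertex set $A\cup B$ with edge set $E(G)\cap(A\times B)$. Write $\bar A=V(G)\setminus A$. An induced matching is a set $M$ of edges, no two sharing an endpoint, such that no edge of the digraph meets two distinct edges of $M$; $\nu(\cdot)$ is the maximum size of an induced matching. Let $\mathrm{bimim}_G(A)=\nu(G[A\to\bar A])+\nu(G[\bar A\to A])$. A tree is subcubic if it has at least two vertices and every internal vertex has degree $3$. A branch decomposition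 of $G$ is a pair $(T,L)$ of a subcubic tree $T$ and a bijection $L$ from $V(G)$ to the leaves of $T$. Each edge $e$ of $T$ yields a cut $(A_e,B_e)$ of $G$, where $A_e$ and $B_e$ are the sets of vertices mapped by $L$ to the leaves in the two components of $T-e$. The bi-mim-width of $(T,L)$ is $\max_{e\in E(T)}\mathrm{bimim}_G(A_e)$. *)

theory Defs
  imports
    "HOL-Library.Disjoint_Sets"
    "Graph_Theory.Graph_Theory"
begin

section \<open>The two families of problems\<close>

text \<open>
  A digraph (finite, no multiple edges, loops allowed) is a \<open>pair_pre_digraph\<close> satisfying the
  predicate \<open>pair_fin_digraph\<close> of the library.
\<close>

definition out_nbrs :: "'a pair_pre_digraph \<Rightarrow> 'a \<Rightarrow> 'a set" where
  "out_nbrs G v = {u. (v, u) \<in> parcs G}"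

definition in_nbrs :: "'a pair_pre_digraph \<Rightarrow> 'a \<Rightarrow> 'a set" where
  "in_nbrs G v = {u. (u, v) \<in> parcs G}"

definition fin_or_cofin :: "nat set \<Rightarrow> bool" where
  "fin_or_cofin A \<longleftrightarrow> finite A \<or> finite (- A)"

definition lcvs_feasible ::
  "nat set \<Rightarrow> nat set \<Rightarrow> nat set \<Rightarrow> nat set \<Rightarrow> 'a pair_pre_digraph \<Rightarrow> 'a set \<Rightarrow> bool" where
  "lcvs_feasible \<sigma>p \<sigma>m \<rho>p \<rho>m G S \<longleftrightarrow>
     S \<subseteq> pverts G \<and>
     (\<forall>v\<in>S. card (out_nbrs G v \<inter> S) \<in> \<sigma>p \<and> card (in_nbrs G v \<inter> S) \<in> \<sigma>m) \<and>
     (\<forall>v\<in>pverts G - S. card (out_nbrs G v \<inter> S) \<in> \<rho>p \<and> card (in_nbrs G v \<inter> S) \<in> \<rho>m)"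

datatype objective = Minimize | Maximize

fun at_least_as_good :: "objective \<Rightarrow> 'a set \<Rightarrow> 'a set \<Rightarrow> bool" where
  "at_least_as_good Minimize S S' \<longleftrightarrow> card S \<le> card S'"
| "at_least_as_good Maximize S S' \<longleftrightarrow> card S \<ge> card S'"

text \<open>\<open>None\<close> is the report that no feasible set exists.\<close>

fun lcvs_answer ::
  "nat set \<Rightarrow> nat set \<Rightarrow> nat set \<Rightarrow> nat set \<Rightarrow> objective \<Rightarrow>
   'a pair_pre_digraph \<Rightarrow> 'a set option \<Rightarrow> bool" where
  "lcvs_answer \<sigma>p \<sigma>m \<rho>p \<rho>m obj G None \<longleftrightarrow> (\<nexists>S. lcvs_feasible \<sigma>p \<sigma>m \<rho>p \<rho>m G S)"
| "lcvs_answer \<sigma>p \<sigma>m \<rho>p \<rho>m obj G (Some S) \<longleftrightarrow>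
     lcvs_feasible \<sigma>p \<sigma>m \<rho>p \<rho>m G S \<and>
     (\<forall>S'. lcvs_feasible \<sigma>p \<sigma>m \<rho>p \<rho>m G S' \<longrightarrow> at_least_as_good obj S S')"

text \<open>
  A \<open>q \<times> q\<close> matrix is a function of which only the entries with both indices in \<open>{1..q}\<close> are used;
  \<open>D i j\<close> is the pair of the out-constraint and the in-constraint.
\<close>

definition lcvp_partition ::
  "nat \<Rightarrow> (nat \<Rightarrow> nat \<Rightarrow> nat set \<times> nat set) \<Rightarrow> 'a pair_pre_digraph \<Rightarrow> (nat \<Rightarrow> 'a set) \<Rightarrow> bool" where
  "lcvp_partition q D G X \<longleftrightarrow>
     (\<Union>i\<in>{1..q}. X i) = pverts G \<and> disjoint_family_on X {1..q} \<and>
     (\<forall>i\<in>{1..q}. \<forall>j\<in>{1..q}. \<forall>v\<in>X i.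
        card (out_nbrs G v \<inter> X j) \<in> fst (D i j) \<and> card (in_nbrs G v \<inter> X j) \<in> snd (D i j))"

definition lcvp_answer ::
  "nat \<Rightarrow> (nat \<Rightarrow> nat \<Rightarrow> nat set \<times> nat set) \<Rightarrow> 'a pair_pre_digraph \<Rightarrow> bool \<Rightarrow> bool" where
  "lcvp_answer q D G b \<longleftrightarrow> (b \<longleftrightarrow> (\<exists>X. lcvp_partition q D G X))"


section \<open>Bi-mim-width\<close>

definition bip_digraph :: "'a pair_pre_digraph \<Rightarrow> 'a set \<Rightarrow> 'a set \<Rightarrow> 'a pair_pre_digraph" where
  "bip_digraph G A B = \<lparr> pverts = A \<union> B, parcs = parcs G \<inter> (A \<times> B) \<rparr>"

definition meets :: "'a \<times> 'a \<Rightarrow> 'a \<times> 'a \<Rightarrow> bool" where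
  "meets e e' \<longleftrightarrow> {fst e, snd e} \<inter> {fst e', snd e'} \<noteq> {}"

definition induced_matching :: "'a pair_pre_digraph \<Rightarrow> ('a \<times> 'a) set \<Rightarrow> bool" where
  "induced_matching H M \<longleftrightarrow>
     M \<subseteq> parcs H \<and>
     (\<forall>m\<in>M. \<forall>m'\<in>M. m \<noteq> m' \<longrightarrow> \<not> meets m m') \<and>
     (\<forall>e\<in>parcs H. \<forall>m\<in>M. \<forall>m'\<in>M. m \<noteq> m' \<longrightarrow> \<not> (meets e m \<and> meets e m'))"

definition induced_matching_number :: "'a pair_pre_digraph \<Rightarrow> nat" where
  "induced_matching_number H = Max {card M | M. induced_matching H M}"

definition bimim :: "'a pair_pre_digraph \<Rightarrow> 'a set \<Rightarrow> nat" where
  "bimim G A =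
     induced_matching_number (bip_digraph G A (pverts G - A)) +
     induced_matching_number (bip_digraph G (pverts G - A) A)"

text \<open>
  An undirected edge is represented by its two opposite arcs, so \<open>pair_graph\<close> describes the finite
  simple undirected graphs. The constant \<open>tree\<close> of the library does not fit this
  representation: its notion of a cycle includes walking along an edge and back. Hence the
  restriction to cycles of length at least three.
\<close>

definition undirected_tree :: "'b pair_pre_digraph \<Rightarrow> bool" where
  "undirected_tree T \<longleftrightarrow>
     pair_graph T \<and> Digraph_Component.connected (with_proj T) \<and>
     \<not> (\<exists>p. pre_digraph.cycle (with_proj T) p \<and> length p \<ge> 3)"

definition tree_leaves :: "'b pair_pre_digraph \<Rightarrow> 'b set" where
  "tree_leaves T = {x \<in> pverts T. out_degree (with_proj T) x = 1}"

definition subcubic_tree :: "'b pair_pre_digraph \<Rightarrow> bool" where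
  "subcubic_tree T \<longleftrightarrow>
     undirected_tree T \<and> card (pverts T) \<ge> 2 \<and>
     (\<forall>x \<in> pverts T - tree_leaves T. out_degree (with_proj T) x = 3)"

definition branch_decomposition ::
  "'a pair_pre_digraph \<Rightarrow> 'b pair_pre_digraph \<Rightarrow> ('a \<Rightarrow> 'b) \<Rightarrow> bool" where
  "branch_decomposition G T L \<longleftrightarrow> subcubic_tree T \<and> bij_betw L (pverts G) (tree_leaves T)"

definition delete_edge :: "'b pair_pre_digraph \<Rightarrow> 'b \<times> 'b \<Rightarrow> 'b pair_pre_digraph" where
  "delete_edge T e = \<lparr> pverts = pverts T, parcs = parcs T - {(fst e, snd e), (snd e, fst e)} \<rparr>"

text \<open>
  The side of the cut induced by an edge that belongs to the first endpoint of \<open>e\<close>. The two arcs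
  of an edge yield the two complementary sides, on which \<open>bimim\<close> agrees, so the maximum over all
  arcs is the maximum over all edges.
\<close>

definition cut_side ::
  "'a pair_pre_digraph \<Rightarrow> 'b pair_pre_digraph \<Rightarrow> ('a \<Rightarrow> 'b) \<Rightarrow> 'b \<times> 'b \<Rightarrow> 'a set" where
  "cut_side G T L e = {v \<in> pverts G. reachable (with_proj (delete_edge T e)) (fst e) (L v)}"

definition bimim_width ::
  "'a pair_pre_digraph \<Rightarrow> 'b pair_pre_digraph \<Rightarrow> ('a \<Rightarrow> 'b) \<Rightarrow> nat" where
  "bimim_width G T L = Max ((\<lambda>e. bimim G (cut_side G T L e)) ` parcs T)"


section \<open>Model of computation\<close>

text \<open>
  Algorithms are programs of the language WHILE of N. D. Jones (Computability and Complexity from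
  a Programming Perspective): imperative programs whose variables hold binary trees over a single
  atom. Every evaluated operator and every executed command costs one step. Since trees can be
  shared by pointers and no operator copies or compares whole trees, this unit cost is
  polynomially related to the running time of Turing machines and of random access machines.
\<close>

datatype val = Nul | Dot val val

datatype exp = Var nat | Null | Cons exp exp | Hd exp | Tl exp

datatype com =
    Skip
  | Assign nat exp
  | Seq com com
  | Cond exp com com
  | While exp com

fun val_hd :: "val \<Rightarrow> val" where
  "val_hd Nul = Nul"
| "val_hd (Dot a b) = a"

fun val_tl :: "val \<Rightarrow> val" where
  "val_tl Nul = Nul"
| "val_tl (Dot a b) = b"

primrec eval_exp :: "exp \<Rightarrow> (nat \<Rightarrow> val) \<Rightarrow> val" where
  "eval_exp (Var x) s = s x"
| "eval_exp Null s = Nul"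
| "eval_exp (Cons a b) s = Dot (eval_exp a s) (eval_exp b s)"
| "eval_exp (Hd a) s = val_hd (eval_exp a s)"
| "eval_exp (Tl a) s = val_tl (eval_exp a s)"

primrec exp_cost :: "exp \<Rightarrow> nat" where
  "exp_cost (Var x) = 1"
| "exp_cost Null = 1"
| "exp_cost (Cons a b) = 1 + exp_cost a + exp_cost b"
| "exp_cost (Hd a) = 1 + exp_cost a"
| "exp_cost (Tl a) = 1 + exp_cost a"

text \<open>\<open>exec c s t s'\<close>: started in store \<open>s\<close>, \<open>c\<close> terminates after \<open>t\<close> steps in store \<open>s'\<close>.\<close>

inductive exec :: "com \<Rightarrow> (nat \<Rightarrow> val) \<Rightarrow> nat \<Rightarrow> (nat \<Rightarrow> val) \<Rightarrow> bool" where
  Skip: "exec Skip s 1 s"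
| Assign: "exec (Assign x a) s (1 + exp_cost a) (s(x := eval_exp a s))"
| Seq: "exec c s t s' \<Longrightarrow> exec d s' t' s'' \<Longrightarrow> exec (Seq c d) s (1 + t + t') s''"
| CondTrue: "eval_exp a s \<noteq> Nul \<Longrightarrow> exec c s t s' \<Longrightarrow> exec (Cond a c d) s (1 + exp_cost a + t) s'"
| CondFalse: "eval_exp a s = Nul \<Longrightarrow> exec d s t s' \<Longrightarrow> exec (Cond a c d) s (1 + exp_cost a + t) s'"
| WhileTrue: "eval_exp a s \<noteq> Nul \<Longrightarrow> exec c s t s' \<Longrightarrow> exec (While a c) s' t' s'' \<Longrightarrow>
    exec (While a c) s (1 + exp_cost a + t + t') s''"
| WhileFalse: "eval_exp a s = Nul \<Longrightarrow> exec (While a c) s (1 + exp_cost a) s"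

inductive_cases exec_SkipE: "exec Skip s t s'"
inductive_cases exec_AssignE: "exec (Assign x a) s t s'"
inductive_cases exec_SeqE: "exec (Seq c d) s t s'"
inductive_cases exec_CondE: "exec (Cond a c d) s t s'"
inductive_cases exec_WhileE: "exec (While a c) s t s'"

lemma exec_deterministic:
  "exec c s t s' \<Longrightarrow> exec c s u r \<Longrightarrow> u = t \<and> r = s'"
proof (induction arbitrary: u r rule: exec.induct)
  case (Skip s)
  then show ?case by (auto elim: exec_SkipE)
next
  case (Assign x a s)
  then show ?case by (auto elim: exec_AssignE)
next
  case (Seq c s t s' d t' s'')
  from Seq.prems show ?case
    by (rule exec_SeqE) (auto dest!: Seq.IH)
next
  case (CondTrue a s c t s' d)
  from CondTrue.prems show ?case
    by (rule exec_CondE) (auto simp: CondTrue.hyps dest!: CondTrue.IH)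
next
  case (CondFalse a s d t s' c)
  from CondFalse.prems show ?case
    by (rule exec_CondE) (auto simp: CondFalse.hyps dest!: CondFalse.IH)
next
  case (WhileTrue a s c t s' t' s'')
  from WhileTrue.prems show ?case
    by (rule exec_WhileE) (auto simp: WhileTrue.hyps dest!: WhileTrue.IH)
next
  case (WhileFalse a s c)
  from WhileFalse.prems show ?case
    by (rule exec_WhileE) (use WhileFalse.hyps in auto)
qed

text \<open>Variable \<open>0\<close> holds the input at the start and the output at the end.\<close>

definition computes :: "com \<Rightarrow> val \<Rightarrow> val \<Rightarrow> nat \<Rightarrow> bool" where
  "computes p x y t \<longleftrightarrow> (\<exists>s. exec p ((\<lambda>_. Nul)(0 := x)) t s \<and> s 0 = y)"


section \<open>Encoding of inputs and outputs\<close>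

fun enc_list :: "('a \<Rightarrow> val) \<Rightarrow> 'a list \<Rightarrow> val" where
  "enc_list f [] = Nul"
| "enc_list f (x # xs) = Dot (f x) (enc_list f xs)"

fun enc_bool :: "bool \<Rightarrow> val" where
  "enc_bool False = Nul"
| "enc_bool True = Dot Nul Nul"

text \<open>Unary notation: only indices of vertices are encoded, so sizes remain polynomial.\<close>

fun enc_nat :: "nat \<Rightarrow> val" where
  "enc_nat 0 = Nul"
| "enc_nat (Suc k) = Dot Nul (enc_nat k)"

text \<open>
  As usual, the vertices of graphs that are given to an algorithm are numbered consecutively.
  Such graphs are encoded by their adjacency matrices, and a vertex set by its characteristic
  vector.
\<close>

definition numbered :: "nat pair_pre_digraph \<Rightarrow> bool" where
  "numbered G \<longleftrightarrow> pverts G = {..<card (pverts G)}"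

definition enc_graph :: "nat pair_pre_digraph \<Rightarrow> val" where
  "enc_graph G =
     enc_list (\<lambda>u. enc_list (\<lambda>v. enc_bool ((u, v) \<in> parcs G)) [0..<card (pverts G)])
       [0..<card (pverts G)]"

definition enc_input ::
  "nat pair_pre_digraph \<Rightarrow> nat pair_pre_digraph \<Rightarrow> (nat \<Rightarrow> nat) \<Rightarrow> val" where
  "enc_input G T L =
     Dot (enc_graph G) (Dot (enc_graph T) (enc_list (\<lambda>v. enc_nat (L v)) [0..<card (pverts G)]))"

fun enc_opt_set :: "nat pair_pre_digraph \<Rightarrow> nat set option \<Rightarrow> val" where
  "enc_opt_set G None = Nul"
| "enc_opt_set G (Some S) = Dot Nul (enc_list (\<lambda>v. enc_bool (v \<in> S)) [0..<card (pverts G)])"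

text \<open>
  \<open>solves_in_time p f enc_out answer\<close>: given a digraph on \<open>n\<close> vertices and a branch decomposition
  of bi-mim-width \<open>w\<close>, the program \<open>p\<close> returns a correct answer in time \<open>O(n ^ f w)\<close>. The constant
  hidden in the \<open>O\<close> depends neither on the input nor on \<open>w\<close>.
\<close>

definition solves_in_time ::
  "com \<Rightarrow> (nat \<Rightarrow> nat) \<Rightarrow> (nat pair_pre_digraph \<Rightarrow> 'r \<Rightarrow> val) \<Rightarrow>
   (nat pair_pre_digraph \<Rightarrow> 'r \<Rightarrow> bool) \<Rightarrow> bool" where
  "solves_in_time p f enc_out answer \<longleftrightarrow>
     (\<exists>C::nat. \<forall>G T L.
        pair_fin_digraph G \<and> numbered G \<and> numbered T \<and> branch_decomposition G T L \<longrightarrow>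
        (\<exists>r t. computes p (enc_input G T L) (enc_out G r) t \<and> answer G r \<and>
               t \<le> C * card (pverts G) ^ f (bimim_width G T L)))"

end

theory Submission
  imports Defs
begin

text \<open>
  Both families ask for a colouring of the vertices with \<open>1, \<dots>, q\<close> such that for each vertex \<open>v\<close> of
  colour \<open>i\<close> the numbers of out- and in-neighbours of \<open>v\<close> of colour \<open>j\<close> lie in given finite or co-finite
  sets. (For a subset problem there are two colours; the objective is to use one of them as rarely as
  possible.) There is a \<open>d\<close> such that membership in these sets does not change when numbers are
  capped at \<open>d\<close>.

  Consider a cut of the graph with sides \<open>A\<close> and \<open>B\<close>. Capped numbers can be added
  (\<open>same_merge\<close>), so all that matters about a colouring of \<open>A\<close> for the vertices of \<open>B\<close> is which capped
  numbers of neighbours of each colour they have in \<open>A\<close>. Call colourings of \<open>A\<close> equivalent if these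
  numbers are equal. If the cut has bi-mim-width at most \<open>w\<close>, there are at most \<open>(n + 1) ^ (2 q d w)\<close>
  classes (\<open>card_inequivalent_colourings\<close>): a colour class can be thinned out to \<open>d\<close> layers without
  changing what \<open>B\<close> sees, each layer being a minimal set that dominates what can be dominated; by
  minimality its elements have private neighbours in \<open>B\<close>, which form an induced matching
  (\<open>capped_selection\<close>, \<open>card_private_le_bimim\<close>).

  Dynamic programming then works on the sides \<open>A\<close> of the cuts of the branch decomposition. For
  representatives \<open>r\<close> of the classes on \<open>A\<close> and \<open>e\<close> of the classes on the complement, a table keeps a
  cheapest colouring of \<open>A\<close> that is equivalent to \<open>r\<close> and meets the requirements of the vertices of \<open>A\<close>
  when the other vertices are coloured by \<open>e\<close>. Every side is a single vertex or the disjoint union of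
  two smaller sides (\<open>cut_side_cases\<close>), and optimal entries for the smaller sides yield optimal entries
  for their union (\<open>table_complete_sweep\<close>), because replacing a part of a solution by an equivalent
  colouring does not affect the rest.

  For the running time, \<open>ptime f\<close> says that \<open>f\<close> is computed by a WHILE program in time polynomial in the
  size of the encoded argument. This class is closed under composition, case distinction and folds
  whose accumulators stay polynomially small, so the algorithm is an ordinary function on lists and
  numbers whose complexity follows from the form of its definition. The number of classes is however
  not polynomial in the input, and \<open>w\<close> is not given. The algorithm therefore has a limit as an
  additional argument and fails if it meets more representatives than that; its time is polynomial in
  the input and the limit. It is run with the limits \<open>0, 1, 2, \<dots>\<close> until it succeeds (\<open>retry_program\<close>),
  at the latest with the number of classes above, which yields time \<open>n ^ f w\<close>
  (\<open>right_answer_in_time\<close>).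
\<close>

section \<open>Encodings and polynomial bounds\<close>

text \<open>
  The instances below coincide with the encodings in the problem statement (and \<open>None\<close>, \<open>Some\<close> with
  the report and the answer of a subset problem), so that algorithms can be written with the usual
  types and their inputs and outputs need no translation.
\<close>

class enc = fixes enc :: "'a \<Rightarrow> val"

text \<open>
  The unit value is \<open>Nul\<close>, so that a list of \<open>k\<close> units has the same code as the number \<open>k\<close>; loops that
  run \<open>k\<close> times are therefore loops over a list.
\<close>

instantiation unit :: enc begin
definition enc_unit :: "unit \<Rightarrow> val" where "enc_unit x = Nul"
instance ..
end

instantiation bool :: enc begin
definition enc_bool_inst: "enc = enc_bool"
instance ..
end

instantiation nat :: enc begin
definition enc_nat_inst: "enc = enc_nat"
instance ..
end

instantiation list :: (enc) enc begin
definition enc_list_inst: "enc = enc_list enc"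
instance ..
end

instantiation prod :: (enc, enc) enc begin
definition enc_prod :: "'a \<times> 'b \<Rightarrow> val" where "enc_prod p = Dot (enc (fst p)) (enc (snd p))"
instance ..
end

instantiation option :: (enc) enc begin
fun enc_option :: "'a option \<Rightarrow> val" where
  "enc_option None = Nul"
| "enc_option (Some x) = Dot Nul (enc x)"
instance ..
end

lemma enc_simps [simp]:
  "enc () = Nul"
  "enc False = Nul" "enc True = Dot Nul Nul"
  "enc (0::nat) = Nul" "enc (Suc k) = Dot Nul (enc k)"
  "enc ([]::'a::enc list) = Nul" "enc (x # xs) = Dot (enc x) (enc (xs::'a list))"
  "enc (a, b) = Dot (enc a) (enc b)"
  by (simp_all add: enc_unit_def enc_bool_inst enc_nat_inst enc_list_inst enc_prod_def)

primrec vsize :: "val \<Rightarrow> nat" where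
  "vsize Nul = 1"
| "vsize (Dot a b) = 1 + vsize a + vsize b"

text \<open>
  Shared subtrees are counted as often as they occur. Programs may share them, so this is an upper
  bound on memory; all data of the algorithm below is small even in this measure.
\<close>

definition sz :: "'a::enc \<Rightarrow> nat" where "sz x = vsize (enc x)"

lemma sz_simps [simp]:
  "sz () = 1" "sz False = 1" "sz True = 3"
  "sz ([]::'a::enc list) = 1" "sz (x # xs) = 1 + sz x + sz (xs::'a list)"
  "sz (a, b) = 1 + sz a + sz b"
  "sz (None :: 'a option) = 1" "sz (Some x) = 2 + sz x"
  by (simp_all add: sz_def)

lemma sz_nat [simp]: "sz (n::nat) = 2 * n + 1"
  by (induction n) (simp_all add: sz_def)

lemma sz_fst_le: "sz (fst p) \<le> sz p" and sz_snd_le: "sz (snd p) \<le> sz p"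
  by (cases p; simp)+

lemma sz_bool_le: "sz (b::bool) \<le> 3"
  by (cases b) simp_all

lemma sz_list: "sz xs = 1 + (\<Sum>x\<leftarrow>xs. Suc (sz x))"
  by (induction xs) simp_all

lemma sz_append: "sz (xs @ ys) + 1 = sz xs + sz ys"
  by (simp add: sz_list)

lemma length_le_sz: "length xs \<le> sz xs"
  by (induction xs) simp_all

lemma sz_mem_le: "x \<in> set xs \<Longrightarrow> Suc (sz x) \<le> sz xs"
  by (induction xs) auto

lemma sz_list_le:
  assumes "\<And>x. x \<in> set xs \<Longrightarrow> sz x \<le> b"
  shows "sz xs \<le> 1 + length xs * (b + 1)"
  using assms by (induction xs) (simp_all, fastforce)

text \<open>
  The base is at least two, whence a larger exponent absorbs constants, sums and products, and one
  exponent suffices to describe a polynomial bound.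
\<close>

definition pbound :: "('a::enc \<Rightarrow> nat) \<Rightarrow> bool" where
  "pbound g \<longleftrightarrow> (\<exists>a. \<forall>x. g x \<le> (sz x + 2) ^ a)"

named_theorems pbound_intros

lemma pbound_mono: "pbound g \<Longrightarrow> (\<And>x. f x \<le> g x) \<Longrightarrow> pbound f"
  unfolding pbound_def by (meson le_trans)

lemma pbound_const [pbound_intros]: "pbound (\<lambda>x. c)"
  unfolding pbound_def
proof (intro exI allI)
  fix x :: 'a
  have "c \<le> 2 ^ c" by (rule less_imp_le) (rule less_exp)
  also have "\<dots> \<le> (sz x + 2) ^ c" by (rule power_mono) simp_all
  finally show "c \<le> (sz x + 2) ^ c" .
qed

lemma pbound_sz_self: "pbound sz"
  unfolding pbound_def by (rule exI[of _ 1]) simp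

lemma pbound_add [pbound_intros]:
  assumes "pbound f" "pbound g"
  shows "pbound (\<lambda>x. f x + g x)"
proof -
  obtain a b where a: "\<And>x. f x \<le> (sz x + 2) ^ a" and b: "\<And>x. g x \<le> (sz x + 2) ^ b"
    using assms unfolding pbound_def by blast
  have "f x + g x \<le> (sz x + 2) ^ (Suc (max a b))" for x
  proof -
    have "f x \<le> (sz x + 2) ^ max a b" "g x \<le> (sz x + 2) ^ max a b"
      using a[of x] b[of x] power_increasing[of a "max a b" "sz x + 2"]
        power_increasing[of b "max a b" "sz x + 2"] by linarith+
    then have "f x + g x \<le> 2 * (sz x + 2) ^ max a b" by linarith
    also have "\<dots> \<le> (sz x + 2) * (sz x + 2) ^ max a b" by (rule mult_right_mono) simp_all
    finally show ?thesis by simp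
  qed
  then show ?thesis unfolding pbound_def by blast
qed

lemma pbound_mult [pbound_intros]:
  assumes "pbound f" "pbound g"
  shows "pbound (\<lambda>x. f x * g x)"
proof -
  obtain a b where a: "\<And>x. f x \<le> (sz x + 2) ^ a" and b: "\<And>x. g x \<le> (sz x + 2) ^ b"
    using assms unfolding pbound_def by blast
  have "f x * g x \<le> (sz x + 2) ^ (a + b)" for x
    using mult_mono[OF a[of x] b[of x]] by (simp add: power_add)
  then show ?thesis unfolding pbound_def by blast
qed

lemma pbound_power [pbound_intros]:
  "pbound f \<Longrightarrow> pbound (\<lambda>x. f x ^ k)"
  by (induction k) (auto intro: pbound_intros)

lemma pbound_comp:
  assumes "pbound g" "pbound (\<lambda>x. sz (u x))"
  shows "pbound (\<lambda>x. g (u x))"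
proof -
  obtain a where a: "\<And>x. g x \<le> (sz x + 2) ^ a"
    using assms(1) unfolding pbound_def by blast
  have "pbound (\<lambda>x. (sz (u x) + 2) ^ a)" by (intro pbound_intros assms)
  then show ?thesis by (rule pbound_mono) (rule a)
qed

section \<open>Functions computed by programs in polynomial time\<close>

text \<open>
  The second argument of \<open>Q\<close> is what remains of the budget \<open>N\<close>, so that sequential composition passes
  the budget on and no time has to be named in advance.
\<close>

definition wp :: "com \<Rightarrow> (nat \<Rightarrow> val) \<Rightarrow> nat \<Rightarrow> ((nat \<Rightarrow> val) \<Rightarrow> nat \<Rightarrow> bool) \<Rightarrow> bool" where
  "wp c s N Q \<longleftrightarrow> (\<exists>t s' M. exec c s t s' \<and> t + M \<le> N \<and> Q s' M)"

lemma wpI: "exec c s t s' \<Longrightarrow> t + M \<le> N \<Longrightarrow> Q s' M \<Longrightarrow> wp c s N Q"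
  unfolding wp_def by blast

lemma wp_Assign:
  "1 + exp_cost a \<le> N \<Longrightarrow> Q (s(x := eval_exp a s)) (N - (1 + exp_cost a)) \<Longrightarrow> wp (Assign x a) s N Q"
  by (rule wpI[OF exec.Assign]) auto

lemma wp_Seq:
  assumes "1 \<le> N" "wp c s (N - 1) (\<lambda>s' M. wp d s' M Q)"
  shows "wp (Seq c d) s N Q"
proof -
  from assms(2) obtain t s' M t' s'' M' where "exec c s t s'" "t + M \<le> N - 1" "exec d s' t' s''"
      "t' + M' \<le> M" "Q s'' M'"
    unfolding wp_def by blast
  then show ?thesis
    unfolding wp_def using exec.Seq[of c s t s' d t' s''] assms(1)
    by (intro exI[of _ "1 + t + t'"] exI[of _ s''] exI[of _ M']) auto
qed

lemma wp_Cond: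
  assumes "1 + exp_cost a \<le> N"
    and "eval_exp a s \<noteq> Nul \<Longrightarrow> wp c s (N - (1 + exp_cost a)) Q"
    and "eval_exp a s = Nul \<Longrightarrow> wp d s (N - (1 + exp_cost a)) Q"
  shows "wp (Cond a c d) s N Q"
proof -
  obtain b where b: "b = (if eval_exp a s \<noteq> Nul then c else d)" "wp b s (N - (1 + exp_cost a)) Q"
    using assms(2,3) by auto
  from b(2) obtain t s' M where t: "exec b s t s'" "t + M \<le> N - (1 + exp_cost a)" "Q s' M"
    unfolding wp_def by blast
  then have "exec (Cond a c d) s (1 + exp_cost a + t) s'"
    using b(1) exec.CondTrue[of a s c t s' d] exec.CondFalse[of a s d t s' c] by (auto split: if_splits)
  then show ?thesis
    unfolding wp_def using t assms(1)
    by (intro exI[of _ "1 + exp_cost a + t"] exI[of _ s'] exI[of _ M]) auto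
qed

lemma wp_WhileTrue:
  assumes "eval_exp a s \<noteq> Nul" "1 + exp_cost a \<le> N"
    and "wp c s (N - (1 + exp_cost a)) (\<lambda>s' M. wp (While a c) s' M Q)"
  shows "wp (While a c) s N Q"
proof -
  from assms(3) obtain t s' M t' s'' M' where "exec c s t s'" "t + M \<le> N - (1 + exp_cost a)"
      "exec (While a c) s' t' s''" "t' + M' \<le> M" "Q s'' M'"
    unfolding wp_def by blast
  then show ?thesis
    unfolding wp_def using exec.WhileTrue[OF assms(1), of c t s' t' s''] assms(2)
    by (intro exI[of _ "1 + exp_cost a + t + t'"] exI[of _ s''] exI[of _ M']) auto
qed

lemma wp_WhileFalse:
  "eval_exp a s = Nul \<Longrightarrow> 1 + exp_cost a \<le> N \<Longrightarrow> Q s (N - (1 + exp_cost a)) \<Longrightarrow> wp (While a c) s N Q"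
  by (rule wpI[OF exec.WhileFalse]) auto

lemma wp_use:
  assumes "wp c s N P" "N \<le> B" "\<And>s' M. P s' M \<Longrightarrow> Q s' (B - N)"
  shows "wp c s B Q"
proof -
  from assms(1) obtain t s' M where t: "exec c s t s'" "t + M \<le> N" "P s' M" unfolding wp_def by blast
  then show ?thesis
    unfolding wp_def using assms(2,3) by (intro exI[of _ t] exI[of _ s'] exI[of _ "B - N"]) auto
qed

text \<open>
  Registers are used like a stack: a program for \<open>f\<close> reads its argument from register \<open>k\<close> and leaves
  its result there, may use all higher registers as scratch space and preserves all lower ones.
  Programs are combined by running a part at a higher \<open>k\<close>.
\<close>

definition realizes :: "com \<Rightarrow> nat \<Rightarrow> ('a::enc \<Rightarrow> 'b::enc) \<Rightarrow> ('a \<Rightarrow> nat) \<Rightarrow> bool" where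
  "realizes c k f T \<longleftrightarrow> (\<forall>s x. s k = enc x \<longrightarrow>
     wp c s (T x) (\<lambda>s' _. s' k = enc (f x) \<and> (\<forall>i<k. s' i = s i)))"

text \<open>
  The time bound is chosen before \<open>k\<close>: moving a program to other registers does not change its cost.
  The size of the result is bounded as well, because time counts steps, not nodes, and otherwise
  composition would not preserve polynomial time.
\<close>

definition ptime :: "('a::enc \<Rightarrow> 'b::enc) \<Rightarrow> bool" where
  "ptime f \<longleftrightarrow> pbound (\<lambda>x. sz (f x)) \<and> (\<exists>T. pbound T \<and> (\<forall>k. \<exists>c. realizes c k f T))"

named_theorems ptime_intros

lemma realizesI:
  assumes "\<And>s x. s k = enc x \<Longrightarrow> wp c s (T x) (\<lambda>s' _. s' k = enc (f x) \<and> (\<forall>i<k. s' i = s i))"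
  shows "realizes c k f T"
  using assms by (simp add: realizes_def)

lemma wp_call:
  assumes "realizes c k f T" "s k = enc x" "T x \<le> N"
    and "\<And>s'. s' k = enc (f x) \<Longrightarrow> \<forall>i<k. s' i = s i \<Longrightarrow> Q s' (N - T x)"
  shows "wp c s N Q"
proof (rule wp_use[OF _ assms(3)])
  show "wp c s (T x) (\<lambda>s' _. s' k = enc (f x) \<and> (\<forall>i<k. s' i = s i))"
    using assms(1,2) by (simp add: realizes_def)
qed (use assms(4) in auto)

lemma ptimeE:
  assumes "ptime f"
  obtains T c where "pbound (\<lambda>x. sz (f x))" "pbound T" "\<And>k. realizes (c k) k f T"
  using assms unfolding ptime_def by metis

lemma pbound_sz [pbound_intros]: "ptime f \<Longrightarrow> pbound (\<lambda>x. sz (f x))"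
  by (simp add: ptime_def)

lemma ptime_exp:
  assumes "\<And>k s x. s k = enc x \<Longrightarrow> eval_exp (e k) s = enc (f x)"
    and "\<And>k. exp_cost (e k) \<le> C"
    and "pbound (\<lambda>x. sz (f x))"
  shows "ptime f"
  unfolding ptime_def
proof (intro conjI assms(3) exI[of _ "\<lambda>_. 1 + C"] allI)
  show "pbound (\<lambda>_::'a. 1 + C)" by (rule pbound_const)
  fix k
  show "\<exists>c. realizes c k f (\<lambda>_. 1 + C)"
    by (intro exI[of _ "Assign k (e k)"] realizesI wp_Assign)
      (use assms(1) assms(2)[of k] in auto)
qed

text \<open>
  Such a function only changes the type under which a value is seen, such as between \<open>k\<close> and
  \<open>replicate k ()\<close> or between a nonempty list and the pair of its head and tail.
\<close>

lemma ptime_recode: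
  assumes "\<And>x. enc (f x) = enc x"
  shows "ptime f"
  by (rule ptime_exp[of Var _ 1])
    (use assms in \<open>simp_all add: sz_def pbound_sz_self[unfolded sz_def]\<close>)

lemma ptime_id [ptime_intros]: "ptime (\<lambda>x. x)"
  by (rule ptime_recode) simp

primrec quote_val :: "val \<Rightarrow> exp" where
  "quote_val Nul = Null"
| "quote_val (Dot a b) = Cons (quote_val a) (quote_val b)"

lemma eval_quote_val [simp]: "eval_exp (quote_val v) s = v"
  by (induction v) simp_all

lemma ptime_const [ptime_intros]: "ptime (\<lambda>x. c)"
  by (rule ptime_exp[of "\<lambda>_. quote_val (enc c)" _ "exp_cost (quote_val (enc c))"])
    (simp_all add: pbound_const)

lemma ptime_comp:
  fixes f :: "'b::enc \<Rightarrow> 'c::enc" and u :: "'a::enc \<Rightarrow> 'b"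
  assumes "ptime f" "ptime u"
  shows "ptime (\<lambda>x. f (u x))"
proof -
  obtain Tf cf where f: "pbound (\<lambda>x. sz (f x))" "pbound Tf" "\<And>k. realizes (cf k) k f Tf"
    by (rule ptimeE[OF assms(1)]) blast
  obtain Tu cu where u: "pbound (\<lambda>x. sz (u x))" "pbound Tu" "\<And>k. realizes (cu k) k u Tu"
    by (rule ptimeE[OF assms(2)]) blast
  show ?thesis
    unfolding ptime_def
  proof (intro conjI exI[of _ "\<lambda>x. 1 + Tu x + Tf (u x)"] allI)
    show "pbound (\<lambda>x. sz (f (u x)))"
      using pbound_comp[OF f(1) u(1)] .
    show "pbound (\<lambda>x. 1 + Tu x + Tf (u x))"
      by (intro pbound_intros u pbound_comp[OF f(2) u(1)])
    fix k
    show "\<exists>c. realizes c k (\<lambda>x. f (u x)) (\<lambda>x. 1 + Tu x + Tf (u x))"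
    proof (intro exI[of _ "Seq (cu k) (cf k)"] realizesI)
      fix s :: "nat \<Rightarrow> val" and x :: 'a assume "s k = enc x"
      then show "wp (Seq (cu k) (cf k)) s (1 + Tu x + Tf (u x)) (\<lambda>s' _. s' k = enc (f (u x)) \<and> (\<forall>i<k. s' i = s i))"
        by (intro wp_Seq wp_call[OF u(3), where x = x] wp_call[OF f(3), where x = "u x"]) auto
    qed
  qed
qed

lemma ptime_Pair [ptime_intros]:
  fixes f :: "'a::enc \<Rightarrow> 'b::enc" and g :: "'a \<Rightarrow> 'c::enc"
  assumes "ptime f" "ptime g"
  shows "ptime (\<lambda>x. (f x, g x))"
proof -
  obtain Tf cf where f: "pbound (\<lambda>x. sz (f x))" "pbound Tf" "\<And>k. realizes (cf k) k f Tf"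
    by (rule ptimeE[OF assms(1)]) blast
  obtain Tg cg where g: "pbound (\<lambda>x. sz (g x))" "pbound Tg" "\<And>k. realizes (cg k) k g Tg"
    by (rule ptimeE[OF assms(2)]) blast
  show ?thesis
    unfolding ptime_def
  proof (intro conjI exI[of _ "\<lambda>x. 12 + Tf x + Tg x"] allI)
    show "pbound (\<lambda>x. sz (f x, g x))" by (simp, rule pbound_mono[of "\<lambda>x. 1 + sz (f x) + sz (g x)"])
        (intro pbound_intros f g, simp)
    show "pbound (\<lambda>x. 12 + Tf x + Tg x)" by (intro pbound_intros f g)
    fix k
    let ?c = "Seq (Assign (k+1) (Var k)) (Seq (cf (k+1)) (Seq (Assign (k+2) (Var k))
      (Seq (cg (k+2)) (Assign k (Cons (Var (k+1)) (Var (k+2)))))))"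
    show "\<exists>c. realizes c k (\<lambda>x. (f x, g x)) (\<lambda>x. 12 + Tf x + Tg x)"
    proof (intro exI[of _ ?c] realizesI)
      fix s :: "nat \<Rightarrow> val" and x :: 'a assume "s k = enc x"
      then show "wp ?c s (12 + Tf x + Tg x) (\<lambda>s' _. s' k = enc (f x, g x) \<and> (\<forall>i<k. s' i = s i))"
        by (intro wp_Seq wp_Assign wp_call[OF f(3), where x = x] wp_call[OF g(3), where x = x]) auto
    qed
  qed
qed

lemma ptime_If [ptime_intros]:
  fixes f g :: "'a::enc \<Rightarrow> 'b::enc"
  assumes "ptime b" "ptime f" "ptime g"
  shows "ptime (\<lambda>x. if b x then f x else g x)"
proof -
  obtain Tb cb where b: "pbound Tb" "\<And>k. realizes (cb k) k b Tb"
    by (rule ptimeE[OF assms(1)]) blast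
  obtain Tf cf where f: "pbound (\<lambda>x. sz (f x))" "pbound Tf" "\<And>k. realizes (cf k) k f Tf"
    by (rule ptimeE[OF assms(2)]) blast
  obtain Tg cg where g: "pbound (\<lambda>x. sz (g x))" "pbound Tg" "\<And>k. realizes (cg k) k g Tg"
    by (rule ptimeE[OF assms(3)]) blast
  show ?thesis
    unfolding ptime_def
  proof (intro conjI exI[of _ "\<lambda>x. 6 + Tb x + Tf x + Tg x"] allI)
    show "pbound (\<lambda>x. sz (if b x then f x else g x))"
      by (rule pbound_mono[of "\<lambda>x. sz (f x) + sz (g x)"]) (intro pbound_intros f g, simp)
    show "pbound (\<lambda>x. 6 + Tb x + Tf x + Tg x)" by (intro pbound_intros b f g)
    fix k
    let ?c = "Seq (Assign (k+1) (Var k)) (Seq (cb (k+1)) (Cond (Var (k+1)) (cf k) (cg k)))"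
    show "\<exists>c. realizes c k (\<lambda>x. if b x then f x else g x) (\<lambda>x. 6 + Tb x + Tf x + Tg x)"
    proof (intro exI[of _ ?c] realizesI)
      fix s :: "nat \<Rightarrow> val" and x :: 'a assume "s k = enc x"
      then show "wp ?c s (6 + Tb x + Tf x + Tg x) (\<lambda>s' _. s' k = enc (if b x then f x else g x) \<and> (\<forall>i<k. s' i = s i))"
        by (intro wp_Seq wp_Assign wp_Cond wp_call[OF b(2), where x = x] wp_call[OF f(3), where x = x]
            wp_call[OF g(3), where x = x]) (auto split: if_splits)
    qed
  qed
qed

text \<open>
  The environment stays in register \<open>k\<close>, the rest of the list is in \<open>k+1\<close> and the accumulator in
  \<open>k+2\<close>; the body assembles the argument of the step function in \<open>k+3\<close> and finds the new accumulator
  there.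
\<close>

definition fold_loop :: "com \<Rightarrow> nat \<Rightarrow> com" where
  "fold_loop c k = While (Var (k+1))
     (Seq (Assign (k+3) (Cons (Var k) (Cons (Hd (Var (k+1))) (Var (k+2)))))
     (Seq c (Seq (Assign (k+2) (Var (k+3))) (Assign (k+1) (Tl (Var (k+1)))))))"

lemma wp_fold_loop:
  fixes f :: "'a::enc \<Rightarrow> 'e::enc \<Rightarrow> 'b::enc \<Rightarrow> 'b"
  assumes step: "realizes c (k+3) (\<lambda>p. f (fst p) (fst (snd p)) (snd (snd p))) T"
    and time: "\<forall>us y vs. ys = us @ y # vs \<longrightarrow> T (x, y, fold (f x) us acc) \<le> B"
    and s: "s k = enc x" "s (k+1) = enc ys" "s (k+2) = enc acc"
  shows "wp (fold_loop c k) s (2 + length ys * (B + 17))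
    (\<lambda>s' _. s' (k+2) = enc (fold (f x) ys acc) \<and> (\<forall>i<k. s' i = s i))"
  using time s
proof (induction ys arbitrary: acc s)
  case Nil
  then show ?case unfolding fold_loop_def by (intro wp_WhileFalse) auto
next
  case (Cons y ys)
  have "\<forall>us v vs. ys = us @ v # vs \<longrightarrow> T (x, v, fold (f x) us (f x y acc)) \<le> B"
    using Cons.prems(1) by (metis append_Cons fold_simps(2))
  note IH = Cons.IH[OF this, unfolded fold_loop_def]
  have T: "T (x, y, acc) \<le> B" using Cons.prems(1) by (metis append_Nil fold_simps(1))
  have budget: "2 + length (y # ys) * (B + 17) = (B + 17) + (2 + length ys * (B + 17))" by simp
  show ?case
    unfolding fold_loop_def budget
    by (rule wp_WhileTrue, use Cons.prems(3) in simp, simp,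
        intro wp_Seq wp_Assign wp_call[OF step, where x = "(x, y, acc)"] wp_use[OF IH])
      (use T Cons.prems(2-4) in auto)
qed

text \<open>
  A fold can double its accumulator in every step and thus leave polynomial time although its step
  function is polynomial. Hence the separate bound on the accumulators after all prefixes.

  Open terms are handled by pairing: a function of an environment and of bound variables is
  polynomial-time when the function of the tuple of all of them is. The rules for maps, filters and
  quantifiers follow the same pattern.
\<close>

lemma ptime_fold:
  fixes f :: "'a::enc \<Rightarrow> 'e::enc \<Rightarrow> 'b::enc \<Rightarrow> 'b"
  assumes "ptime (\<lambda>p. f (fst p) (fst (snd p)) (snd (snd p)))" "ptime l" "ptime a"
    and bound: "pbound B" "\<And>x us vs. l x = us @ vs \<Longrightarrow> sz (fold (f x) us (a x)) \<le> B x"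
  shows "ptime (\<lambda>x. fold (f x) (l x) (a x))"
proof -
  obtain Tf cf where f: "pbound Tf" "\<And>k. realizes (cf k) k (\<lambda>p. f (fst p) (fst (snd p)) (snd (snd p))) Tf"
    by (rule ptimeE[OF assms(1)]) blast
  obtain Tll cl where l: "pbound (\<lambda>x. sz (l x))" "pbound Tll" "\<And>k. realizes (cl k) k l Tll"
    by (rule ptimeE[OF assms(2)]) blast
  obtain Ta ca where a: "pbound (\<lambda>x. sz (a x))" "pbound Ta" "\<And>k. realizes (ca k) k a Ta"
    by (rule ptimeE[OF assms(3)]) blast
  obtain e where e: "\<And>p. Tf p \<le> (sz p + 2) ^ e" using f(1) unfolding pbound_def by blast
  \<comment> \<open>a bound on a single step: its argument consists of the environment, a list element and an accumulator\<close>
  define W where "W = (\<lambda>x. (sz x + sz (l x) + B x + 4) ^ e)"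
  have W: "pbound W" unfolding W_def by (intro pbound_intros pbound_sz_self l bound)
  have Tf: "\<forall>us y vs. l x = us @ y # vs \<longrightarrow> Tf (x, y, fold (f x) us (a x)) \<le> W x" for x
  proof (intro allI impI)
    fix us y vs assume that: "l x = us @ y # vs"
    have "sz y \<le> sz (l x)" using sz_mem_le[of y "l x"] that by simp
    moreover have "sz (fold (f x) us (a x)) \<le> B x" using bound(2) that by blast
    ultimately have "(sz (x, y, fold (f x) us (a x)) + 2) ^ e \<le> W x"
      unfolding W_def by (intro power_mono) simp_all
    then show "Tf (x, y, fold (f x) us (a x)) \<le> W x" using e le_trans by blast
  qed
  show ?thesis
    unfolding ptime_def
  proof (intro conjI exI[of _ "\<lambda>x. 20 + Tll x + Ta x + sz (l x) * (W x + 17)"] allI)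
    show "pbound (\<lambda>x. sz (fold (f x) (l x) (a x)))"
      by (rule pbound_mono[OF bound(1)]) (use bound(2)[of _ _ "[]"] in simp)
    show "pbound (\<lambda>x. 20 + Tll x + Ta x + sz (l x) * (W x + 17))"
      by (intro pbound_intros l a W)
    fix k
    let ?c = "Seq (Assign (k+1) (Var k)) (Seq (cl (k+1)) (Seq (Assign (k+2) (Var k))
      (Seq (ca (k+2)) (Seq (fold_loop (cf (k+3)) k) (Assign k (Var (k+2)))))))"
    show "\<exists>c. realizes c k (\<lambda>x. fold (f x) (l x) (a x))
        (\<lambda>x. 20 + Tll x + Ta x + sz (l x) * (W x + 17))"
    proof (intro exI[of _ ?c] realizesI)
      fix s :: "nat \<Rightarrow> val" and x :: 'a assume sk: "s k = enc x"
      have "length (l x) * (W x + 17) \<le> sz (l x) * (W x + 17)"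
        by (intro mult_right_mono length_le_sz) simp
      then obtain z where z: "sz (l x) * (W x + 17) = length (l x) * (W x + 17) + z"
        using le_Suc_ex by blast
      show "wp ?c s (20 + Tll x + Ta x + sz (l x) * (W x + 17))
          (\<lambda>s' _. s' k = enc (fold (f x) (l x) (a x)) \<and> (\<forall>i<k. s' i = s i))"
        unfolding z using sk
        by (intro wp_Seq wp_Assign wp_call[OF l(3), where x = x] wp_call[OF a(3), where x = x]
            wp_use[OF wp_fold_loop[OF f(2) Tf]]) auto
    qed
  qed
qed

section \<open>A library of polynomial-time functions\<close>

lemma ptime_recode_result:
  assumes "ptime f" "\<And>x. enc (g x) = enc (f x)"
  shows "ptime g"
  using assms unfolding ptime_def realizes_def sz_def by simp

lemma ptime_comp2:
  assumes "ptime (\<lambda>p. f (fst p) (snd p))" "ptime a" "ptime b"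
  shows "ptime (\<lambda>x. f (a x) (b x))"
  using ptime_comp[OF assms(1) ptime_Pair[OF assms(2,3)]] by simp

lemma ptime_fst [ptime_intros]: "ptime u \<Longrightarrow> ptime (\<lambda>x. fst (u x))"
  by (rule ptime_comp[of fst u], rule ptime_exp[of "\<lambda>k. Hd (Var k)" _ 2])
    (auto simp: enc_prod_def intro: pbound_mono[OF pbound_sz_self] sz_fst_le)

lemma ptime_snd [ptime_intros]: "ptime u \<Longrightarrow> ptime (\<lambda>x. snd (u x))"
  by (rule ptime_comp[of snd u], rule ptime_exp[of "\<lambda>k. Tl (Var k)" _ 2])
    (auto simp: enc_prod_def intro: pbound_mono[OF pbound_sz_self] sz_snd_le)

lemma ptime_Cons [ptime_intros]:
  "ptime a \<Longrightarrow> ptime b \<Longrightarrow> ptime (\<lambda>x. a x # b x)"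
  by (rule ptime_recode_result[where f = "\<lambda>x. (a x, b x)"]) (auto intro: ptime_intros)

lemma ptime_Some [ptime_intros]: "ptime a \<Longrightarrow> ptime (\<lambda>x. Some (a x))"
  by (rule ptime_recode_result[where f = "\<lambda>x. ((), a x)"]) (auto intro: ptime_intros)

lemma enc_replicate: "enc (replicate n ()) = enc n"
  by (induction n) simp_all

lemma ptime_replicate_unit: "ptime u \<Longrightarrow> ptime (\<lambda>x. replicate (u x) ())"
  by (rule ptime_recode_result[where f = u]) (simp_all add: enc_replicate)

lemma ptime_tl [ptime_intros]:
  fixes u :: "'a::enc \<Rightarrow> 'b::enc list"
  assumes "ptime u" shows "ptime (\<lambda>x. tl (u x))"
proof (rule ptime_comp[OF _ assms], rule ptime_exp[of "\<lambda>k. Tl (Var k)" _ 2])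
  show "eval_exp (Tl (Var k)) s = enc (tl xs)" if "s k = enc xs" for k s and xs :: "'b list"
    using that by (cases xs) auto
  have "sz (tl xs) \<le> sz xs" for xs :: "'b list" by (cases xs) auto
  then show "pbound (\<lambda>xs::'b list. sz (tl xs))" by (rule pbound_mono[OF pbound_sz_self])
qed simp

lemma ptime_pred: "ptime u \<Longrightarrow> ptime (\<lambda>x. u x - Suc 0)"
  by (rule ptime_recode_result[where f = "\<lambda>x. tl (replicate (u x) ())"],
      intro ptime_intros ptime_replicate_unit)
    (simp_all add: enc_replicate del: tl_replicate, simp add: enc_replicate)

lemma ptime_not [ptime_intros]: "ptime P \<Longrightarrow> ptime (\<lambda>x. \<not> P x)"
  by (rule ptime_recode_result[where f = "\<lambda>x. if P x then False else True"])
    (simp_all add: ptime_If ptime_const)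

lemma ptime_conj [ptime_intros]: "ptime P \<Longrightarrow> ptime Q \<Longrightarrow> ptime (\<lambda>x. P x \<and> Q x)"
  by (rule ptime_recode_result[where f = "\<lambda>x. if P x then Q x else False"])
    (simp_all add: ptime_If ptime_const)

lemma ptime_disj [ptime_intros]: "ptime P \<Longrightarrow> ptime Q \<Longrightarrow> ptime (\<lambda>x. P x \<or> Q x)"
  using ptime_not[OF ptime_conj[OF ptime_not[of P] ptime_not[of Q]]] by simp

lemma ptime_imp [ptime_intros]: "ptime P \<Longrightarrow> ptime Q \<Longrightarrow> ptime (\<lambda>x. P x \<longrightarrow> Q x)"
  by (rule ptime_recode_result[where f = "\<lambda>x. if P x then Q x else True"])
    (simp_all add: ptime_If ptime_const)

lemma ptime_bool_eq [ptime_intros]: "ptime P \<Longrightarrow> ptime Q \<Longrightarrow> ptime (\<lambda>x. P x = (Q x::bool))"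
  by (rule ptime_recode_result[where f = "\<lambda>x. if P x then Q x else \<not> Q x"])
    (simp_all add: ptime_If ptime_not)

text \<open>
  The quantifier ranges over constants; the program contains one copy of the test for each of them.
\<close>

lemma ptime_ball_const [ptime_intros]:
  "finite I \<Longrightarrow> (\<And>i. i \<in> I \<Longrightarrow> ptime (\<lambda>x. P x i)) \<Longrightarrow> ptime (\<lambda>x. \<forall>i\<in>I. P x i)"
  by (induction I rule: finite_induct) (simp_all add: ptime_intros)

lemma ptime_fold_invariant:
  fixes f :: "'a::enc \<Rightarrow> 'e::enc \<Rightarrow> 'b::enc \<Rightarrow> 'b"
  assumes "ptime (\<lambda>p. f (fst p) (fst (snd p)) (snd (snd p)))" "ptime l" "ptime a"
    and "\<And>x. I x (a x)"
    and "\<And>x y b. y \<in> set (l x) \<Longrightarrow> I x b \<Longrightarrow> I x (f x y b)"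
    and "pbound B" "\<And>x b. I x b \<Longrightarrow> sz b \<le> B x"
  shows "ptime (\<lambda>x. fold (f x) (l x) (a x))"
proof (rule ptime_fold[OF assms(1-3) assms(6)])
  fix x us vs assume "l x = us @ vs"
  then have "I x (fold (f x) us (a x))"
    by (intro fold_invariant[where Q = "\<lambda>y. y \<in> set (l x)" and P = "I x"] assms(4,5)) auto
  then show "sz (fold (f x) us (a x)) \<le> B x" by (rule assms(7))
qed

lemma ptime_last_or:
  fixes u :: "'a::enc \<Rightarrow> 'b::enc list"
  assumes "ptime u" "ptime d"
  shows "ptime (\<lambda>x. fold (\<lambda>y _. y) (u x) (d x))"
proof (rule ptime_fold_invariant[where f = "\<lambda>x y _. y" and I = "\<lambda>x b. b = d x \<or> b \<in> set (u x)", OF _ assms])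
  show "ptime (\<lambda>p::'a \<times> 'b \<times> 'b. fst (snd p))" by (intro ptime_intros)
  show "pbound (\<lambda>x. sz (u x) + sz (d x))" by (intro pbound_intros assms)
qed (auto dest: sz_mem_le)

lemma ptime_rev [ptime_intros]:
  fixes u :: "'a::enc \<Rightarrow> 'b::enc list"
  assumes "ptime u"
  shows "ptime (\<lambda>x. rev (u x))"
proof -
  have "ptime (\<lambda>x. fold (\<lambda>y b. y # b) (u x) [])"
  proof (rule ptime_fold[where f = "\<lambda>x y b. y # b", OF _ assms ptime_const])
    show "ptime (\<lambda>p::'a \<times> 'b \<times> 'b list. fst (snd p) # snd (snd p))" by (intro ptime_intros)
    show "pbound (\<lambda>x. sz (u x))" by (intro pbound_intros assms)
    have rev: "fold (\<lambda>y b. y # b) us [] = rev us" for us :: "'b list" by (simp add: fold_Cons_rev)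
    show "sz (fold (\<lambda>y b. y # b) us []) \<le> sz (u x)" if "u x = us @ vs" for x us vs
      unfolding rev that by (simp add: sz_list rev_map[symmetric] sum_list_rev)
  qed
  then show ?thesis by (simp add: fold_Cons_rev)
qed

lemma sz_map_le: "(\<And>y. y \<in> set us \<Longrightarrow> sz (f y) \<le> b) \<Longrightarrow> sz (map f us) \<le> 1 + length us * (b + 1)"
  using sz_list_le[of "map f us" b] by auto

lemma ptime_map [ptime_intros]:
  fixes f :: "'a::enc \<Rightarrow> 'e::enc \<Rightarrow> 'b::enc"
  assumes f: "ptime (\<lambda>p. f (fst p) (snd p))" and u: "ptime u"
  shows "ptime (\<lambda>x. map (f x) (u x))"
proof -
  obtain e where e': "\<And>p. sz (f (fst p) (snd p)) \<le> (sz p + 2) ^ e"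
    using pbound_sz[OF f] unfolding pbound_def by blast
  have e: "sz (f x y) \<le> (sz x + sz y + 3) ^ e" for x y
  proof -
    have "sz (x, y) + 2 = sz x + sz y + 3" by simp
    then show ?thesis using e'[of "(x, y)"] by (simp only: fst_conv snd_conv)
  qed
  have eq: "fold (\<lambda>y b. f x y # b) us [] = rev (map (f x) us)" for x us
    by (induction us rule: rev_induct) simp_all
  have "ptime (\<lambda>x. fold (\<lambda>y b. f x y # b) (u x) [])"
  proof (rule ptime_fold[where f = "\<lambda>x y b. f x y # b", OF _ u ptime_const])
    show "ptime (\<lambda>p::'a \<times> 'e \<times> 'b list. f (fst p) (fst (snd p)) # snd (snd p))"
      by (intro ptime_comp2[OF f] ptime_intros)
    show "pbound (\<lambda>x. 1 + sz (u x) * ((sz x + sz (u x) + 3) ^ e + 1))"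
      by (intro pbound_intros u pbound_sz_self)
    fix x us vs assume x: "u x = us @ vs"
    have "sz (rev (map (f x) us)) \<le> 1 + length (rev us) * ((sz x + sz (u x) + 3) ^ e + 1)"
      unfolding rev_map
    proof (rule sz_map_le)
      fix y assume "y \<in> set (rev us)"
      then have "sz y \<le> sz (u x)" using sz_mem_le[of y "u x"] x by auto
      then have "(sz x + sz y + 3) ^ e \<le> (sz x + sz (u x) + 3) ^ e" by (intro power_mono) auto
      then show "sz (f x y) \<le> (sz x + sz (u x) + 3) ^ e" using e[of x y] by linarith
    qed
    moreover have "length (rev us) \<le> sz (u x)" using x length_le_sz[of "u x"] by simp
    ultimately show "sz (fold (\<lambda>y b. f x y # b) us []) \<le> 1 + sz (u x) * ((sz x + sz (u x) + 3) ^ e + 1)"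
      unfolding eq by (meson add_left_mono le_trans mult_le_mono1)
  qed
  then have "ptime (\<lambda>x. rev (fold (\<lambda>y b. f x y # b) (u x) []))" by (rule ptime_rev)
  then show ?thesis by (simp add: eq)
qed

lemma sz_prefix_le: "sz us \<le> sz (us @ vs)"
  by (simp add: sz_list)

lemma sz_rev [simp]: "sz (rev xs) = sz xs"
  by (simp add: sz_list rev_map[symmetric] sum_list_rev)

lemma ptime_append [ptime_intros]:
  fixes u v :: "'a::enc \<Rightarrow> 'b::enc list"
  assumes u: "ptime u" and v: "ptime v"
  shows "ptime (\<lambda>x. u x @ v x)"
proof -
  have "ptime (\<lambda>x. fold (\<lambda>y b. y # b) (rev (u x)) (v x))"
  proof (rule ptime_fold[where f = "\<lambda>x y b. y # b", OF _ ptime_rev[OF u] v])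
    show "ptime (\<lambda>p::'a \<times> 'b \<times> 'b list. fst (snd p) # snd (snd p))" by (intro ptime_intros)
    show "pbound (\<lambda>x. sz (u x) + sz (v x))" by (intro pbound_intros u v)
    fix x us vs assume x: "rev (u x) = us @ vs"
    have "sz us \<le> sz (u x)" using sz_prefix_le[of us vs] x by (metis sz_rev)
    moreover have "fold (\<lambda>y b. y # b) us (v x) = rev us @ v x" by (simp add: fold_Cons_rev)
    ultimately show "sz (fold (\<lambda>y b. y # b) us (v x)) \<le> sz (u x) + sz (v x)"
      using sz_append[of "rev us" "v x"] by (simp only: sz_rev)
  qed
  then show ?thesis by (simp add: fold_Cons_rev)
qed

lemma ptime_concat [ptime_intros]:
  fixes u :: "'a::enc \<Rightarrow> 'b::enc list list"
  assumes u: "ptime u"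
  shows "ptime (\<lambda>x. concat (u x))"
proof -
  have eq: "fold (\<lambda>y b. b @ y) us b = b @ concat us" for us and b :: "'b list"
    by (induction us arbitrary: b) auto
  have "ptime (\<lambda>x. fold (\<lambda>y b. b @ y) (u x) [])"
  proof (rule ptime_fold[where f = "\<lambda>x y b. b @ y", OF _ u ptime_const])
    show "ptime (\<lambda>p::'a \<times> 'b list \<times> 'b list. snd (snd p) @ fst (snd p))" by (intro ptime_intros)
    show "pbound (\<lambda>x. sz (u x))" by (intro pbound_intros u)
    have "sz (concat us) \<le> sz us" for us :: "'b list list"
    proof (induction us)
      case (Cons y us)
      then show ?case using sz_append[of y "concat us"] by simp
    qed simp
    then show "sz (fold (\<lambda>y b. b @ y) us []) \<le> sz (u x)" if "u x = us @ vs" for x us vs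
      unfolding eq that using sz_prefix_le[of us vs] le_trans by fastforce
  qed
  then show ?thesis by (simp add: eq)
qed

lemma ptime_filter [ptime_intros]:
  fixes P :: "'a::enc \<Rightarrow> 'e::enc \<Rightarrow> bool"
  assumes P: "ptime (\<lambda>p. P (fst p) (snd p))" and u: "ptime u"
  shows "ptime (\<lambda>x. filter (P x) (u x))"
proof -
  have "filter (P x) us = concat (map (\<lambda>y. if P x y then [y] else []) us)" for x us
    by (induction us) simp_all
  then show ?thesis by (simp only:) (intro ptime_intros P u)
qed

lemma ptime_is_Nil [ptime_intros]:
  assumes u: "ptime u" shows "ptime (\<lambda>x. u x = [])"
proof -
  have "us = [] \<longleftrightarrow> fold (\<lambda>_ _. False) us True" for us :: "'b list"
    by (induction us) (simp_all add: fold_invariant[where P = "\<lambda>b. \<not> b" and Q = "\<lambda>_. True"])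
  note Nil_fold = this
  show ?thesis
    unfolding Nil_fold
    by (rule ptime_fold_invariant[where f = "\<lambda>_ _ _. False" and I = "\<lambda>_ _. True" and B = "\<lambda>_. 3"])
      (auto intro: u ptime_const pbound_const sz_bool_le)
qed

lemma ptime_ball_set [ptime_intros]:
  fixes P :: "'a::enc \<Rightarrow> 'e::enc \<Rightarrow> bool"
  assumes P: "ptime (\<lambda>p. P (fst p) (snd p))" and u: "ptime u"
  shows "ptime (\<lambda>x. \<forall>y\<in>set (u x). P x y)"
proof -
  have "ptime (\<lambda>x. filter (\<lambda>y. \<not> P x y) (u x) = [])" by (intro ptime_intros P u)
  then show ?thesis by (simp add: filter_empty_conv)
qed

lemma ptime_bex_set [ptime_intros]:
  fixes P :: "'a::enc \<Rightarrow> 'e::enc \<Rightarrow> bool"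
  assumes P: "ptime (\<lambda>p. P (fst p) (snd p))" and u: "ptime u"
  shows "ptime (\<lambda>x. \<exists>y\<in>set (u x). P x y)"
  using ptime_not[OF ptime_ball_set[OF ptime_not[OF P] u]] by simp

lemma ptime_length [ptime_intros]:
  fixes u :: "'a::enc \<Rightarrow> 'b::enc list"
  assumes u: "ptime u"
  shows "ptime (\<lambda>x. length (u x))"
  by (rule ptime_recode_result[where f = "\<lambda>x. map (\<lambda>_. ()) (u x)"], intro ptime_intros u)
    (simp add: map_replicate_const enc_replicate)

lemma ptime_funpow:
  fixes f :: "'a::enc \<Rightarrow> 'b::enc \<Rightarrow> 'b"
  assumes "ptime (\<lambda>p. f (fst p) (snd p))" "ptime k" "ptime a"
    and "\<And>x. I x (a x)" "\<And>x b. I x b \<Longrightarrow> I x (f x b)"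
    and "pbound B" "\<And>x b. I x b \<Longrightarrow> sz b \<le> B x"
  shows "ptime (\<lambda>x. (f x ^^ k x) (a x))"
proof -
  have eq: "(g ^^ m) b = fold (\<lambda>_. g) (replicate m ()) b" for g :: "'b \<Rightarrow> 'b" and m b
    by (induction m arbitrary: b) (simp_all add: funpow_swap1)
  show ?thesis
    unfolding eq
  proof (rule ptime_fold_invariant[where f = "\<lambda>x _. f x" and I = I and B = B])
    show "ptime (\<lambda>p::'a \<times> unit \<times> 'b. f (fst p) (snd (snd p)))"
      by (intro ptime_comp2[OF assms(1)] ptime_intros)
  qed (use assms in \<open>auto intro: ptime_replicate_unit\<close>)
qed

lemma ptime_diff [ptime_intros]:
  assumes "ptime u" "ptime v"
  shows "ptime (\<lambda>x. u x - (v x :: nat))"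
proof -
  have "((\<lambda>n. n - Suc 0) ^^ k) m = m - k" for k m
    by (induction k) auto
  moreover have "ptime (\<lambda>x. ((\<lambda>n. n - Suc 0) ^^ v x) (u x))"
    by (rule ptime_funpow[where I = "\<lambda>x b. b \<le> u x" and B = "\<lambda>x. sz (u x)"])
      (use assms in \<open>auto intro: ptime_pred[OF ptime_snd[OF ptime_id]] pbound_mono[OF pbound_sz[of u]]\<close>)
  ultimately show ?thesis by simp
qed

lemma ptime_eq_0: "ptime u \<Longrightarrow> ptime (\<lambda>x. u x = (0::nat))"
  using ptime_is_Nil[OF ptime_replicate_unit, of u] by simp

lemma ptime_le [ptime_intros]: "ptime u \<Longrightarrow> ptime v \<Longrightarrow> ptime (\<lambda>x. u x \<le> (v x :: nat))"
  using ptime_eq_0[OF ptime_diff[of u v]] by simp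

lemma ptime_nat_eq [ptime_intros]: "ptime u \<Longrightarrow> ptime v \<Longrightarrow> ptime (\<lambda>x. u x = (v x :: nat))"
  using ptime_conj[OF ptime_le[of u v] ptime_le[of v u]] by (simp add: eq_iff)

lemma ptime_min [ptime_intros]: "ptime u \<Longrightarrow> ptime v \<Longrightarrow> ptime (\<lambda>x. min (u x) (v x :: nat))"
  unfolding min_def by (intro ptime_intros)

text \<open>
  Membership in the finite set or in its finite complement is a comparison with finitely many
  constants.
\<close>

lemma ptime_nat_mem:
  assumes "fin_or_cofin A" "ptime u"
  shows "ptime (\<lambda>x. u x \<in> A)"
proof -
  have fin: "ptime (\<lambda>x. u x \<in> B)" if "finite B" for B
  proof -
    have "ptime (\<lambda>x. \<not> (\<forall>i\<in>B. u x \<noteq> i))" by (intro ptime_intros that assms)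
    then show ?thesis by simp
  qed
  show ?thesis
    using assms(1) fin[of A] ptime_not[OF fin[of "- A"]] by (auto simp: fin_or_cofin_def)
qed

lemma ptime_upt [ptime_intros]:
  assumes u: "ptime u"
  shows "ptime (\<lambda>x. [0..<u x])"
proof -
  have eq: "((\<lambda>b. length b # b) ^^ k) [] = rev [0..<k]" for k
    by (induction k) auto
  have "ptime (\<lambda>x. fold (\<lambda>_ b. length b # b) (replicate (u x) ()) [])"
  proof (rule ptime_fold[where f = "\<lambda>_ _ b. length b # b", OF _ ptime_replicate_unit[OF u] ptime_const])
    show "ptime (\<lambda>p::'a \<times> unit \<times> nat list. length (snd (snd p)) # snd (snd p))"
      by (intro ptime_intros)
    show "pbound (\<lambda>x. 1 + sz (u x) * (sz (u x) + 1))" by (intro pbound_intros u)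
    fix x us vs assume x: "replicate (u x) () = us @ vs"
    have "fold (\<lambda>_ b. length b # b) us [] = rev [0..<length us]"
      by (induction us rule: rev_induct) auto
    moreover have "length us \<le> u x" using arg_cong[OF x, of length] by simp
    moreover have "sz (rev [0..<length us]) \<le> 1 + length (rev [0..<length us]) * (sz (u x) + 1)"
      using calculation(2) by (intro sz_list_le) auto
    moreover have "length us * (sz (u x) + 1) \<le> sz (u x) * (sz (u x) + 1)"
      using calculation(2) by (intro mult_right_mono) auto
    ultimately show "sz (fold (\<lambda>_ b. length b # b) us []) \<le> 1 + sz (u x) * (sz (u x) + 1)"
      by (simp only: length_rev length_upt diff_zero)
  qed
  moreover have "fold (\<lambda>_ b. length b # b) (replicate k ()) [] = rev [0..<k]" for k
    using eq[of k] by (induction k) (auto simp: replicate_append_same[symmetric])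
  ultimately have "ptime (\<lambda>x. rev [0..<u x])" by simp
  from ptime_rev[OF this] show ?thesis by simp
qed

text \<open>
  Programs compute total functions, whereas \<open>xs ! i\<close> is unspecified beyond the end of the list.
\<close>

definition nth_or :: "'a \<Rightarrow> 'a list \<Rightarrow> nat \<Rightarrow> 'a" where
  "nth_or d xs i = (if i < length xs then xs ! i else d)"

lemma nth_or_map_upt [simp]: "nth_or e (map f [0..<k]) v = (if v < k then f v else e)"
  by (simp add: nth_or_def)

lemma ptime_nth_or [ptime_intros]:
  fixes u :: "'a::enc \<Rightarrow> 'b::enc list"
  assumes u: "ptime u" and d: "ptime d" and i: "ptime i"
  shows "ptime (\<lambda>x. nth_or (d x) (u x) (i x))"
proof -
  have last: "fold (\<lambda>y _. y) xs e = (if xs = [] then e else last xs)" for xs and e :: 'b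
    by (induction xs arbitrary: e) auto
  have tl: "(tl ^^ k) xs = drop k xs" for k and xs :: "'b list"
    by (induction k) (simp_all add: drop_Suc drop_tl)
  have "ptime (\<lambda>x. (tl ^^ i x) (u x))"
  proof (rule ptime_funpow[where I = "\<lambda>x b. sz b \<le> sz (u x)"])
    show "ptime (\<lambda>p::'a \<times> 'b list. tl (snd p))" by (intro ptime_intros)
    show "sz (tl b) \<le> sz (u x)" if "sz b \<le> sz (u x)" for x b
      using that by (cases b) auto
  qed (auto intro: i u pbound_sz[OF u])
  then have "ptime (\<lambda>x. fold (\<lambda>y _. y) (rev ((tl ^^ i x) (u x))) (d x))"
    by (intro ptime_last_or ptime_rev d)
  moreover have "fold (\<lambda>y _. y) (rev ((tl ^^ i x) (u x))) (d x) = nth_or (d x) (u x) (i x)" for x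
    by (simp add: last tl nth_or_def last_rev hd_drop_conv_nth)
  ultimately show ?thesis by simp
qed

section \<open>Searches with a growing limit\<close>

text \<open>
  Register \<open>1\<close> counts the limits tried so far in unary, register \<open>2\<close> holds \<open>Nul\<close> once the search has
  succeeded, and \<open>F\<close> is evaluated from register \<open>3\<close> on.
\<close>

definition retry_loop :: "com \<Rightarrow> com" where
  "retry_loop c = While (Var 2) (Seq (Assign 3 (Cons (Var 0) (Var 1)))
     (Seq c (Cond (Var 3) (Assign 2 Null) (Assign 1 (Cons Null (Var 1))))))"

lemma wp_retry_loop:
  fixes F :: "'a::enc \<Rightarrow> nat \<Rightarrow> 'r::enc option"
  assumes c: "realizes c 3 (\<lambda>p. F (fst p) (snd p)) T"
    and T: "\<And>k. k \<le> N \<Longrightarrow> T (x, k) \<le> W"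
    and N: "F x N \<noteq> None" "\<And>k. k < N \<Longrightarrow> F x k = None"
    and s: "k \<le> N" "s 0 = enc x" "s 1 = enc k" "s 2 \<noteq> Nul"
  shows "wp (retry_loop c) s (2 + (N - k + 1) * (W + 20)) (\<lambda>s' _. s' 3 = enc (F x N))"
  using s
proof (induction "N - k" arbitrary: k s)
  case (0 k s)
  have T: "T (x, N) \<le> W" using T by simp
  show ?case
    unfolding retry_loop_def
    by (rule wp_WhileTrue, use 0 in simp, simp,
        intro wp_Seq wp_Assign wp_Cond wp_call[OF c, where x = "(x, N)"])
      (use 0 T N(1) in \<open>auto intro!: wp_WhileFalse wp_Assign\<close>)
next
  case (Suc m k s)
  then have k: "k < N" "T (x, k) \<le> W" using T by simp_all
  have "N - k + 1 = Suc (N - Suc k + 1)" using k by simp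
  then have budget: "2 + (N - k + 1) * (W + 20) = (W + 20) + (2 + (N - Suc k + 1) * (W + 20))"
    by (simp only: mult_Suc)
  have IH: "wp (retry_loop c) s' (2 + (N - Suc k + 1) * (W + 20)) (\<lambda>s' _. s' 3 = enc (F x N))"
    if "s' 0 = enc x" "s' 1 = enc (Suc k)" "s' 2 \<noteq> Nul" for s'
    by (rule Suc.hyps(1)) (use Suc.hyps(2) k that in auto)
  show ?case
    unfolding budget unfolding retry_loop_def
    by (rule wp_WhileTrue, use Suc.prems in simp, simp,
        intro wp_Seq wp_Assign wp_Cond wp_call[OF c, where x = "(x, k)"])
      (use Suc.prems k N(2)[OF k(1)] in \<open>auto intro!: wp_Assign wp_use[OF IH[unfolded retry_loop_def One_nat_def]]\<close>)
qed

text \<open>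
  The least successful limit \<open>M\<close> is at most \<open>N\<close>, so there are at most \<open>N + 1\<close> attempts, each polynomial
  in the input and in \<open>N\<close>. The program depends neither on \<open>x\<close> nor on \<open>N\<close>: it finds a sufficient limit
  without knowing a bound on it.
\<close>

lemma retry_program:
  fixes F :: "'a::enc \<Rightarrow> nat \<Rightarrow> 'r::enc option"
  assumes "ptime (\<lambda>p. F (fst p) (snd p))"
  shows "\<exists>p e. \<forall>x N. F x N \<noteq> None \<longrightarrow>
    (\<exists>M r t. F x M = Some r \<and> computes p (enc x) (enc r) t \<and> t \<le> (sz x + N + 2) ^ e)"
proof -
  obtain T c where T: "pbound T" and c: "\<And>k. realizes (c k) k (\<lambda>p. F (fst p) (snd p)) T"
    by (rule ptimeE[OF assms]) blast
  obtain a where a: "\<And>p. T p \<le> (sz p + 2) ^ a" using T unfolding pbound_def by blast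
  let ?p = "Seq (Assign 2 (Cons Null Null)) (Seq (retry_loop (c 3)) (Assign 0 (Tl (Var 3))))"
  have "\<exists>M r t. F x M = Some r \<and> computes ?p (enc x) (enc r) t \<and> t \<le> (sz x + N + 2) ^ (2 * a + 5)"
    if N: "F x N \<noteq> None" for x N
  proof -
    define M where "M = (LEAST M. F x M \<noteq> None)"
    have M: "F x M \<noteq> None" "M \<le> N" unfolding M_def using N by (auto intro: LeastI Least_le)
    have M': "F x k = None" if "k < M" for k using not_less_Least that unfolding M_def by blast
    obtain r where r: "F x M = Some r" using M(1) by blast
    \<comment> \<open>a base whose powers bound the cost of one attempt, the number of attempts and all constants\<close>
    define y where "y = sz x + N + 2"
    have y3: "3 \<le> y" unfolding y_def by (cases "enc x") (simp_all add: sz_def)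
    \<comment> \<open>the factor \<open>2\<close> is the price of the unary notation of the limit\<close>
    have W: "T (x, k) \<le> y ^ (2 * a)" if "k \<le> M" for k
    proof -
      have "sz (x, k) + 2 \<le> 2 * y" using that M(2) by (simp add: y_def)
      also have "\<dots> \<le> y ^ 2" using y3 by (simp add: power2_eq_square)
      finally have "(sz (x, k) + 2) ^ a \<le> (y ^ 2) ^ a" by (rule power_mono) simp
      then show ?thesis using a[of "(x, k)"] by (simp add: power_mult)
    qed
    have "wp ?p ((\<lambda>_. Nul)(0 := enc x)) (11 + (M + 1) * (y ^ (2 * a) + 20)) (\<lambda>s' _. s' 0 = enc r)"
      by (intro wp_Seq wp_Assign wp_use[OF wp_retry_loop[OF c W M(1) M', of 0]]) (auto simp: r)
    then obtain t where t: "computes ?p (enc x) (enc r) t" "t \<le> 11 + (M + 1) * (y ^ (2 * a) + 20)"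
      unfolding computes_def wp_def by (metis add_leD1)
    note t(2)
    also have "11 + (M + 1) * (y ^ (2 * a) + 20) \<le> y ^ (2 * a + 5)"
    proof -
      have "(M + 1) * (y ^ (2 * a) + 20) \<le> y * (y ^ (2 * a) + 20)"
        using M(2) by (intro mult_right_mono) (simp_all add: y_def)
      then have "11 + (M + 1) * (y ^ (2 * a) + 20) \<le> y * y ^ (2 * a) + (20 * y + 11)"
        by (simp add: algebra_simps)
      also have "20 * y + 11 \<le> 27 * y" using y3 by simp
      also have "27 * y \<le> y ^ 3 * y"
        using power_mono[OF y3, of 3] by (intro mult_right_mono) simp_all
      also have "\<dots> \<le> y ^ (2 * a + 4)"
        using y3 by (simp add: power_Suc2[symmetric] power_increasing del: power_Suc)
      also have "y * y ^ (2 * a) \<le> y ^ (2 * a + 4)"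
        using y3 by (simp add: power_Suc[symmetric] power_increasing del: power_Suc)
      also have "y ^ (2 * a + 4) + y ^ (2 * a + 4) \<le> y * y ^ (2 * a + 4)"
        using mult_le_mono1[of 2 y "y ^ (2 * a + 4)"] y3 by (simp only: mult_2)
      also have "\<dots> = y ^ (2 * a + 5)" by (simp add: eval_nat_numeral)
      finally show ?thesis by simp
    qed
    finally show ?thesis using r t(1) unfolding y_def by blast
  qed
  then show ?thesis by blast
qed

section \<open>The two sides of an edge of a subcubic tree\<close>

text \<open>
  The component that contains \<open>x\<close> after the edge between \<open>x\<close> and \<open>y\<close> is removed.
\<close>

definition side :: "'b rel \<Rightarrow> 'b \<Rightarrow> 'b \<Rightarrow> 'b set" where
  "side E x y = {z. (x, z) \<in> (E - {(x, y), (y, x)})\<^sup>*}"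

lemma rtrancl_on_eq_rtrancl:
  assumes "r \<subseteq> F \<times> F" "u \<in> F"
  shows "(u, v) \<in> rtrancl_on F r \<longleftrightarrow> (u, v) \<in> r\<^sup>*"
proof
  assume "(u, v) \<in> r\<^sup>*"
  then show "(u, v) \<in> rtrancl_on F r"
    by induction (use assms in \<open>auto intro: rtrancl_on_into_rtrancl_on\<close>)
qed (rule rtrancl_on_rtranclI)

lemma pair_graph_arcs:
  assumes "pair_graph T"
  shows "sym (parcs T)" "irrefl (parcs T)" "finite (pverts T)" "finite (parcs T)"
    "parcs T \<subseteq> pverts T \<times> pverts T"
proof -
  interpret pair_graph T by fact
  show "sym (parcs T)" using pair_sym_arcs by (simp add: symmetric_def)
  show "irrefl (parcs T)" using pair_no_loops by (force simp: irrefl_def)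
  show "finite (pverts T)" "finite (parcs T)" by auto
  show "parcs T \<subseteq> pverts T \<times> pverts T" using in_arcsD1 in_arcsD2 by auto
qed

lemma undirected_tree_connected:
  assumes "undirected_tree T" "u \<in> pverts T" "v \<in> pverts T"
  shows "(u, v) \<in> (parcs T)\<^sup>*"
proof -
  have g: "pair_graph T" using assms by (simp add: undirected_tree_def)
  have "parcs (mk_symmetric (with_proj T)) = parcs T" "pverts (mk_symmetric (with_proj T)) = pverts T"
    using pair_graph_arcs(1)[OF g] by (auto simp: mk_symmetric_def sym_def)
  then have "reachable (with_proj (mk_symmetric (with_proj T))) u v"
    using assms unfolding undirected_tree_def connected_def strongly_connected_def by simp
  from reachable_rtranclI[OF this] show ?thesis
    using \<open>parcs (mk_symmetric (with_proj T)) = parcs T\<close> by simp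
qed

lemma reachable_delete_edge:
  assumes "pair_graph T" "(x, y) \<in> parcs T"
  shows "reachable (with_proj (delete_edge T (x, y))) x z \<longleftrightarrow> z \<in> side (parcs T) x y"
  unfolding reachable_def side_def
  using pair_graph_arcs(5)[OF assms(1)] assms(2)
  by (simp add: delete_edge_def, subst rtrancl_on_eq_rtrancl) auto

text \<open>
  A path from \<open>x\<close> to \<open>y\<close> that avoids the edge between them has at least two arcs, and the arc from \<open>y\<close>
  back to \<open>x\<close> closes it to a cycle of length at least three.
\<close>

lemma undirected_tree_bridge:
  assumes T: "undirected_tree T" and xy: "(x, y) \<in> parcs T"
  shows "y \<notin> side (parcs T) x y"
proof
  assume y: "y \<in> side (parcs T) x y"
  have g: "pair_graph T" using T by (simp add: undirected_tree_def)
  interpret T: pair_graph T by fact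
  let ?D = "delete_edge T (x, y)"
  interpret D: pair_wf_digraph ?D
    by unfold_locales (use T.in_arcsD1 T.in_arcsD2 in \<open>auto simp: delete_edge_def\<close>)
  have "reachable (with_proj ?D) x y" using reachable_delete_edge[OF g xy] y by simp
  then obtain p where p: "pre_digraph.apath (with_proj ?D) x p y"
    using D.reachable_apath by auto
  have arcs: "set p \<subseteq> parcs T - {(x, y), (y, x)}" and cas: "pcas x p y"
    and dist: "distinct (pawalk_verts x p)"
    using p unfolding pre_digraph.apath_def pre_digraph.awalk_def cas_with_proj_eq awalk_verts_with_proj_eq
    by (simp_all add: delete_edge_def)
  have ne: "x \<noteq> y" using T.pair_no_loops xy by force
  have cas': "pcas x (p @ [(y, x)]) x"
    using cas by (induction p arbitrary: x) auto
  have cas'': "pcas a (q @ [(y, b)]) b" if "pcas a q y" for a b q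
    using that by (induction q arbitrary: a) auto
  have verts: "pawalk_verts a (q @ [(y, b)]) = pawalk_verts a q @ [b]" if "pcas a q y" for a b q
    using that by (induction q arbitrary: a) auto
  have hd: "pawalk_verts x p = x # tl (pawalk_verts x p)"
    using cas by (cases p) auto
  have "length p \<ge> 2"
  proof (rule ccontr)
    assume "\<not> length p \<ge> 2"
    then consider "p = []" | e where "p = [e]"
      by (cases p; cases "tl p") auto
    then show False using cas ne arcs by cases auto
  qed
  moreover have "pre_digraph.cycle (with_proj T) (p @ [(y, x)])"
    unfolding T.cycle_def
  proof (intro exI[of _ x] conjI)
    have "(y, x) \<in> parcs T" using pair_graph_arcs(1)[OF g] xy by (auto dest: symD)
    then show "T.awalk x (p @ [(y, x)]) x"
      unfolding T.awalk_def using cas''[OF cas, of x] arcs T.in_arcsD1[OF xy] by auto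
    show "distinct (tl (pawalk_verts x (p @ [(y, x)])))"
      using dist hd verts[OF cas, of x] by (cases "pawalk_verts x p") auto
  qed simp
  ultimately show False
    using T by (auto simp: undirected_tree_def)
qed

lemma side_self: "x \<in> side E x y"
  by (simp add: side_def)

lemma side_step:
  "z \<in> side E x y \<Longrightarrow> (z, z') \<in> E \<Longrightarrow> (z, z') \<noteq> (x, y) \<Longrightarrow> (z, z') \<noteq> (y, x) \<Longrightarrow> z' \<in> side E x y"
  unfolding side_def by (auto intro: rtrancl.rtrancl_into_rtrancl)

lemma side_induct [consumes 1, case_names self step]:
  assumes "z \<in> side E x y" "P x"
    and "\<And>z z'. z \<in> side E x y \<Longrightarrow> P z \<Longrightarrow> (z, z') \<in> E \<Longrightarrow> (z, z') \<noteq> (x, y) \<Longrightarrow> (z, z') \<noteq> (y, x) \<Longrightarrow> P z'"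
  shows "P z"
proof -
  have "(x, z) \<in> (E - {(x, y), (y, x)})\<^sup>*" using assms(1) by (simp add: side_def)
  then show ?thesis
    by induction (use assms(2,3) in \<open>auto simp: side_def\<close>)
qed

lemma side_subset:
  assumes "E \<subseteq> W \<times> W" "x \<in> W"
  shows "side E x y \<subseteq> W"
proof
  fix z assume "z \<in> side E x y"
  then show "z \<in> W" by (induction rule: side_induct) (use assms in auto)
qed

lemma side_covers:
  assumes "(x, z) \<in> E\<^sup>*"
  shows "z \<in> side E x y \<union> side E y x"
  using assms
proof induction
  case (step z z')
  then show ?case
    using side_step[of z E x y z'] side_step[of z E y x z'] side_self[of x E y] side_self[of y E x] by blast
qed (simp add: side_self)

definition nbrs :: "'b rel \<Rightarrow> 'b \<Rightarrow> 'b set" where "nbrs E x = {u. (x, u) \<in> E}"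

text \<open>
  All that is used about trees apart from connectedness: every edge is a bridge.
\<close>

locale bridged =
  fixes E :: "'b rel"
  assumes sym: "sym E" and irr: "irrefl E" and bridge: "(x, y) \<in> E \<Longrightarrow> y \<notin> side E x y"
begin

lemma side_disjoint: 
  assumes "(x, y) \<in> E" shows "side E x y \<inter> side E y x = {}"
proof (rule ccontr)
  assume "side E x y \<inter> side E y x \<noteq> {}"
  then obtain z where z: "(x, z) \<in> (E - {(x, y), (y, x)})\<^sup>*" "(y, z) \<in> (E - {(x, y), (y, x)})\<^sup>*"
    unfolding side_def by (auto simp: insert_commute)
  have "sym (E - {(x, y), (y, x)})" using sym by (auto simp: sym_def)
  then have "(z, y) \<in> (E - {(x, y), (y, x)})\<^sup>*" using z(2) by (meson sym_rtrancl symD)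
  then have "(x, y) \<in> (E - {(x, y), (y, x)})\<^sup>*" using z(1) by (rule rtrancl_trans[rotated])
  then show False using bridge[OF assms] unfolding side_def by simp
qed

text \<open>
  A walk that starts in \<open>u\<close> and avoids the edge to \<open>x\<close> never meets \<open>x\<close>, since that edge is a bridge;
  so it cannot use the edge between \<open>x\<close> and \<open>y\<close> either.
\<close>

lemma side_mono:
  assumes "(x, y) \<in> E" "(x, u) \<in> E" "u \<noteq> y"
  shows "side E u x \<subseteq> side E x y"
proof
  fix z assume "z \<in> side E u x"
  have ux: "x \<notin> side E u x" using bridge[of u x] assms(2) sym by (auto dest: symD)
  from \<open>z \<in> side E u x\<close> show "z \<in> side E x y"
  proof (induction rule: side_induct)
    case self
    show ?case by (rule side_step[OF side_self assms(2)]) (use assms irr in \<open>auto simp: irrefl_def\<close>)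
  next
    case (step z z')
    then have "z' \<in> side E u x" using side_step by metis
    then have "z' \<noteq> x" "z \<noteq> x" using ux step.hyps(1) by auto
    then show ?case using side_step[OF step.IH step.hyps(2)] by auto
  qed
qed

lemma side_eq:
  assumes "(x, y) \<in> E"
  shows "side E x y = insert x (\<Union>u \<in> nbrs E x - {y}. side E u x)"
proof
  show "insert x (\<Union>u \<in> nbrs E x - {y}. side E u x) \<subseteq> side E x y"
    using side_mono[OF assms] side_self by (force simp: nbrs_def)
  show "side E x y \<subseteq> insert x (\<Union>u \<in> nbrs E x - {y}. side E u x)"
  proof
    fix z assume "z \<in> side E x y"
    then show "z \<in> insert x (\<Union>u \<in> nbrs E x - {y}. side E u x)"
    proof (induction rule: side_induct)
      case (step z z')
      show ?case
      proof (cases "z = x \<or> z' = x")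
        case True
        then show ?thesis using step.hyps(2-4) side_self[of z' E x] by (auto simp: nbrs_def)
      next
        case False
        then obtain u where "u \<in> nbrs E x - {y}" "z \<in> side E u x" using step.IH by blast
        then show ?thesis using side_step[of z E u x z'] step.hyps(2) False by blast
      qed
    qed simp
  qed
qed

lemma side_notin: "(x, u) \<in> E \<Longrightarrow> x \<notin> side E u x"
  using bridge[of u x] sym by (auto dest: symD)

lemma side_siblings_disjoint:
  assumes "(x, u) \<in> E" "(x, v) \<in> E" "u \<noteq> v"
  shows "side E u x \<inter> side E v x = {}"
  using side_mono[OF assms(2,1,3)] side_disjoint[OF assms(2)] by blast

end

lemma undirected_tree_bridged:
  assumes "undirected_tree T"
  shows "bridged (parcs T)"
  using assms pair_graph_arcs[of T] undirected_tree_bridge[OF assms]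
  by unfold_locales (auto simp: undirected_tree_def)

lemma out_degree_nbrs: "out_degree (with_proj T) x = card (nbrs (parcs T) x)"
proof -
  have "out_arcs (with_proj T) x = Pair x ` nbrs (parcs T) x"
    by (auto simp: out_arcs_def nbrs_def)
  then show ?thesis unfolding out_degree_def by (simp add: card_image inj_on_def)
qed

text \<open>
  The recursive structure on which the dynamic programming relies. An internal vertex \<open>x\<close> has exactly
  two neighbours other than \<open>y\<close>.
\<close>

lemma subcubic_side_cases:
  assumes T: "subcubic_tree T" and xy: "(x, y) \<in> parcs T"
  obtains (leaf) "x \<in> tree_leaves T" "side (parcs T) x y = {x}"
  | (internal) u v where "x \<notin> tree_leaves T" "(u, x) \<in> parcs T" "(v, x) \<in> parcs T"
      "side (parcs T) x y = insert x (side (parcs T) u x \<union> side (parcs T) v x)"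
      "side (parcs T) u x \<inter> side (parcs T) v x = {}"
      "x \<notin> side (parcs T) u x" "x \<notin> side (parcs T) v x"
proof -
  have ut: "undirected_tree T" using T by (simp add: subcubic_tree_def)
  then interpret bridged "parcs T" by (rule undirected_tree_bridged)
  note arcs = pair_graph_arcs[of T]
  have xW: "x \<in> pverts T" using xy arcs(5) ut by (auto simp: undirected_tree_def)
  have ny: "y \<in> nbrs (parcs T) x" using xy by (simp add: nbrs_def)
  show ?thesis
  proof (cases "x \<in> tree_leaves T")
    case True
    then have "card (nbrs (parcs T) x) = 1" by (simp add: tree_leaves_def out_degree_nbrs)
    then have "nbrs (parcs T) x - {y} = {}" using ny by (auto simp: card_1_singleton_iff)
    then have "side (parcs T) x y = {x}" by (simp only: side_eq[OF xy] UN_empty)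
    then show ?thesis by (rule leaf[OF True])
  next
    case False
    then have "card (nbrs (parcs T) x) = 3"
      using T xW by (auto simp: subcubic_tree_def out_degree_nbrs)
    then have "card (nbrs (parcs T) x - {y}) = 2" using ny by simp
    then obtain u v where uv: "nbrs (parcs T) x - {y} = {u, v}" "u \<noteq> v"
      by (auto simp: card_2_iff)
    then have e: "(x, u) \<in> parcs T" "(x, v) \<in> parcs T" by (auto simp: nbrs_def)
    show ?thesis
      by (rule internal[OF False, of u v])
        (use e uv side_eq[OF xy] side_notin side_siblings_disjoint[OF e uv(2)] sym in \<open>auto dest: symD\<close>)
  qed
qed

lemma subcubic_tree_arcs:
  assumes "subcubic_tree T"
  shows "sym (parcs T)" "finite (pverts T)" "finite (parcs T)" "parcs T \<subseteq> pverts T \<times> pverts T"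
  using assms pair_graph_arcs[of T] by (auto simp: subcubic_tree_def undirected_tree_def)

lemma finite_side:
  assumes "subcubic_tree T" "(x, y) \<in> parcs T"
  shows "finite (side (parcs T) x y)" "side (parcs T) x y \<subseteq> pverts T"
  using side_subset[of "parcs T" "pverts T" x y] subcubic_tree_arcs[OF assms(1)] assms(2)
  by (auto intro: finite_subset)

text \<open>
  A rooted binary tree has one internal vertex less than leaves. Used to bound the size of the
  decomposition tree, and to see that no side is without leaves.
\<close>

lemma card_side:
  assumes T: "subcubic_tree T" and "(x, y) \<in> parcs T"
  shows "card (side (parcs T) x y) + 1 \<le> 2 * card (side (parcs T) x y \<inter> tree_leaves T)"
  using assms(2)
proof (induction "card (side (parcs T) x y)" arbitrary: x y rule: less_induct)
  case less
  from T less.prems show ?case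
  proof (cases rule: subcubic_side_cases)
    case leaf
    then show ?thesis by simp
  next
    case (internal u v)
    let ?S = "side (parcs T)"
    have fin: "finite (?S u x)" "finite (?S v x)"
      using finite_side[OF T] internal by auto
    have "card (?S x y) = Suc (card (?S u x) + card (?S v x))"
      using internal fin by (simp add: card_Un_disjoint)
    moreover from this have "card (?S u x) + 1 \<le> 2 * card (?S u x \<inter> tree_leaves T)"
      "card (?S v x) + 1 \<le> 2 * card (?S v x \<inter> tree_leaves T)"
      using less.hyps internal(2,3) by auto
    moreover have "?S x y \<inter> tree_leaves T = (?S u x \<inter> tree_leaves T) \<union> (?S v x \<inter> tree_leaves T)"
      using internal by auto
    then have "card (?S x y \<inter> tree_leaves T) = card (?S u x \<inter> tree_leaves T) + card (?S v x \<inter> tree_leaves T)"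
      using internal(5) fin by (simp, intro card_Un_disjoint) auto
    ultimately show ?thesis by linarith
  qed
qed

lemma subcubic_tree_arc_exists:
  assumes "subcubic_tree T"
  obtains x y where "(x, y) \<in> parcs T"
proof -
  have "\<not> card (pverts T) \<le> 1" using assms by (auto simp: subcubic_tree_def)
  then obtain u v where uv: "u \<in> pverts T" "v \<in> pverts T" "u \<noteq> v"
    by (metis One_nat_def card_le_Suc0_iff_eq card.infinite zero_le)
  then have "(u, v) \<in> (parcs T)\<^sup>*"
    using undirected_tree_connected assms by (auto simp: subcubic_tree_def)
  then show ?thesis using uv(3) that by (metis converse_rtranclE)
qed

lemma side_partition:
  assumes T: "subcubic_tree T" and xy: "(x, y) \<in> parcs T"
  shows "side (parcs T) x y \<union> side (parcs T) y x = pverts T"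
    "side (parcs T) x y \<inter> side (parcs T) y x = {}"
proof -
  have ut: "undirected_tree T" using T by (simp add: subcubic_tree_def)
  then interpret bridged "parcs T" by (rule undirected_tree_bridged)
  show "side (parcs T) x y \<inter> side (parcs T) y x = {}" using side_disjoint[OF xy] .
  have yx: "(y, x) \<in> parcs T" using sym xy by (auto dest: symD)
  have "pverts T \<subseteq> side (parcs T) x y \<union> side (parcs T) y x"
  proof
    fix z assume z: "z \<in> pverts T"
    have "x \<in> pverts T" using subcubic_tree_arcs(4)[OF T] xy by auto
    from side_covers[OF undirected_tree_connected[OF ut this z]]
    show "z \<in> side (parcs T) x y \<union> side (parcs T) y x" .
  qed
  then show "side (parcs T) x y \<union> side (parcs T) y x = pverts T"
    using finite_side(2)[OF T xy] finite_side(2)[OF T yx] by (simp add: subset_antisym)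
qed

lemma card_subcubic_tree:
  assumes T: "subcubic_tree T"
  shows "card (pverts T) + 2 \<le> 2 * card (tree_leaves T)"
proof -
  obtain x y where xy: "(x, y) \<in> parcs T" using subcubic_tree_arc_exists[OF T] .
  then have yx: "(y, x) \<in> parcs T" using subcubic_tree_arcs(1)[OF T] by (auto dest: symD)
  let ?S = "side (parcs T)"
  note p = side_partition[OF T xy] and f = finite_side(1)[OF T xy] finite_side(1)[OF T yx]
  \<comment> \<open>cutting an edge yields two rooted binary trees\<close>
  have "card (pverts T) = card (?S x y) + card (?S y x)"
    unfolding p(1)[symmetric] using p(2) f by (simp add: card_Un_disjoint)
  moreover have "tree_leaves T = (?S x y \<inter> tree_leaves T) \<union> (?S y x \<inter> tree_leaves T)"
    using p(1) by (auto simp: tree_leaves_def)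
  then have "card (tree_leaves T) = card (?S x y \<inter> tree_leaves T) + card (?S y x \<inter> tree_leaves T)"
    using p(2) f by (subst card_Un_disjoint[symmetric]) auto
  ultimately show ?thesis using card_side[OF T xy] card_side[OF T yx] by linarith
qed

section \<open>The cuts of a branch decomposition\<close>

lemma cut_side_eq:
  assumes "branch_decomposition G T L" "(x, y) \<in> parcs T"
  shows "cut_side G T L (x, y) = {v \<in> pverts G. L v \<in> side (parcs T) x y}"
  using reachable_delete_edge[OF _ assms(2)] assms(1)
  by (auto simp: cut_side_def branch_decomposition_def subcubic_tree_def undirected_tree_def)

lemma cut_side_nonempty:
  assumes "branch_decomposition G T L" "(x, y) \<in> parcs T"
  shows "cut_side G T L (x, y) \<noteq> {}"
proof -
  have T: "subcubic_tree T" using assms by (simp add: branch_decomposition_def)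
  have "card (side (parcs T) x y \<inter> tree_leaves T) \<noteq> 0" using card_side[OF T assms(2)] by linarith
  then obtain z where "z \<in> side (parcs T) x y" "z \<in> tree_leaves T" by (metis Int_iff card.empty ex_in_conv)
  moreover from this have "z \<in> L ` pverts G"
    using assms(1) by (simp add: branch_decomposition_def bij_betw_def)
  ultimately show ?thesis
    unfolding cut_side_eq[OF assms] by auto
qed

lemma cut_side_opposite:
  assumes "branch_decomposition G T L" "(x, y) \<in> parcs T"
  shows "(y, x) \<in> parcs T" "pverts G = cut_side G T L (x, y) \<union> cut_side G T L (y, x)"
    "cut_side G T L (x, y) \<inter> cut_side G T L (y, x) = {}"
proof -
  have T: "subcubic_tree T" using assms by (simp add: branch_decomposition_def)
  show yx: "(y, x) \<in> parcs T" using subcubic_tree_arcs(1)[OF T] assms(2) by (auto dest: symD)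
  have "L v \<in> pverts T" if "v \<in> pverts G" for v
    using assms(1) that by (auto simp: branch_decomposition_def bij_betw_def tree_leaves_def)
  then show "pverts G = cut_side G T L (x, y) \<union> cut_side G T L (y, x)"
    "cut_side G T L (x, y) \<inter> cut_side G T L (y, x) = {}"
    using side_partition[OF T assms(2)]
    unfolding cut_side_eq[OF assms] cut_side_eq[OF assms(1) yx] by auto
qed

lemma cut_side_cases:
  assumes bd: "branch_decomposition G T L" and xy: "(x, y) \<in> parcs T"
  obtains (singleton) v where "cut_side G T L (x, y) = {v}"
  | (union) e e' where "e \<in> parcs T" "e' \<in> parcs T"
      "cut_side G T L (x, y) = cut_side G T L e \<union> cut_side G T L e'"
      "cut_side G T L e \<inter> cut_side G T L e' = {}"
proof -
  have T: "subcubic_tree T" using bd by (simp add: branch_decomposition_def)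
  from T xy show ?thesis
  proof (cases rule: subcubic_side_cases)
    case leaf
    have "x \<in> L ` pverts G"
      using leaf(1) bd by (simp add: branch_decomposition_def bij_betw_def)
    then obtain v where "v \<in> pverts G" "L v = x" by auto
    then have "cut_side G T L (x, y) = {v}"
      using bd leaf unfolding cut_side_eq[OF bd xy] branch_decomposition_def bij_betw_def
      by (auto dest: inj_onD)
    then show ?thesis by (rule singleton)
  next
    case (internal u v)
    have "L w \<noteq> x" if "w \<in> pverts G" for w
      using internal(1) bd that by (auto simp: branch_decomposition_def bij_betw_def)
    then have "cut_side G T L (x, y) = cut_side G T L (u, x) \<union> cut_side G T L (v, x)"
      "cut_side G T L (u, x) \<inter> cut_side G T L (v, x) = {}"
      using internal(4,5) unfolding cut_side_eq[OF bd xy] cut_side_eq[OF bd internal(2)]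
        cut_side_eq[OF bd internal(3)] by auto
    then show ?thesis using union internal(2,3) by blast
  qed
qed

lemma bimim_cut_side_le:
  assumes "branch_decomposition G T L" "e \<in> parcs T"
  shows "bimim G (cut_side G T L e) \<le> bimim_width G T L"
  unfolding bimim_width_def
  using assms subcubic_tree_arcs(3)[of T] by (intro Max_ge) (auto simp: branch_decomposition_def)

lemma branch_decomposition_card:
  assumes "branch_decomposition G T L"
  shows "card (pverts T) + 2 \<le> 2 * card (pverts G)" "2 \<le> card (pverts G)"
proof -
  have T: "subcubic_tree T" and "card (pverts G) = card (tree_leaves T)"
    using assms by (auto simp: branch_decomposition_def bij_betw_same_card)
  then show *: "card (pverts T) + 2 \<le> 2 * card (pverts G)" using card_subcubic_tree by metis
  show "2 \<le> card (pverts G)" using * T unfolding subcubic_tree_def by linarith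
qed

section \<open>The number of inequivalent colourings across a cut\<close>

text \<open>
  The set \<open>X'\<close> is the union of \<open>d\<close> layers. Each layer is a minimum subset of what is left of \<open>X\<close> that
  still meets the neighbourhood of every \<open>b \<in> B\<close> that can be met. A vertex \<open>b\<close> then sees either an
  element of every layer, so at least \<open>d\<close> elements in all, or all its neighbours in \<open>X\<close> belong to the
  layers before the first one that it does not see. By minimality each element of a layer has a
  private neighbour in \<open>B\<close>, which is the situation where the assumption gives the bound \<open>k\<close>.
\<close>

lemma capped_selection:
  fixes R :: "'a \<Rightarrow> 'b \<Rightarrow> bool"
  assumes "finite X"
    and "\<And>Y p. Y \<subseteq> X \<Longrightarrow> \<forall>y\<in>Y. p y \<in> B \<and> (\<forall>y'\<in>Y. R y' (p y) \<longleftrightarrow> y' = y) \<Longrightarrow> card Y \<le> k"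
  shows "\<exists>X'\<subseteq>X. card X' \<le> d * k \<and>
    (\<forall>b\<in>B. min d (card {x \<in> X'. R x b}) = min d (card {x \<in> X. R x b}))"
  using assms
proof (induction d arbitrary: X)
  case 0
  show ?case by (rule exI[of _ "{}"]) simp
next
  case (Suc d)
  \<comment> \<open>\<open>Z\<close> is the first layer\<close>
  define D where "D Y \<longleftrightarrow> Y \<subseteq> X \<and> (\<forall>b\<in>B. (\<exists>x\<in>X. R x b) \<longrightarrow> (\<exists>x\<in>Y. R x b))" for Y
  have "D X" by (simp add: D_def)
  then obtain Z where Z: "D Z" and minimal: "\<And>Y. D Y \<Longrightarrow> card Z \<le> card Y"
    using exists_least_lemma[of "\<lambda>m. \<exists>Y. D Y \<and> card Y = m"] ex_has_least_nat[of D X card] by metis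
  have ZX: "Z \<subseteq> X" and finZ: "finite Z" using Z Suc.prems(1) by (auto simp: D_def intro: finite_subset)
  have "\<exists>b\<in>B. \<forall>y'\<in>Z. R y' b \<longleftrightarrow> y' = y" if y: "y \<in> Z" for y
  proof -
    have "card (Z - {y}) < card Z" using y finZ by (intro psubset_card_mono) auto
    then have "\<not> D (Z - {y})" using minimal[of "Z - {y}"] by linarith
    then obtain b where b: "b \<in> B" "\<exists>x\<in>X. R x b" "\<not> (\<exists>x\<in>Z - {y}. R x b)"
      using ZX unfolding D_def by blast
    moreover from this have "\<exists>x\<in>Z. R x b" using Z by (simp add: D_def)
    ultimately show ?thesis by blast
  qed
  then obtain p where p: "\<forall>y\<in>Z. p y \<in> B \<and> (\<forall>y'\<in>Z. R y' (p y) \<longleftrightarrow> y' = y)" by metis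
  have cZ: "card Z \<le> k" by (rule Suc.prems(2)[OF ZX p])
  have "\<exists>X'\<subseteq>X - Z. card X' \<le> d * k \<and>
      (\<forall>b\<in>B. min d (card {x \<in> X'. R x b}) = min d (card {x \<in> X - Z. R x b}))"
  proof (rule Suc.IH)
    show "finite (X - Z)" using Suc.prems(1) by simp
    fix Y p assume Y: "Y \<subseteq> X - Z" "\<forall>y\<in>Y. p y \<in> B \<and> (\<forall>y'\<in>Y. R y' (p y) \<longleftrightarrow> y' = y)"
    show "card Y \<le> k" by (rule Suc.prems(2)[OF _ Y(2)]) (use Y(1) in blast)
  qed
  then obtain X2 where X2: "X2 \<subseteq> X - Z" "card X2 \<le> d * k"
    "\<And>b. b \<in> B \<Longrightarrow> min d (card {x \<in> X2. R x b}) = min d (card {x \<in> X - Z. R x b})"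
    by blast
  have fin2: "finite X2" using X2(1) Suc.prems(1) by (auto intro: finite_subset)
  show ?case
  proof (intro exI[of _ "Z \<union> X2"] conjI ballI)
    show "Z \<union> X2 \<subseteq> X" using ZX X2 by auto
    show "card (Z \<union> X2) \<le> Suc d * k" using card_Un_le[of Z X2] cZ X2(2) by simp
    fix b assume b: "b \<in> B"
    let ?c = "\<lambda>Y. card {x \<in> Y. R x b}"
    have "{x \<in> Z \<union> X2. R x b} = {x \<in> Z. R x b} \<union> {x \<in> X2. R x b}" by auto
    then have 1: "?c (Z \<union> X2) = ?c Z + ?c X2"
      using finZ fin2 X2(1) by (simp, intro card_Un_disjoint) auto
    have "{x \<in> X. R x b} = {x \<in> Z. R x b} \<union> {x \<in> X - Z. R x b}" using ZX by auto
    then have 2: "?c X = ?c Z + ?c (X - Z)"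
      using finZ Suc.prems(1) by (simp, intro card_Un_disjoint) auto
    show "min (Suc d) (?c (Z \<union> X2)) = min (Suc d) (?c X)"
    proof (cases "?c Z = 0")
      case True
      then have "\<not> (\<exists>x\<in>Z. R x b)" using finZ by auto
      then have none: "\<not> (\<exists>x\<in>X. R x b)" using Z b by (auto simp: D_def)
      then have "{x \<in> X2. R x b} = {}" "{x \<in> X - Z. R x b} = {}" using X2(1) by auto
      then show ?thesis unfolding 1 2 by (simp only: card.empty)
    next
      case False
      then show ?thesis using X2(3)[OF b] unfolding 1 2 by linarith
    qed
  qed
qed

lemma card_induced_matching_le:
  assumes "finite (parcs H)" "induced_matching H M"
  shows "card M \<le> induced_matching_number H"
  unfolding induced_matching_number_def
proof (rule Max_ge)
  have "{card M |M. induced_matching H M} \<subseteq> card ` Pow (parcs H)"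
    by (auto simp: induced_matching_def)
  then show "finite {card M |M. induced_matching H M}"
    using assms(1) finite_subset by blast
  show "card M \<in> {card M |M. induced_matching H M}" using assms(2) by auto
qed

text \<open>
  Each element of \<open>Y\<close> together with its private neighbour is an arc, and privacy says that no other arc
  of the cut joins two of these arcs.
\<close>

lemma induced_matching_private:
  assumes "A \<inter> B = {}" "Y \<subseteq> A"
    and p: "\<And>y. y \<in> Y \<Longrightarrow> p y \<in> B" "\<And>y y'. y \<in> Y \<Longrightarrow> y' \<in> Y \<Longrightarrow> R y' (p y) \<longleftrightarrow> y' = y"
  shows "R = (\<lambda>x b. (x, b) \<in> parcs G) \<Longrightarrow> induced_matching (bip_digraph G A B) ((\<lambda>y. (y, p y)) ` Y)"
    and "R = (\<lambda>x b. (b, x) \<in> parcs G) \<Longrightarrow> induced_matching (bip_digraph G B A) ((\<lambda>y. (p y, y)) ` Y)"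
proof -
  have "y = z" if "y \<in> Y" "z \<in> Y" "p y = p z" for y z
    using p(2) that by metis
  moreover have "p y \<noteq> z" if "y \<in> Y" "z \<in> A" for y z using p(1) that assms(1) by blast
  moreover have "p y \<noteq> z" if "y \<in> Y" "z \<in> Y" for y z using p(1) that assms(1,2) by blast
  ultimately show "R = (\<lambda>x b. (x, b) \<in> parcs G) \<Longrightarrow> induced_matching (bip_digraph G A B) ((\<lambda>y. (y, p y)) ` Y)"
    "R = (\<lambda>x b. (b, x) \<in> parcs G) \<Longrightarrow> induced_matching (bip_digraph G B A) ((\<lambda>y. (p y, y)) ` Y)"
    using assms p unfolding induced_matching_def bip_digraph_def meets_def
    by (auto simp: subset_iff disjoint_iff)
qed

text \<open>
  The relation \<open>R\<close> stands for either direction of the arcs across the cut, so that one selection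
  argument serves out-neighbours and in-neighbours alike.
\<close>

lemma card_private_le_bimim:
  assumes "finite (parcs G)" "A \<subseteq> pverts G" "Y \<subseteq> A"
    and p: "\<forall>y\<in>Y. p y \<in> pverts G - A \<and> (\<forall>y'\<in>Y. R y' (p y) \<longleftrightarrow> y' = y)"
    and R: "R = (\<lambda>x b. (x, b) \<in> parcs G) \<or> R = (\<lambda>x b. (b, x) \<in> parcs G)"
  shows "card Y \<le> bimim G A"
proof -
  let ?B = "pverts G - A"
  have fin: "finite (parcs (bip_digraph G A ?B))" "finite (parcs (bip_digraph G ?B A))"
    using assms(1) by (auto simp: bip_digraph_def)
  have card: "card ((\<lambda>y. (y, p y)) ` Y) = card Y" "card ((\<lambda>y. (p y, y)) ` Y) = card Y"
    by (simp_all add: card_image inj_on_def)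
  have "A \<inter> ?B = {}" by auto
  note M = induced_matching_private[OF this assms(3), of p R G]
  from R show ?thesis
    using card_induced_matching_le[OF fin(1) M(1)] card_induced_matching_le[OF fin(2) M(2)] p
    by (auto simp: bimim_def card intro: trans_le_add1 trans_le_add2)
qed

definition out_count :: "'a pair_pre_digraph \<Rightarrow> ('a \<Rightarrow> nat) \<Rightarrow> 'a \<Rightarrow> nat \<Rightarrow> nat" where
  "out_count G f v j = card {u. (v, u) \<in> parcs G \<and> f u = j}"

definition in_count :: "'a pair_pre_digraph \<Rightarrow> ('a \<Rightarrow> nat) \<Rightarrow> 'a \<Rightarrow> nat \<Rightarrow> nat" where
  "in_count G f v j = card {u. (u, v) \<in> parcs G \<and> f u = j}"

lemma card_small_subsets:
  assumes "finite V"
  shows "finite {Z. Z \<subseteq> V \<and> card Z \<le> k}" "card {Z. Z \<subseteq> V \<and> card Z \<le> k} \<le> (card V + 1) ^ k"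
proof -
  show fin: "finite {Z. Z \<subseteq> V \<and> card Z \<le> k}" using assms by simp
  let ?O = "insert None (Some ` V)"
  let ?L = "{xs. set xs \<subseteq> ?O \<and> length xs = k}"
  \<comment> \<open>a small subset is the set of the proper entries of a list of length \<open>k\<close> that is filled up with \<open>None\<close>\<close>
  have "{Z. Z \<subseteq> V \<and> card Z \<le> k} \<subseteq> (\<lambda>xs. {x. Some x \<in> set xs}) ` ?L"
  proof
    fix Z assume Z: "Z \<in> {Z. Z \<subseteq> V \<and> card Z \<le> k}"
    then obtain zs where zs: "set zs = Z" "length zs = card Z"
      using finite_distinct_list[of Z] assms by (metis (lifting) CollectD distinct_card finite_subset)
    let ?xs = "map Some zs @ replicate (k - card Z) None"
    have "?xs \<in> ?L" "{x. Some x \<in> set ?xs} = Z" using Z zs by auto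
    then show "Z \<in> (\<lambda>xs. {x. Some x \<in> set xs}) ` ?L" by blast
  qed
  moreover have "finite ?L" "card ?L = (card V + 1) ^ k"
    using assms by (auto simp: finite_lists_length_eq card_lists_length_eq card_image)
  ultimately show "card {Z. Z \<subseteq> V \<and> card Z \<le> k} \<le> (card V + 1) ^ k"
    by (metis (no_types, lifting) surj_card_le)
qed

text \<open>
  Each colour class can be replaced by at most \<open>d * w\<close> of its vertices without changing the capped
  numbers of in-neighbours that vertices outside \<open>A\<close> see, and by another such set for out-neighbours.
  These \<open>2 * q\<close> small sets determine the colouring up to equivalence.
\<close>

lemma card_inequivalent_colourings:
  fixes col :: "'c \<Rightarrow> nat \<Rightarrow> nat" and G :: "nat pair_pre_digraph"
  assumes G: "pair_fin_digraph G" and A: "A \<subseteq> pverts G" and w: "bimim G A \<le> w"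
    and S: "finite S" "\<And>c u. c \<in> S \<Longrightarrow> col c u \<noteq> 0 \<Longrightarrow> u \<in> A"
    and ineq: "\<And>c c'. c \<in> S \<Longrightarrow> c' \<in> S \<Longrightarrow> c \<noteq> c' \<Longrightarrow>
      \<exists>b\<in>pverts G - A. \<exists>j\<in>{1..q}.
        min d (in_count G (col c) b j) \<noteq> min d (in_count G (col c') b j) \<or>
        min d (out_count G (col c) b j) \<noteq> min d (out_count G (col c') b j)"
  shows "card S \<le> ((card (pverts G) + 1) ^ (d * w)) ^ (2 * q)"
proof -
  interpret pair_fin_digraph G by fact
  let ?Z = "{Z. Z \<subseteq> pverts G \<and> card Z \<le> d * w}"
  have sel: "\<exists>Z. Z \<in> ?Z \<and> (\<forall>b\<in>pverts G - A.
      min d (card {u\<in>Z. R u b}) = min d (card {u. R u b \<and> col c u = j}))"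
    if "c \<in> S" "j \<in> {1..q}" "R = (\<lambda>x b. (x, b) \<in> parcs G) \<or> R = (\<lambda>x b. (b, x) \<in> parcs G)" for c j R
  proof -
    let ?X = "{u. col c u = j}"
    have XA: "?X \<subseteq> A" using S(2)[OF that(1)] that(2) by auto
    then have finX: "finite ?X" using A pair_finite_verts by (meson finite_subset)
    have "\<exists>X'\<subseteq>?X. card X' \<le> d * w \<and> (\<forall>b\<in>pverts G - A.
        min d (card {x \<in> X'. R x b}) = min d (card {x \<in> ?X. R x b}))"
    proof (rule capped_selection[OF finX])
      fix Y p assume "Y \<subseteq> ?X" "\<forall>y\<in>Y. p y \<in> pverts G - A \<and> (\<forall>y'\<in>Y. R y' (p y) \<longleftrightarrow> y' = y)"
      then show "card Y \<le> w"
        using card_private_le_bimim[OF pair_finite_arcs A _ _ that(3), of Y p] XA w by fastforce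
    qed
    then obtain Z where Z: "Z \<subseteq> ?X" "card Z \<le> d * w" "\<forall>b\<in>pverts G - A.
        min d (card {x \<in> Z. R x b}) = min d (card {x \<in> ?X. R x b})"
      by blast
    have X: "{x \<in> ?X. R x b} = {u. R u b \<and> col c u = j}" for b by auto
    have "Z \<subseteq> pverts G" using Z(1) XA A by (meson subset_trans)
    then have "Z \<in> ?Z" using Z(2) by simp
    then show ?thesis using Z(3) unfolding X by blast
  qed
  define P where "P c j = (SOME Z. Z \<in> ?Z \<and> (\<forall>b\<in>pverts G - A.
      min d (card {u\<in>Z. (u, b) \<in> parcs G}) = min d (in_count G (col c) b j)))" for c j
  have P: "P c j \<in> ?Z" "\<And>b. b \<in> pverts G - A \<Longrightarrow>
      min d (card {u\<in>P c j. (u, b) \<in> parcs G}) = min d (in_count G (col c) b j)"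
    if "c \<in> S" "j \<in> {1..q}" for c j
    using someI_ex[OF sel[OF that, of "\<lambda>x b. (x, b) \<in> parcs G"]] unfolding P_def in_count_def by blast+
  define Q where "Q c j = (SOME Z. Z \<in> ?Z \<and> (\<forall>b\<in>pverts G - A.
      min d (card {u\<in>Z. (b, u) \<in> parcs G}) = min d (out_count G (col c) b j)))" for c j
  have Q: "Q c j \<in> ?Z" "\<And>b. b \<in> pverts G - A \<Longrightarrow>
      min d (card {u\<in>Q c j. (b, u) \<in> parcs G}) = min d (out_count G (col c) b j)"
    if "c \<in> S" "j \<in> {1..q}" for c j
    using someI_ex[OF sel[OF that, of "\<lambda>x b. (b, x) \<in> parcs G"]] unfolding Q_def out_count_def by blast+
  let ?I = "{1..q} \<times> (UNIV :: bool set)"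
  define h where "h c = restrict (\<lambda>(j, out). if out then P c j else Q c j) ?I" for c
  have "inj_on h S"
  proof (rule inj_onI, rule ccontr)
    fix c c' assume c: "c \<in> S" "c' \<in> S" "h c = h c'" "c \<noteq> c'"
    have same: "P c j = P c' j \<and> Q c j = Q c' j" if "j \<in> {1..q}" for j
      using fun_cong[OF c(3), of "(j, True)"] fun_cong[OF c(3), of "(j, False)"] that
      by (simp add: h_def)
    from ineq[OF c(1,2,4)] obtain b j where "b \<in> pverts G - A" "j \<in> {1..q}"
      "min d (in_count G (col c) b j) \<noteq> min d (in_count G (col c') b j) \<or>
       min d (out_count G (col c) b j) \<noteq> min d (out_count G (col c') b j)"
      by blast
    then show False
      using P(2)[OF c(1), of j b] P(2)[OF c(2), of j b] Q(2)[OF c(1), of j b] Q(2)[OF c(2), of j b] same[of j]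
      by simp
  qed
  moreover have "h ` S \<subseteq> Pi\<^sub>E ?I (\<lambda>_. ?Z)"
  proof (rule image_subsetI, rule PiE_I)
    fix c i assume "c \<in> S" "i \<in> ?I"
    then show "h c i \<in> ?Z" using P(1)[of c "fst i"] Q(1)[of c "fst i"]
      by (cases i) (simp add: h_def del: mem_Collect_eq)
  next
    fix c i assume "i \<notin> ?I"
    then show "h c i = undefined" by (simp add: h_def)
  qed
  moreover have "finite (Pi\<^sub>E ?I (\<lambda>_. ?Z))"
    using card_small_subsets(1)[OF pair_finite_verts] by (intro finite_PiE) auto
  ultimately have "card S \<le> card (Pi\<^sub>E ?I (\<lambda>_. ?Z))" by (rule card_inj_on_le)
  also have "\<dots> = card ?Z ^ (2 * q)" by (simp add: card_PiE card_cartesian_product mult.commute)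
  also have "\<dots> \<le> ((card (pverts G) + 1) ^ (d * w)) ^ (2 * q)"
    by (intro power_mono card_small_subsets pair_finite_verts) simp
  finally show ?thesis .
qed

section \<open>The dynamic programming algorithm\<close>

type_synonym graph = "bool list list"
type_synonym colours = "nat list"
type_synonym entry = "colours \<times> colours"

definition adj :: "graph \<Rightarrow> nat \<Rightarrow> nat \<Rightarrow> bool" where
  "adj g u v = nth_or False (nth_or [] g u) v"

text \<open>
  A partial colouring of the vertices \<open>0, \<dots>, n - 1\<close> is a list of \<open>n\<close> numbers in which \<open>0\<close> stands for
  \<open>uncoloured\<close>; a vertex set is a characteristic vector.
\<close>

abbreviation colour :: "colours \<Rightarrow> nat \<Rightarrow> nat" where "colour \<equiv> nth_or 0"
abbreviation member :: "bool list \<Rightarrow> nat \<Rightarrow> bool" where "member \<equiv> nth_or False"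

definition outdeg :: "graph \<Rightarrow> colours \<Rightarrow> nat \<Rightarrow> nat \<Rightarrow> nat" where
  "outdeg g c v j = length (filter (\<lambda>u. adj g v u \<and> colour c u = j) [0..<length g])"

definition indeg :: "graph \<Rightarrow> colours \<Rightarrow> nat \<Rightarrow> nat \<Rightarrow> nat" where
  "indeg g c v j = length (filter (\<lambda>u. adj g u v \<and> colour c u = j) [0..<length g])"

text \<open>
  Meant for colourings with disjoint domains. It is not pointwise addition because the entries must
  stay bounded on all arguments.
\<close>

definition merge :: "graph \<Rightarrow> colours \<Rightarrow> colours \<Rightarrow> colours" where
  "merge g c c' = map (\<lambda>v. if colour c v = 0 then colour c' v else colour c v) [0..<length g]"

definition paint :: "graph \<Rightarrow> colours \<Rightarrow> nat \<Rightarrow> nat \<Rightarrow> colours" where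
  "paint g c v j = map (\<lambda>u. if u = v then j else colour c u) [0..<length g]"

definition blank :: "graph \<Rightarrow> colours" where
  "blank g = map (\<lambda>_. 0) [0..<length g]"

definition compl :: "graph \<Rightarrow> bool list \<Rightarrow> bool list" where
  "compl g A = map (\<lambda>v. \<not> member A v) [0..<length g]"

text \<open>
  The empty list signals that the limit was exceeded. It is stable: extending it yields the empty list
  again. Genuine lists of representatives are never empty.
\<close>

definition trim :: "nat \<Rightarrow> 'a list \<Rightarrow> 'a list" where
  "trim limit R = (if length R \<le> limit then R else [])"

definition full :: "graph \<Rightarrow> colours \<Rightarrow> bool" where
  "full g c \<longleftrightarrow> (\<forall>v\<in>set [0..<length g]. colour c v \<noteq> 0)"

text \<open>
  The colouring problem that comprises both families: find a colouring with \<open>1, \<dots>, q\<close> that satisfies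
  the matrix \<open>D\<close> and has as few vertices of colour \<open>K\<close> as possible. All sets in the matrix are
  insensitive to capping numbers at \<open>d\<close>.
\<close>

locale lcvp =
  fixes q :: nat and D :: "nat \<Rightarrow> nat \<Rightarrow> nat set \<times> nat set" and d :: nat and K :: nat
  assumes q_pos: "1 \<le> q" and K_pos: "K \<noteq> 0"
    and fin_or_cofin: "i \<in> {1..q} \<Longrightarrow> j \<in> {1..q} \<Longrightarrow> fin_or_cofin (fst (D i j)) \<and> fin_or_cofin (snd (D i j))"
    and capped: "i \<in> {1..q} \<Longrightarrow> j \<in> {1..q} \<Longrightarrow>
      (k \<in> fst (D i j) \<longleftrightarrow> min d k \<in> fst (D i j)) \<and> (k \<in> snd (D i j) \<longleftrightarrow> min d k \<in> snd (D i j))"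
begin

definition same :: "graph \<Rightarrow> colours \<Rightarrow> colours \<Rightarrow> nat \<Rightarrow> bool" where
  "same g c c' v \<longleftrightarrow> (\<forall>j\<in>{1..q}. min d (outdeg g c v j) = min d (outdeg g c' v j) \<and>
     min d (indeg g c v j) = min d (indeg g c' v j))"

definition fits :: "graph \<Rightarrow> colours \<Rightarrow> nat \<Rightarrow> bool" where
  "fits g c v \<longleftrightarrow> (\<forall>i\<in>{1..q}. colour c v = i \<longrightarrow>
     (\<forall>j\<in>{1..q}. outdeg g c v j \<in> fst (D i j) \<and> indeg g c v j \<in> snd (D i j)))"

definition agree :: "graph \<Rightarrow> bool list \<Rightarrow> colours \<Rightarrow> colours \<Rightarrow> bool" where
  "agree g B c c' \<longleftrightarrow> (\<forall>v\<in>set [0..<length g]. member B v \<longrightarrow> same g c c' v)"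

definition insert_new :: "graph \<Rightarrow> bool list \<Rightarrow> colours \<Rightarrow> colours list \<Rightarrow> colours list" where
  "insert_new g B e R = (if \<exists>r\<in>set R. agree g B e r then R else e # R)"

text \<open>
  One more vertex \<open>v\<close> of \<open>A\<close> is coloured in all ways, and of colourings that the vertices outside \<open>A\<close>
  cannot distinguish only one is kept. Colours are given to the vertices of \<open>A\<close> one by one because equivalence is preserved
  by further vertices, whereas the set of all colourings of \<open>A\<close> is too large.
\<close>

definition extend :: "graph \<Rightarrow> nat \<Rightarrow> bool list \<Rightarrow> nat \<Rightarrow> colours list \<Rightarrow> colours list" where
  "extend g limit A v R = (if member A v then trim limit (fold (insert_new g (compl g A))
     (concat (map (\<lambda>e. map (\<lambda>j. paint g e v j) [1..<Suc q]) R)) []) else R)"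

definition reps :: "graph \<Rightarrow> nat \<Rightarrow> bool list \<Rightarrow> colours list" where
  "reps g limit A = fold (extend g limit A) [0..<length g] [blank g]"

definition leaf_cands :: "graph \<Rightarrow> bool list \<Rightarrow> colours \<Rightarrow> colours list" where
  "leaf_cands g A e = concat (map (\<lambda>v. filter (\<lambda>c. fits g (merge g c e) v)
       (map (\<lambda>j. paint g (blank g) v j) [1..<Suc q]))
     (filter (\<lambda>v. \<forall>u\<in>set [0..<length g]. member A u = (u = v)) [0..<length g]))"

text \<open>
  The pairs \<open>(c1, e1)\<close> and \<open>(c2, e2)\<close> consist of a colouring of a set and an assumption about the colours
  outside. They can be joined to a colouring of \<open>A\<close> under the assumption \<open>e\<close> if the domains of \<open>c1\<close> and
  \<open>c2\<close> partition \<open>A\<close> and each vertex sees through its assumption \<open>e1\<close> or \<open>e2\<close> what it really sees in the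
  other part together with \<open>e\<close>.
\<close>

definition joinable :: "graph \<Rightarrow> bool list \<Rightarrow> colours \<Rightarrow>
    entry \<Rightarrow> entry \<Rightarrow> bool" where
  "joinable g A e p1 p2 \<longleftrightarrow> (\<forall>v\<in>set [0..<length g].
     member A v = (colour (fst p1) v \<noteq> 0 \<or> colour (fst p2) v \<noteq> 0) \<and>
     (colour (fst p1) v = 0 \<or> colour (fst p2) v = 0) \<and>
     (colour (fst p1) v \<noteq> 0 \<longrightarrow> same g (merge g (fst p2) e) (snd p1) v) \<and>
     (colour (fst p2) v \<noteq> 0 \<longrightarrow> same g (merge g (fst p1) e) (snd p2) v))"

definition join_cands :: "graph \<Rightarrow> entry list \<Rightarrow> bool list \<Rightarrow> colours \<Rightarrow> colours list" where
  "join_cands g S A e = concat (map (\<lambda>p1. map (\<lambda>p2. merge g (fst p1) (fst p2))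
     (filter (\<lambda>p2. joinable g A e p1 p2) S)) S)"

definition cost :: "graph \<Rightarrow> colours \<Rightarrow> nat" where
  "cost g c = length (filter (\<lambda>v. colour c v = K) [0..<length g])"

definition keep_cheaper :: "graph \<Rightarrow> colours \<Rightarrow> colours list \<Rightarrow> colours list" where
  "keep_cheaper g c b = (if \<exists>c'\<in>set b. cost g c' \<le> cost g c then b else [c])"

definition cheapest :: "graph \<Rightarrow> colours list \<Rightarrow> colours list" where
  "cheapest g cs = fold (keep_cheaper g) cs []"

text \<open>
  For each set \<open>A\<close> of the family, each representative \<open>r\<close> of the colourings of \<open>A\<close> and each
  representative \<open>e\<close> of the colourings of its complement, the new table has at most one entry: a
  cheapest known colouring that is equivalent to \<open>r\<close> and satisfies the vertices of \<open>A\<close> if the rest is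
  coloured by \<open>e\<close>. Indexing by representatives bounds the size of the table on all arguments.
\<close>

definition sweep :: "graph \<Rightarrow> nat \<Rightarrow> graph \<Rightarrow> entry list \<Rightarrow> entry list" where
  "sweep g limit F S = concat (map (\<lambda>A. concat (map (\<lambda>r. concat (map (\<lambda>e. map (\<lambda>c. (c, e))
       (cheapest g (filter (\<lambda>c. agree g (compl g A) c r) (leaf_cands g A e @ join_cands g S A e))))
     (reps g limit (compl g A)))) (reps g limit A))) F)"

text \<open>
  All sets are treated in every sweep, irrespective of their position in the decomposition tree. After
  \<open>k\<close> sweeps the entries for sets of at most \<open>k\<close> vertices are optimal, so \<open>n\<close> sweeps suffice.
\<close>

definition solve :: "graph \<Rightarrow> nat \<Rightarrow> graph \<Rightarrow> entry list" where
  "solve g limit F = fold (\<lambda>_. sweep g limit F) [0..<length g] []"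

definition overflow :: "graph \<Rightarrow> nat \<Rightarrow> graph \<Rightarrow> bool" where
  "overflow g limit F \<longleftrightarrow> (\<exists>A\<in>set F. reps g limit A = [] \<or> reps g limit (compl g A) = [])"

definition best :: "graph \<Rightarrow> nat \<Rightarrow> graph \<Rightarrow> colours list" where
  "best g limit F = cheapest g (filter (full g) (map fst (solve g limit F)))"

end

definition grow :: "graph \<Rightarrow> nat \<Rightarrow> nat \<Rightarrow> bool list \<Rightarrow> bool list" where
  "grow t x y R = map (\<lambda>z. member R z \<or> (\<exists>u\<in>set [0..<length t]. member R u \<and> adj t u z \<and>
     \<not> (u = x \<and> z = y) \<and> \<not> (u = y \<and> z = x))) [0..<length t]"

text \<open>
  A concatenation of \<open>m\<close> lists of length \<open>m\<close> serves as a counter: there are at most \<open>m * m\<close> arcs, so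
  \<open>m * m\<close> steps of growth reach the whole component.
\<close>

definition component :: "graph \<Rightarrow> nat \<Rightarrow> nat \<Rightarrow> bool list" where
  "component t x y = fold (\<lambda>_. grow t x y) (concat (map (\<lambda>_. [0..<length t]) [0..<length t]))
     (map (\<lambda>z. z = x) [0..<length t])"

definition cut :: "graph \<Rightarrow> graph \<Rightarrow> colours \<Rightarrow> nat \<Rightarrow> nat \<Rightarrow> bool list" where
  "cut g t L x y = map (\<lambda>v. member (component t x y) (nth_or 0 L v)) [0..<length g]"

text \<open>
  The whole vertex set is added as the final target of the dynamic programming: it is the union of the
  two sides of any edge.
\<close>

definition cuts :: "graph \<Rightarrow> graph \<Rightarrow> colours \<Rightarrow> graph" where
  "cuts g t L = map (\<lambda>_. True) [0..<length g] #
     concat (map (\<lambda>x. map (\<lambda>y. cut g t L x y) (filter (\<lambda>y. adj t x y) [0..<length t])) [0..<length t])"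

section \<open>Running time of the algorithm\<close>

text \<open>
  The proofs in this section follow the structure of the definitions. Under a binder, an argument \<open>g x\<close>
  appears as \<open>g (fst p)\<close>, which is what the composition rule applied to the assumptions covers.
\<close>

lemma ptime_adj [ptime_intros]:
  assumes "ptime g" "ptime u" "ptime v"
  shows "ptime (\<lambda>x. adj (g x) (u x) (v x))"
  unfolding adj_def by (intro ptime_intros assms)

lemma ptime_outdeg [ptime_intros]:
  assumes "ptime g" "ptime c" "ptime v" "ptime j"
  shows "ptime (\<lambda>x. outdeg (g x) (c x) (v x) (j x))"
  unfolding outdeg_def by (intro ptime_intros assms assms[THEN ptime_comp])

lemma ptime_indeg [ptime_intros]:
  assumes "ptime g" "ptime c" "ptime v" "ptime j"
  shows "ptime (\<lambda>x. indeg (g x) (c x) (v x) (j x))"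
  unfolding indeg_def by (intro ptime_intros assms assms[THEN ptime_comp])

lemma ptime_merge [ptime_intros]:
  assumes "ptime g" "ptime c" "ptime c'"
  shows "ptime (\<lambda>x. merge (g x) (c x) (c' x))"
  unfolding merge_def by (intro ptime_intros assms assms[THEN ptime_comp])

lemma ptime_paint [ptime_intros]:
  assumes "ptime g" "ptime c" "ptime v" "ptime j"
  shows "ptime (\<lambda>x. paint (g x) (c x) (v x) (j x))"
  unfolding paint_def by (intro ptime_intros assms assms[THEN ptime_comp])

lemma ptime_blank [ptime_intros]:
  assumes "ptime g"
  shows "ptime (\<lambda>x. blank (g x))"
  unfolding blank_def by (intro ptime_intros assms assms[THEN ptime_comp])

lemma ptime_compl [ptime_intros]:
  assumes "ptime g" "ptime A"
  shows "ptime (\<lambda>x. compl (g x) (A x))"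
  unfolding compl_def by (intro ptime_intros assms assms[THEN ptime_comp])

lemma ptime_trim [ptime_intros]:
  assumes "ptime limit" "ptime R"
  shows "ptime (\<lambda>x. trim (limit x) (R x))"
  unfolding trim_def by (intro ptime_intros assms)

lemma ptime_full [ptime_intros]:
  assumes "ptime g" "ptime c"
  shows "ptime (\<lambda>x. full (g x) (c x))"
  unfolding full_def by (intro ptime_intros assms assms[THEN ptime_comp])

lemma ptime_grow [ptime_intros]:
  assumes "ptime t" "ptime a" "ptime b" "ptime R"
  shows "ptime (\<lambda>x. grow (t x) (a x) (b x) (R x))"
  unfolding grow_def by (intro ptime_intros assms assms[THEN ptime_comp])

lemma ptime_component [ptime_intros]:
  assumes "ptime t" "ptime a" "ptime b"
  shows "ptime (\<lambda>x. component (t x) (a x) (b x))"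
  unfolding component_def
proof (rule ptime_fold_invariant[where f = "\<lambda>x _. grow (t x) (a x) (b x)" and I = "\<lambda>x R. length R = length (t x)"])
  show "pbound (\<lambda>x. 1 + sz (t x) * (3 + 1))" by (intro pbound_intros assms)
  show "sz R \<le> 1 + sz (t x) * (3 + 1)" if "length R = length (t x)" for x and R :: "bool list"
    using sz_list_le[of R 3] sz_bool_le that length_le_sz[of "t x"] by fastforce
qed ((intro ptime_intros assms assms[THEN ptime_comp])+, auto simp: grow_def)

lemma ptime_cut [ptime_intros]:
  assumes "ptime g" "ptime t" "ptime L" "ptime a" "ptime b"
  shows "ptime (\<lambda>x. cut (g x) (t x) (L x) (a x) (b x))"
  unfolding cut_def by (intro ptime_intros assms assms[THEN ptime_comp])

lemma ptime_cuts [ptime_intros]: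
  assumes "ptime g" "ptime t" "ptime L"
  shows "ptime (\<lambda>x. cuts (g x) (t x) (L x))"
  unfolding cuts_def by (intro ptime_intros assms assms[THEN ptime_comp])

context lcvp begin

lemma ptime_same [ptime_intros]:
  assumes "ptime g" "ptime c" "ptime c'" "ptime v"
  shows "ptime (\<lambda>x. same (g x) (c x) (c' x) (v x))"
  unfolding same_def by (intro ptime_intros assms finite_atLeastAtMost)

lemma ptime_fits [ptime_intros]:
  assumes "ptime g" "ptime c" "ptime v"
  shows "ptime (\<lambda>x. fits (g x) (c x) (v x))"
  unfolding fits_def
  by (intro ptime_intros ptime_nat_mem assms finite_atLeastAtMost) (use fin_or_cofin in auto)

lemma ptime_agree [ptime_intros]:
  assumes "ptime g" "ptime B" "ptime c" "ptime c'"
  shows "ptime (\<lambda>x. agree (g x) (B x) (c x) (c' x))"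
  unfolding agree_def by (intro ptime_intros assms assms[THEN ptime_comp])

lemma ptime_insert_new [ptime_intros]:
  assumes "ptime g" "ptime B" "ptime e" "ptime R"
  shows "ptime (\<lambda>x. insert_new (g x) (B x) (e x) (R x))"
  unfolding insert_new_def by (intro ptime_intros assms assms[THEN ptime_comp])

lemma ptime_fold_insert_new [ptime_intros]:
  assumes "ptime g" "ptime B" "ptime es"
  shows "ptime (\<lambda>x. fold (insert_new (g x) (B x)) (es x) [])"
proof (rule ptime_fold[where f = "\<lambda>x. insert_new (g x) (B x)"])
  show "pbound (\<lambda>x. sz (es x))" by (intro pbound_intros assms)
  have "sz (fold (insert_new h C) us R) + 1 \<le> sz us + sz R" for h C us R
  proof (induction us arbitrary: R)
    case (Cons u us)
    have "sz (insert_new h C u R) \<le> 1 + sz u + sz R" by (simp add: insert_new_def)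
    then show ?case using Cons[of "insert_new h C u R"] by simp
  qed simp
  note sz_fold = this
  fix x us vs assume x: "es x = us @ vs"
  show "sz (fold (insert_new (g x) (B x)) us []) \<le> sz (es x)"
    using sz_fold[of "g x" "B x" us "[]"] sz_prefix_le[of us vs] unfolding x by simp
qed (intro ptime_intros assms assms[THEN ptime_comp])+

lemma ptime_extend [ptime_intros]:
  assumes "ptime g" "ptime limit" "ptime A" "ptime v" "ptime R"
  shows "ptime (\<lambda>x. extend (g x) (limit x) (A x) (v x) (R x))"
  unfolding extend_def by (intro ptime_intros assms assms[THEN ptime_comp] assms[THEN ptime_comp, THEN ptime_comp])

definition bounded :: "graph \<Rightarrow> colours \<Rightarrow> bool" where
  "bounded g c \<longleftrightarrow> length c = length g \<and> (\<forall>v. colour c v \<le> q)"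

lemma sz_bounded:
  assumes "bounded g c"
  shows "sz c \<le> 1 + sz g * (2 * q + 2)"
proof -
  have "sz a \<le> 2 * q + 1" if a: "a \<in> set c" for a
  proof -
    obtain i where "i < length c" "c ! i = a" using a by (auto simp: in_set_conv_nth)
    then have "a = colour c i" by (simp add: nth_or_def)
    then have "a \<le> q" using assms by (simp add: bounded_def)
    then show ?thesis by simp
  qed
  then have "sz c \<le> 1 + length g * (2 * q + 2)"
    using sz_list_le[of c "2 * q + 1"] assms by (simp add: bounded_def)
  also have "\<dots> \<le> 1 + sz g * (2 * q + 2)"
    using length_le_sz[of g] by (intro add_left_mono mult_right_mono) auto
  finally show ?thesis .
qed

lemma bounded_paint: "bounded g c \<Longrightarrow> j \<le> q \<Longrightarrow> bounded g (paint g c v j)"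
  and bounded_merge: "bounded g c \<Longrightarrow> bounded g c' \<Longrightarrow> bounded g (merge g c c')"
  and bounded_blank: "bounded g (blank g)"
  by (simp_all add: bounded_def paint_def merge_def blank_def nth_or_map_upt)

lemma set_fold_insert_new: "set (fold (insert_new g B) es R) \<subseteq> set es \<union> set R"
proof (induction es arbitrary: R)
  case (Cons e es)
  have "set (insert_new g B e R) \<subseteq> insert e (set R)" by (auto simp: insert_new_def)
  then show ?case using Cons[of "insert_new g B e R"] by auto
qed simp

lemma extend_bounded:
  assumes "\<forall>c\<in>set R. bounded g c"
  shows "\<forall>c\<in>set (extend g limit A v R). bounded g c"
proof -
  let ?es = "concat (map (\<lambda>e. map (\<lambda>j. paint g e v j) [1..<Suc q]) R)"
  have es: "bounded g c" if "c \<in> set ?es" for c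
    using that assms by (auto intro!: bounded_paint)
  have "bounded g c" if "c \<in> set (fold (insert_new g (compl g A)) ?es [])" for c
    using subsetD[OF set_fold_insert_new that] es[of c] by (simp only: list.set(1) Un_empty_right)
  then show ?thesis
    using assms unfolding extend_def trim_def by (auto simp del: upt_Suc)
qed

text \<open>
  The shape of the intermediate lists of representatives. It holds on all inputs, also those that are
  not graphs, and bounds their sizes; the first list has one element even if the limit is \<open>0\<close>.
\<close>

definition rep_list :: "graph \<Rightarrow> nat \<Rightarrow> colours list \<Rightarrow> bool" where
  "rep_list g limit R \<longleftrightarrow> length R \<le> limit + 1 \<and> (\<forall>c\<in>set R. bounded g c)"

lemma rep_list_blank: "rep_list g limit [blank g]"
  by (simp add: rep_list_def bounded_blank)

lemma rep_list_extend:
  assumes "rep_list g limit R"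
  shows "rep_list g limit (extend g limit A v R)"
  using assms extend_bounded[of R g limit A v]
  by (auto simp: rep_list_def extend_def trim_def)

lemma rep_list_reps: "rep_list g limit (reps g limit A)"
  unfolding reps_def
  by (rule fold_invariant[where Q = "\<lambda>_. True"]) (auto intro: rep_list_blank rep_list_extend)

lemma ptime_reps [ptime_intros]:
  assumes "ptime g" "ptime limit" "ptime A"
  shows "ptime (\<lambda>x. reps (g x) (limit x) (A x))"
  unfolding reps_def
proof (rule ptime_fold_invariant[where f = "\<lambda>x. extend (g x) (limit x) (A x)" and I = "\<lambda>x. rep_list (g x) (limit x)"])
  let ?B = "\<lambda>x. 1 + (sz (limit x) + 1) * ((1 + sz (g x) * (2 * q + 2)) + 1)"
  show "pbound ?B" by (intro pbound_intros assms)
  show "sz R \<le> ?B x" if "rep_list (g x) (limit x) R" for x R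
  proof -
    have "sz c \<le> 1 + sz (g x) * (2 * q + 2)" if "c \<in> set R" for c
      using that \<open>rep_list (g x) (limit x) R\<close> sz_bounded by (auto simp: rep_list_def)
    then have "sz R \<le> 1 + length R * ((1 + sz (g x) * (2 * q + 2)) + 1)" by (rule sz_list_le)
    also have "\<dots> \<le> ?B x"
      using that by (intro add_left_mono mult_right_mono) (auto simp: rep_list_def)
    finally show ?thesis .
  qed
qed ((intro ptime_intros assms assms[THEN ptime_comp])+, auto intro: rep_list_blank rep_list_extend)

lemma ptime_leaf_cands [ptime_intros]:
  assumes "ptime g" "ptime A" "ptime e"
  shows "ptime (\<lambda>x. leaf_cands (g x) (A x) (e x))"
  unfolding leaf_cands_def by (intro ptime_intros assms assms[THEN ptime_comp])

lemma ptime_joinable [ptime_intros]: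
  assumes "ptime g" "ptime A" "ptime e" "ptime p1" "ptime p2"
  shows "ptime (\<lambda>x. joinable (g x) (A x) (e x) (p1 x) (p2 x))"
  unfolding joinable_def by (intro ptime_intros assms assms[THEN ptime_comp])

lemma ptime_join_cands [ptime_intros]:
  assumes "ptime g" "ptime S" "ptime A" "ptime e"
  shows "ptime (\<lambda>x. join_cands (g x) (S x) (A x) (e x))"
  unfolding join_cands_def by (intro ptime_intros assms assms[THEN ptime_comp])

lemma ptime_cost [ptime_intros]:
  assumes "ptime g" "ptime c"
  shows "ptime (\<lambda>x. cost (g x) (c x))"
  unfolding cost_def by (intro ptime_intros assms assms[THEN ptime_comp])

lemma ptime_keep_cheaper [ptime_intros]:
  assumes "ptime g" "ptime c" "ptime b"
  shows "ptime (\<lambda>x. keep_cheaper (g x) (c x) (b x))"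
  unfolding keep_cheaper_def by (intro ptime_intros assms assms[THEN ptime_comp])

lemma fold_keep_cheaper_cases:
  "fold (keep_cheaper g) cs [] = [] \<or> (\<exists>c\<in>set cs. fold (keep_cheaper g) cs [] = [c])"
proof (induction cs rule: rev_induct)
  case (snoc c cs)
  then show ?case by (auto simp: keep_cheaper_def)
qed simp

lemma ptime_cheapest [ptime_intros]:
  assumes "ptime g" "ptime cs"
  shows "ptime (\<lambda>x. cheapest (g x) (cs x))"
  unfolding cheapest_def
proof (rule ptime_fold[where f = "\<lambda>x. keep_cheaper (g x)"])
  show "pbound (\<lambda>x. 2 + sz (cs x))" by (intro pbound_intros assms)
  show "sz (fold (keep_cheaper (g x)) us []) \<le> 2 + sz (cs x)" if "cs x = us @ vs" for x us vs
    using fold_keep_cheaper_cases[of "g x" us] sz_mem_le[of _ "cs x"] that by fastforce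
qed (intro ptime_intros assms assms[THEN ptime_comp])+

lemma ptime_sweep [ptime_intros]:
  assumes "ptime g" "ptime limit" "ptime F" "ptime S"
  shows "ptime (\<lambda>x. sweep (g x) (limit x) (F x) (S x))"
  unfolding sweep_def by (intro ptime_intros assms assms[THEN ptime_comp])

definition table :: "graph \<Rightarrow> nat \<Rightarrow> graph \<Rightarrow> entry list \<Rightarrow> bool" where
  "table g limit F S \<longleftrightarrow> length S \<le> length F * ((limit + 1) * (limit + 1)) \<and>
     (\<forall>p\<in>set S. bounded g (fst p) \<and> bounded g (snd p))"

lemma cheapest_cases: "cheapest g cs = [] \<or> (\<exists>c\<in>set cs. cheapest g cs = [c])"
  unfolding cheapest_def by (rule fold_keep_cheaper_cases)

lemma length_concat_map_le:
  assumes "\<And>x. x \<in> set xs \<Longrightarrow> length (f x) \<le> b"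
  shows "length (concat (map f xs)) \<le> length xs * b"
  using assms by (induction xs) (simp_all, fastforce)

lemma table_sweep:
  assumes "table g limit F S"
  shows "table g limit F (sweep g limit F S)"
proof -
  have reps: "length (reps g limit A) \<le> limit + 1" for A using rep_list_reps by (simp add: rep_list_def)
  have 1: "length (map (\<lambda>c. (c, e)) (cheapest g cs)) \<le> 1" for e :: "nat list" and cs
    using cheapest_cases[of g cs] by auto
  have "length (concat (map (\<lambda>e. map (\<lambda>c. (c, e)) (cheapest g (h e))) (reps g limit A))) \<le> limit + 1" for h A
    using length_concat_map_le[of "reps g limit A" "\<lambda>e. map (\<lambda>c. (c, e)) (cheapest g (h e))" 1] 1 reps[of A]
    by fastforce
  then have 2: "length (concat (map (\<lambda>r. concat (map (\<lambda>e. map (\<lambda>c. (c, e)) (cheapest g (h r e))) (reps g limit A)))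
      (reps g limit A'))) \<le> (limit + 1) * (limit + 1)" for h A A'
    using length_concat_map_le[of "reps g limit A'" "\<lambda>r. concat (map (\<lambda>e. map (\<lambda>c. (c, e)) (cheapest g (h r e))) (reps g limit A))" "limit + 1"]
      mult_le_mono1[OF reps[of A'], of "limit + 1"] le_trans by blast
  have len: "length (sweep g limit F S) \<le> length F * ((limit + 1) * (limit + 1))"
    unfolding sweep_def by (intro length_concat_map_le 2)
  have cands: "\<forall>c\<in>set (leaf_cands g A e @ join_cands g S A e). bounded g c" for A e
    using assms
    by (auto simp: leaf_cands_def join_cands_def table_def intro!: bounded_paint bounded_merge bounded_blank)
  have "bounded g c" if "c \<in> set (cheapest g (filter P (leaf_cands g A e @ join_cands g S A e)))" for c P A e
    using cheapest_cases[of g "filter P (leaf_cands g A e @ join_cands g S A e)"] cands[of A e] that by auto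
  moreover have "\<forall>c\<in>set (reps g limit A). bounded g c" for A using rep_list_reps by (simp add: rep_list_def)
  ultimately have "\<forall>p\<in>set (sweep g limit F S). bounded g (fst p) \<and> bounded g (snd p)"
    unfolding sweep_def by auto
  with len show ?thesis by (simp add: table_def)
qed

lemma ptime_solve [ptime_intros]:
  assumes "ptime g" "ptime limit" "ptime F"
  shows "ptime (\<lambda>x. solve (g x) (limit x) (F x))"
  unfolding solve_def
proof (rule ptime_fold_invariant[where f = "\<lambda>x _. sweep (g x) (limit x) (F x)" and I = "\<lambda>x. table (g x) (limit x) (F x)"])
  let ?b = "\<lambda>x. 1 + (1 + sz (g x) * (2 * q + 2)) + (1 + sz (g x) * (2 * q + 2))"
  let ?B = "\<lambda>x. 1 + sz (F x) * ((sz (limit x) + 1) * (sz (limit x) + 1)) * (?b x + 1)"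
  show "pbound ?B" by (intro pbound_intros assms)
  show "sz S \<le> ?B x" if "table (g x) (limit x) (F x) S" for x S
  proof -
    have "sz p \<le> ?b x" if "p \<in> set S" for p
    proof -
      have "bounded (g x) (fst p)" "bounded (g x) (snd p)"
        using that \<open>table (g x) (limit x) (F x) S\<close> by (auto simp: table_def)
      then have "1 + sz (fst p) + sz (snd p) \<le> ?b x" using sz_bounded[of "g x" "fst p"] sz_bounded[of "g x" "snd p"] by linarith
      then show ?thesis by (cases p) (simp only: sz_simps fst_conv snd_conv)
    qed
    then have "sz S \<le> 1 + length S * (?b x + 1)" by (rule sz_list_le)
    also have "\<dots> \<le> ?B x"
    proof (intro add_left_mono mult_right_mono)
      have "length S \<le> length (F x) * ((limit x + 1) * (limit x + 1))" using that by (simp add: table_def)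
      also have "\<dots> \<le> sz (F x) * ((sz (limit x) + 1) * (sz (limit x) + 1))"
        by (intro mult_le_mono length_le_sz) simp_all
      finally show "length S \<le> sz (F x) * ((sz (limit x) + 1) * (sz (limit x) + 1))" .
    qed simp
    finally show ?thesis .
  qed
qed ((intro ptime_intros assms assms[THEN ptime_comp])+, auto simp: table_sweep, simp add: table_def)

lemma ptime_overflow [ptime_intros]:
  assumes "ptime g" "ptime limit" "ptime F"
  shows "ptime (\<lambda>x. overflow (g x) (limit x) (F x))"
  unfolding overflow_def by (intro ptime_intros assms assms[THEN ptime_comp])

lemma ptime_best [ptime_intros]:
  assumes "ptime g" "ptime limit" "ptime F"
  shows "ptime (\<lambda>x. best (g x) (limit x) (F x))"
  unfolding best_def by (intro ptime_intros assms assms[THEN ptime_comp])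

end

section \<open>Colourings and capped degrees\<close>

lemma colour_merge: "colour (merge g c c') v =
    (if v < length g then if colour c v = 0 then colour c' v else colour c v else 0)"
  by (simp add: merge_def nth_or_def)

lemma colour_paint: "colour (paint g c v j) u = (if u < length g then if u = v then j else colour c u else 0)"
  by (simp add: paint_def nth_or_def)

lemma colour_blank [simp]: "colour (blank g) u = 0"
  by (simp add: blank_def nth_or_def)

lemma length_colourings [simp]: "length (merge g c c') = length g" "length (paint g c v j) = length g"
    "length (blank g) = length g"
  by (simp_all add: merge_def paint_def blank_def)

lemma colouring_eqI:
  assumes "length c = length c'" "\<And>v. v < length c \<Longrightarrow> colour c v = colour c' v"
  shows "c = c'"
  using assms by (intro nth_equalityI) (auto simp: nth_or_def)

definition region :: "graph \<Rightarrow> bool list \<Rightarrow> nat set" where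
  "region g A = {v. v < length g \<and> member A v}"

text \<open>
  The abstract form of a decomposition tree on which the correctness proof rests. The parts \<open>B\<close> and \<open>C\<close>
  are proper subsets because regions are nonempty.
\<close>

definition decomposes :: "graph \<Rightarrow> graph \<Rightarrow> bool" where
  "decomposes g F \<longleftrightarrow> (\<forall>A\<in>set F. region g A \<noteq> {} \<and> ((\<exists>v. region g A = {v}) \<or>
     (\<exists>B\<in>set F. \<exists>C\<in>set F. region g A = region g B \<union> region g C \<and> region g B \<inter> region g C = {})))"

lemma member_compl: "member (compl g A) v \<longleftrightarrow> v < length g \<and> \<not> member A v"
  by (simp add: compl_def nth_or_def)

lemma region_compl: "region g (compl g A) = {..<length g} - region g A"
  by (auto simp: region_def member_compl)

lemma length_filter_disj:
  assumes "\<And>x. x \<in> set xs \<Longrightarrow> P x \<longleftrightarrow> Q x \<or> R x" "\<And>x. x \<in> set xs \<Longrightarrow> \<not> (Q x \<and> R x)"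
  shows "length (filter P xs) = length (filter Q xs) + length (filter R xs)"
  using assms by (induction xs) auto

definition disj :: "graph \<Rightarrow> colours \<Rightarrow> colours \<Rightarrow> bool" where
  "disj g c c' \<longleftrightarrow> (\<forall>v<length g. colour c v = 0 \<or> colour c' v = 0)"

lemma outdeg_merge: "disj g c e \<Longrightarrow> j \<noteq> 0 \<Longrightarrow> outdeg g (merge g c e) v j = outdeg g c v j + outdeg g e v j"
  unfolding outdeg_def by (rule length_filter_disj) (auto simp: disj_def colour_merge)

lemma indeg_merge: "disj g c e \<Longrightarrow> j \<noteq> 0 \<Longrightarrow> indeg g (merge g c e) v j = indeg g c v j + indeg g e v j"
  unfolding indeg_def by (rule length_filter_disj) (auto simp: disj_def colour_merge)

lemma merge_assoc: "merge g (merge g a b) c = merge g a (merge g b c)"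
  by (rule colouring_eqI) (auto simp: colour_merge)

lemma merge_commute: "disj g a b \<Longrightarrow> merge g a b = merge g b a"
  by (rule colouring_eqI) (auto simp: colour_merge disj_def)

context lcvp begin

definition colouring :: "graph \<Rightarrow> nat set \<Rightarrow> colours \<Rightarrow> bool" where
  "colouring g X c \<longleftrightarrow> bounded g c \<and> (\<forall>v<length g. colour c v \<noteq> 0 \<longleftrightarrow> v \<in> X)"

definition admissible :: "graph \<Rightarrow> nat set \<Rightarrow> colours \<Rightarrow> colours \<Rightarrow> bool" where
  "admissible g X c e \<longleftrightarrow> (\<forall>v\<in>X. fits g (merge g c e) v)"

lemma colouring_length: "colouring g X c \<Longrightarrow> length c = length g"
  by (simp add: colouring_def bounded_def)

lemma colouring_colour: "colouring g X c \<Longrightarrow> v < length g \<Longrightarrow> colour c v \<noteq> 0 \<longleftrightarrow> v \<in> X"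
  by (simp add: colouring_def)

lemma colouring_disj: "colouring g X c \<Longrightarrow> colouring g Y c' \<Longrightarrow> X \<inter> Y = {} \<Longrightarrow> disj g c c'"
  unfolding disj_def colouring_def by blast

lemma colouring_merge: "colouring g X c \<Longrightarrow> colouring g Y c' \<Longrightarrow> colouring g (X \<union> Y) (merge g c c')"
  by (auto simp: colouring_def bounded_merge colour_merge)

lemma colouring_paint:
  "colouring g X c \<Longrightarrow> j \<in> {1..q} \<Longrightarrow> colouring g (insert v X) (paint g c v j)"
  by (auto simp: colouring_def bounded_paint colour_paint)

lemma colouring_blank: "colouring g {} (blank g)"
  by (simp add: colouring_def bounded_blank)

lemma same_refl [simp]: "same g c c v"
  by (simp add: same_def)

lemma same_sym: "same g c c' v \<Longrightarrow> same g c' c v"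
  by (simp add: same_def)

lemma same_trans: "same g c c' v \<Longrightarrow> same g c' c'' v \<Longrightarrow> same g c c'' v"
  by (simp add: same_def)

lemma min_add_cong: "min d a = min d a' \<Longrightarrow> min d b = min d b' \<Longrightarrow> min d (a + b) = min d (a' + b')" for a b :: nat
  by linarith

text \<open>
  Capped numbers can be added: the capped sum depends only on the capped summands. This makes
  equivalence of colourings a congruence and is the reason why representatives suffice.
\<close>

lemma same_merge:
  assumes "disj g c e" "disj g c' e'" "same g c c' v" "same g e e' v"
  shows "same g (merge g c e) (merge g c' e') v"
  unfolding same_def
proof (intro ballI conjI)
  fix j assume j: "j \<in> {1..q}"
  then have j0: "j \<noteq> 0" by simp
  show "min d (outdeg g (merge g c e) v j) = min d (outdeg g (merge g c' e') v j)"
    unfolding outdeg_merge[OF assms(1) j0] outdeg_merge[OF assms(2) j0]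
    using assms(3,4) j unfolding same_def by (blast intro: min_add_cong)
  show "min d (indeg g (merge g c e) v j) = min d (indeg g (merge g c' e') v j)"
    unfolding indeg_merge[OF assms(1) j0] indeg_merge[OF assms(2) j0]
    using assms(3,4) j unfolding same_def by (blast intro: min_add_cong)
qed

text \<open>
  Here the choice of \<open>d\<close> enters: membership in the sets of the matrix depends on capped numbers only.
\<close>

lemma fits_same:
  assumes "same g c c' v" "colour c v = colour c' v"
  shows "fits g c v \<longleftrightarrow> fits g c' v"
proof -
  have "outdeg g c v j \<in> fst (D i j) \<longleftrightarrow> outdeg g c' v j \<in> fst (D i j)"
    "indeg g c v j \<in> snd (D i j) \<longleftrightarrow> indeg g c' v j \<in> snd (D i j)"
    if "i \<in> {1..q}" "j \<in> {1..q}" for i j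
    using capped[OF that, of "outdeg g c v j"] capped[OF that, of "outdeg g c' v j"]
      capped[OF that, of "indeg g c v j"] capped[OF that, of "indeg g c' v j"] assms(1) that(2)
    by (auto simp: same_def)
  then show ?thesis using assms(2) by (simp add: fits_def)
qed

lemma agree_refl [simp]: "agree g B c c"
  by (simp add: agree_def)

lemma agree_sym: "agree g B c c' \<Longrightarrow> agree g B c' c"
  by (simp add: agree_def same_sym)

lemma agree_trans: "agree g B c c' \<Longrightarrow> agree g B c' c'' \<Longrightarrow> agree g B c c''"
  unfolding agree_def using same_trans by blast

lemma agreeD: "agree g (compl g A) c c' \<Longrightarrow> v < length g \<Longrightarrow> v \<notin> region g A \<Longrightarrow> same g c c' v"
  by (simp add: agree_def region_def member_compl)

lemma agreeI: "(\<And>v. v < length g \<Longrightarrow> v \<notin> region g A \<Longrightarrow> same g c c' v) \<Longrightarrow> agree g (compl g A) c c'"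
  by (simp add: agree_def region_def member_compl)

end

section \<open>Representatives of the classes of colourings\<close>

context lcvp begin

lemma fold_insert_new_covers:
  assumes "e \<in> set es \<union> set R"
  shows "\<exists>r\<in>set (fold (insert_new g B) es R). agree g B e r"
  using assms
proof (induction es arbitrary: R rule: rev_induct)
  case Nil
  then show ?case by (intro bexI[of _ e]) simp_all
next
  case (snoc e' es)
  let ?R = "fold (insert_new g B) es R"
  have "\<exists>r\<in>set (insert_new g B e' ?R). agree g B e r"
  proof (cases "e = e'")
    case True
    then show ?thesis by (auto simp: insert_new_def)
  next
    case False
    then have "\<exists>r\<in>set ?R. agree g B e r" using snoc by auto
    then show ?thesis by (auto simp: insert_new_def)
  qed
  then show ?case by simp
qed

definition independent :: "graph \<Rightarrow> bool list \<Rightarrow> colours set \<Rightarrow> bool" where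
  "independent g B R \<longleftrightarrow> (\<forall>r\<in>R. \<forall>r'\<in>R. r \<noteq> r' \<longrightarrow> \<not> agree g B r r')"

lemma fold_insert_new_independent:
  assumes "independent g B (set R)" "distinct R"
  shows "independent g B (set (fold (insert_new g B) es R)) \<and> distinct (fold (insert_new g B) es R)"
  using assms
proof (induction es arbitrary: R)
  case (Cons e es)
  have "independent g B (set (insert_new g B e R)) \<and> distinct (insert_new g B e R)"
    using Cons.prems agree_refl[of g B e] agree_sym by (auto simp: insert_new_def independent_def)
  then show ?case using Cons.IH by simp
qed simp

text \<open>
  Representatives of the colourings of those vertices of \<open>A\<close> that are less than \<open>m\<close>, always with
  respect to what vertices outside the whole set \<open>A\<close> see.
\<close>

definition prefix_reps :: "graph \<Rightarrow> nat \<Rightarrow> bool list \<Rightarrow> nat \<Rightarrow> colours list" where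
  "prefix_reps g limit A m = fold (extend g limit A) [0..<m] [blank g]"

lemma prefix_reps_simps:
  "prefix_reps g limit A 0 = [blank g]"
  "prefix_reps g limit A (Suc m) = extend g limit A m (prefix_reps g limit A m)"
  by (simp_all add: prefix_reps_def)

lemma set_trim: "set (trim limit R) \<subseteq> set R"
  by (auto simp: trim_def)

lemma in_repaint:
  "e \<in> set (concat (map (\<lambda>e. map (\<lambda>j. paint g e v j) [1..<Suc q]) R)) \<longleftrightarrow>
    (\<exists>r\<in>set R. \<exists>j\<in>{1..q}. e = paint g r v j)"
  by (auto simp del: upt_Suc simp: atLeastLessThanSuc_atLeastAtMost)

lemma prefix_reps_sound:
  assumes "r \<in> set (prefix_reps g limit A m)"
  shows "colouring g (region g A \<inter> {..<m}) r"
  using assms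
proof (induction m arbitrary: r)
  case 0
  then show ?case by (simp add: prefix_reps_simps colouring_blank)
next
  case (Suc m)
  show ?case
  proof (cases "member A m")
    case False
    then have "region g A \<inter> {..<Suc m} = region g A \<inter> {..<m}"
      by (auto simp: region_def less_Suc_eq)
    then show ?thesis using Suc False by (simp add: prefix_reps_simps extend_def)
  next
    case True
    let ?es = "concat (map (\<lambda>e. map (\<lambda>j. paint g e m j) [1..<Suc q]) (prefix_reps g limit A m))"
    have "r \<in> set (fold (insert_new g (compl g A)) ?es [])"
      using Suc.prems True subsetD[OF set_trim] unfolding prefix_reps_simps extend_def by (simp only: if_True)
    from subsetD[OF set_fold_insert_new this] have "r \<in> set ?es" by (simp only: list.set(1) Un_empty_right)
    then obtain r' j where r': "r' \<in> set (prefix_reps g limit A m)" "j \<in> {1..q}" "r = paint g r' m j"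
      unfolding in_repaint by blast
    then have "colouring g (insert m (region g A \<inter> {..<m})) r"
      using colouring_paint Suc.IH by blast
    moreover have "v < length g \<Longrightarrow> v \<in> insert m (region g A \<inter> {..<m}) \<longleftrightarrow> v \<in> region g A \<inter> {..<Suc m}" for v
      using True by (auto simp: region_def less_Suc_eq)
    ultimately show ?thesis by (simp add: colouring_def)
  qed
qed

text \<open>
  Painting an uncoloured vertex is merging with a colouring of that single vertex.
\<close>

lemma same_paint:
  assumes "colour c v = 0" "colour c' v = 0" "same g c c' u" "v < length g"
  shows "same g (paint g c v j) (paint g c' v j) u"
proof -
  have "paint g b v j = merge g (paint g (blank g) v j) b" if "colour b v = 0" for b
    by (rule colouring_eqI) (use that in \<open>auto simp: colour_paint colour_merge\<close>)
  moreover have "disj g (paint g (blank g) v j) b" if "colour b v = 0" for b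
    using that by (simp add: disj_def colour_paint)
  ultimately show ?thesis
    using same_merge[of g "paint g (blank g) v j" c "paint g (blank g) v j" c' u] assms(1-3)
    by (simp only: same_refl)
qed

lemma prefix_reps_complete:
  assumes "prefix_reps g limit A m \<noteq> []" "m \<le> length g" "colouring g (region g A \<inter> {..<m}) c"
  shows "\<exists>r\<in>set (prefix_reps g limit A m). agree g (compl g A) c r"
  using assms
proof (induction m arbitrary: c)
  case 0
  have "c = blank g"
    by (rule colouring_eqI) (use 0(3) in \<open>auto simp: colouring_def bounded_def\<close>)
  then show ?case by (simp add: prefix_reps_simps)
next
  case (Suc m)
  let ?R = "prefix_reps g limit A m"
  let ?es = "concat (map (\<lambda>e. map (\<lambda>j. paint g e m j) [1..<Suc q]) ?R)"
  show ?case
  proof (cases "member A m")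
    case False
    then have "region g A \<inter> {..<Suc m} = region g A \<inter> {..<m}"
      by (auto simp: region_def less_Suc_eq)
    then show ?thesis using Suc False by (simp add: prefix_reps_simps extend_def)
  next
    case True
    then have ext: "prefix_reps g limit A (Suc m) = trim limit (fold (insert_new g (compl g A)) ?es [])"
      by (simp add: prefix_reps_simps extend_def)
    then have eq: "prefix_reps g limit A (Suc m) = fold (insert_new g (compl g A)) ?es []"
      using Suc.prems(1) by (metis trim_def)
    have ne: "?R \<noteq> []" using Suc.prems(1) eq by (auto simp del: upt_Suc)
    have m: "m < length g" using Suc.prems(2) by simp
    \<comment> \<open>the restriction of the colouring to the earlier vertices\<close>
    define c0 where "c0 = paint g c m 0"
    have "colouring g (region g A \<inter> {..<m}) c0"
      using Suc.prems(3) bounded_paint[of g c 0 m]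
      by (auto simp: colouring_def c0_def colour_paint less_Suc_eq)
    then obtain r0 where r0: "r0 \<in> set ?R" "agree g (compl g A) c0 r0"
      using Suc.IH ne m by force
    define j where "j = colour c m"
    have j: "j \<in> {1..q}"
      using Suc.prems(3) m True by (auto simp: j_def colouring_def bounded_def region_def Suc_le_eq)
    have c: "c = paint g c0 m j"
      by (rule colouring_eqI)
        (use colouring_length[OF Suc.prems(3)] in \<open>auto simp: colour_paint c0_def j_def\<close>)
    have "colour r0 m = 0"
      using colouring_colour[OF prefix_reps_sound[OF r0(1)] m] by simp
    then have "agree g (compl g A) c (paint g r0 m j)"
      using r0(2) same_paint[of c0 m r0] m unfolding c agree_def by (auto simp: c0_def colour_paint)
    moreover have "paint g r0 m j \<in> set ?es" unfolding in_repaint using r0(1) j by blast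
    then obtain r where "r \<in> set (fold (insert_new g (compl g A)) ?es [])"
        "agree g (compl g A) (paint g r0 m j) r"
      using fold_insert_new_covers[of "paint g r0 m j" ?es "[]"] by (metis Un_iff)
    ultimately show ?thesis unfolding eq using agree_trans by blast
  qed
qed

lemma reps_sound: "r \<in> set (reps g limit A) \<Longrightarrow> colouring g (region g A) r"
  using prefix_reps_sound[of r g limit A "length g"]
  by (simp add: prefix_reps_def reps_def colouring_def)

lemma reps_complete:
  assumes "reps g limit A \<noteq> []" "colouring g (region g A) c"
  shows "\<exists>r\<in>set (reps g limit A). agree g (compl g A) c r"
  using prefix_reps_complete[of g limit A "length g" c] assms
  by (simp add: prefix_reps_def reps_def colouring_def)

lemma reps_empty:
  assumes "region g A = {}"
  shows "reps g limit A = [blank g]"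
proof -
  have "prefix_reps g limit A m = [blank g]" if "m \<le> length g" for m
    using that assms by (induction m) (auto simp: prefix_reps_simps extend_def region_def)
  then show ?thesis by (simp add: reps_def prefix_reps_def)
qed

text \<open>
  Representatives are pairwise inequivalent and colour subsets of the region, at every stage. So a
  bound on the number of such colourings keeps all stages within the limit.
\<close>

lemma reps_nonempty:
  assumes few: "\<And>S. finite S \<Longrightarrow> (\<And>c. c \<in> S \<Longrightarrow> \<exists>X\<subseteq>region g A. colouring g X c) \<Longrightarrow>
      independent g (compl g A) S \<Longrightarrow> card S \<le> limit"
  shows "reps g limit A \<noteq> []"
proof -
  have "prefix_reps g limit A m \<noteq> []" if "m \<le> length g" for m
    using that
  proof (induction m)
    case 0
    then show ?case by (simp add: prefix_reps_simps)
  next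
    case (Suc m)
    let ?R = "prefix_reps g limit A m"
    let ?es = "concat (map (\<lambda>e. map (\<lambda>j. paint g e m j) [1..<Suc q]) ?R)"
    let ?S = "fold (insert_new g (compl g A)) ?es []"
    show ?case
    proof (cases "member A m")
      case False
      then show ?thesis using Suc by (simp add: prefix_reps_simps extend_def)
    next
      case True
      obtain r where "r \<in> set ?R" using Suc by (cases ?R) auto
      then have "paint g r m 1 \<in> set ?es" unfolding in_repaint using q_pos by force
      then have ne: "?S \<noteq> []"
        using fold_insert_new_covers[of "paint g r m 1" ?es "[]" g "compl g A"] by (metis Un_iff empty_iff list.set(1))
      have ind: "independent g (compl g A) (set ?S)" "distinct ?S"
        using fold_insert_new_independent[of g "compl g A" "[]" ?es] by (auto simp: independent_def)
      have "card (set ?S) \<le> limit"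
      proof (rule few[OF _ _ ind(1)])
        fix c assume "c \<in> set ?S"
        from subsetD[OF set_fold_insert_new this] have "c \<in> set ?es" by (simp only: list.set(1) Un_empty_right)
        then obtain r j where "r \<in> set ?R" "j \<in> {1..q}" "c = paint g r m j" unfolding in_repaint by blast
        then have "colouring g (insert m (region g A \<inter> {..<m})) c"
          using colouring_paint prefix_reps_sound by blast
        moreover have "insert m (region g A \<inter> {..<m}) \<subseteq> region g A"
          using True Suc.prems by (auto simp: region_def)
        ultimately show "\<exists>X\<subseteq>region g A. colouring g X c" by blast
      qed simp
      then have "length ?S \<le> limit" using distinct_card[OF ind(2)] by simp
      then show ?thesis using ne True by (simp add: prefix_reps_simps extend_def trim_def)
    qed
  qed
  then show ?thesis by (simp add: reps_def prefix_reps_def)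
qed

end

section \<open>Correctness of the tables\<close>

context lcvp begin

lemma cost_merge: "disj g c e \<Longrightarrow> cost g (merge g c e) = cost g c + cost g e"
  unfolding cost_def by (rule length_filter_disj) (use K_pos in \<open>auto simp: disj_def colour_merge\<close>)

lemma cheapest_optimal:
  assumes "c \<in> set cs"
  shows "\<exists>c'\<in>set (cheapest g cs). cost g c' \<le> cost g c"
  using assms unfolding cheapest_def
proof (induction cs rule: rev_induct)
  case (snoc b cs)
  have keep: "\<exists>c'\<in>set (keep_cheaper g b B). cost g c' \<le> cost g c"
    if "c = b \<or> (\<exists>c'\<in>set B. cost g c' \<le> cost g c)" "B = [] \<or> (\<exists>b'. B = [b'])" for B
    using that by (auto simp: keep_cheaper_def)
  show ?case
    using keep[of "fold (keep_cheaper g) cs []"] snoc fold_keep_cheaper_cases[of g cs] by auto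
qed simp

lemma set_cheapest: "set (cheapest g cs) \<subseteq> set cs"
  using cheapest_cases[of g cs] by auto

definition table_sound :: "graph \<Rightarrow> entry list \<Rightarrow> bool" where
  "table_sound g S \<longleftrightarrow> (\<forall>(c, e)\<in>set S. \<exists>X\<subseteq>{..<length g}. colouring g X c \<and>
     colouring g ({..<length g} - X) e \<and> admissible g X c e)"

lemma leaf_cands_sound:
  assumes "c \<in> set (leaf_cands g A e)"
  shows "colouring g (region g A) c \<and> admissible g (region g A) c e"
proof -
  from assms obtain v j where v: "v < length g" "\<forall>u<length g. member A u = (u = v)" "j \<in> {1..q}"
    "c = paint g (blank g) v j" "fits g (merge g c e) v"
    unfolding leaf_cands_def by (auto simp del: upt_Suc simp: atLeastLessThanSuc_atLeastAtMost)
  then have "region g A = {v}" by (auto simp: region_def)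
  then show ?thesis using v colouring_paint[OF colouring_blank v(3), of g v] by (simp add: admissible_def)
qed

lemma leaf_cands_complete:
  assumes A: "region g A = {v}" and c: "colouring g {v} c" and adm: "admissible g {v} c e"
  shows "c \<in> set (leaf_cands g A e)"
proof -
  have reg: "u \<in> region g A \<longleftrightarrow> u = v" for u by (simp add: A)
  have v: "v < length g" using reg[of v] by (simp add: region_def)
  have u: "\<forall>u\<in>set [0..<length g]. member A u = (u = v)"
  proof
    fix u assume "u \<in> set [0..<length g]"
    then show "member A u = (u = v)" using reg[of u] by (simp add: region_def)
  qed
  have j: "colour c v \<in> {1..q}"
    using c v by (auto simp: colouring_def bounded_def Suc_le_eq)
  have "c = paint g (blank g) v (colour c v)"
    by (rule colouring_eqI) (use c in \<open>auto simp: colouring_def bounded_def colour_paint\<close>)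
  then have "c \<in> set (map (\<lambda>j. paint g (blank g) v j) [1..<Suc q])"
    using j by (auto simp del: upt_Suc simp: atLeastLessThanSuc_atLeastAtMost)
  moreover have "fits g (merge g c e) v" using adm by (simp add: admissible_def)
  moreover have "v \<in> set (filter (\<lambda>v. \<forall>u\<in>set [0..<length g]. member A u = (u = v)) [0..<length g])"
    using v u by simp
  ultimately show ?thesis
    unfolding leaf_cands_def set_concat set_map by (intro UN_I[of _ ] imageI) auto
qed

text \<open>
  Regrouping the three colourings as \<open>c1\<close> and the rest, the rest looks to \<open>v\<close> like \<open>e1\<close>.
\<close>

lemma admissible_join:
  assumes c1: "colouring g X1 c1" and e1: "colouring g ({..<length g} - X1) e1"
    and c2: "colouring g X2 c2" and e: "colouring g ({..<length g} - (X1 \<union> X2)) e"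
    and X: "X1 \<inter> X2 = {}" "X2 \<subseteq> {..<length g}" "v \<in> X1" "v < length g"
    and s: "same g (merge g c2 e) e1 v"
  shows "fits g (merge g (merge g c1 c2) e) v \<longleftrightarrow> fits g (merge g c1 e1) v"
  unfolding merge_assoc
proof (rule fits_same)
  have "colouring g (X2 \<union> ({..<length g} - (X1 \<union> X2))) (merge g c2 e)"
    using colouring_merge[OF c2 e] .
  then have "disj g c1 (merge g c2 e)" by (rule colouring_disj[OF c1]) (use X in auto)
  moreover have "disj g c1 e1" by (rule colouring_disj[OF c1 e1]) auto
  ultimately show "same g (merge g c1 (merge g c2 e)) (merge g c1 e1) v"
    using s by (intro same_merge) auto
  show "colour (merge g c1 (merge g c2 e)) v = colour (merge g c1 e1) v"
    using colouring_colour[OF c1 X(4)] X(3,4) by (simp add: colour_merge)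
qed

lemma join_cands_sound:
  assumes S: "table_sound g S" and e: "colouring g ({..<length g} - region g A) e"
    and c: "c \<in> set (join_cands g S A e)"
  shows "colouring g (region g A) c \<and> admissible g (region g A) c e"
proof -
  from c obtain c1 e1 c2 e2 where in_S: "(c1, e1) \<in> set S" "(c2, e2) \<in> set S"
    and jn: "joinable g A e (c1, e1) (c2, e2)" and c: "c = merge g c1 c2"
    unfolding join_cands_def by force
  obtain X1 where X1: "X1 \<subseteq> {..<length g}" "colouring g X1 c1" "colouring g ({..<length g} - X1) e1"
      "admissible g X1 c1 e1"
    using S in_S(1) by (auto simp: table_sound_def)
  obtain X2 where X2: "X2 \<subseteq> {..<length g}" "colouring g X2 c2" "colouring g ({..<length g} - X2) e2"
      "admissible g X2 c2 e2"
    using S in_S(2) by (auto simp: table_sound_def)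
  have j: "v \<in> region g A \<longleftrightarrow> v \<in> X1 \<or> v \<in> X2" "v \<notin> X1 \<or> v \<notin> X2"
    "v \<in> X1 \<Longrightarrow> same g (merge g c2 e) e1 v" "v \<in> X2 \<Longrightarrow> same g (merge g c1 e) e2 v" if "v < length g" for v
    using jn colouring_colour[OF X1(2) that] colouring_colour[OF X2(2) that] that
    unfolding joinable_def region_def by auto
  have reg: "region g A = X1 \<union> X2" using j(1) X1(1) X2(1) by (auto simp: region_def)
  have dis: "X1 \<inter> X2 = {}" using j(2) X1(1) by blast
  have col: "colouring g (X1 \<union> X2) c" unfolding c by (rule colouring_merge[OF X1(2) X2(2)])
  have comm: "merge g c1 c2 = merge g c2 c1"
    by (rule merge_commute[OF colouring_disj[OF X1(2) X2(2) dis]])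
  have "fits g (merge g c e) v" if "v \<in> X1 \<union> X2" for v
    using that
  proof
    assume v: "v \<in> X1"
    then have "v < length g" using X1(1) by auto
    then show ?thesis
      using admissible_join[OF X1(2,3) X2(2) _ dis X2(1) v] j(3)[of v] e v X1(4)
      unfolding c reg admissible_def by blast
  next
    assume v: "v \<in> X2"
    then have "v < length g" using X2(1) by auto
    then show ?thesis
      using admissible_join[OF X2(2,3) X1(2) _ _ X1(1) v] j(4)[of v] e v X2(4) dis
      unfolding c comm reg admissible_def by (metis Int_commute Un_commute)
  qed
  then show ?thesis using col unfolding reg admissible_def by blast
qed

definition cands :: "graph \<Rightarrow> entry list \<Rightarrow> bool list \<Rightarrow> colours \<Rightarrow> colours set" where
  "cands g S A e = set (leaf_cands g A e) \<union> set (join_cands g S A e)"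

lemma in_sweep:
  "(c, e) \<in> set (sweep g limit F S) \<longleftrightarrow> (\<exists>A\<in>set F. \<exists>r\<in>set (reps g limit A). e \<in> set (reps g limit (compl g A)) \<and>
     c \<in> set (cheapest g (filter (\<lambda>c. agree g (compl g A) c r) (leaf_cands g A e @ join_cands g S A e))))"
  unfolding sweep_def by auto

lemma cands_sound:
  assumes "table_sound g S" "e \<in> set (reps g limit (compl g A))" "c \<in> cands g S A e"
  shows "colouring g (region g A) c \<and> admissible g (region g A) c e"
  using assms leaf_cands_sound join_cands_sound[of g S A e c] reps_sound[OF assms(2)]
  by (auto simp: cands_def region_compl)

lemma in_sweepE:
  assumes "(c, e) \<in> set (sweep g limit F S)"
  obtains A r where "A \<in> set F" "r \<in> set (reps g limit A)" "e \<in> set (reps g limit (compl g A))"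
    "c \<in> cands g S A e" "agree g (compl g A) c r"
  using assms subsetD[OF set_cheapest] unfolding in_sweep cands_def by fastforce

lemma table_sound_sweep:
  assumes "table_sound g S"
  shows "table_sound g (sweep g limit F S)"
  unfolding table_sound_def
proof (intro ballI, clarify)
  fix c e assume "(c, e) \<in> set (sweep g limit F S)"
  then obtain A where A: "e \<in> set (reps g limit (compl g A))" "c \<in> cands g S A e" by (rule in_sweepE)
  have "colouring g (region g A) c \<and> admissible g (region g A) c e" by (rule cands_sound[OF assms A])
  moreover have "colouring g ({..<length g} - region g A) e" using reps_sound[OF A(1)] by (simp add: region_compl)
  moreover have "region g A \<subseteq> {..<length g}" by (auto simp: region_def)
  ultimately show "\<exists>X\<subseteq>{..<length g}. colouring g X c \<and> colouring g ({..<length g} - X) e \<and> admissible g X c e"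
    by blast
qed

text \<open>
  Entries need not be the given colouring \<open>c\<close> but one that costs no more and that no vertex outside can
  distinguish from \<open>c\<close>. The assumption \<open>e\<close> must be one of the representatives.
\<close>

definition table_complete :: "graph \<Rightarrow> nat \<Rightarrow> graph \<Rightarrow> nat \<Rightarrow> entry list \<Rightarrow> bool" where
  "table_complete g limit F k S \<longleftrightarrow> (\<forall>A\<in>set F. card (region g A) \<le> k \<longrightarrow>
     (\<forall>e\<in>set (reps g limit (compl g A)). \<forall>c. colouring g (region g A) c \<and> admissible g (region g A) c e \<longrightarrow>
       (\<exists>c'. (c', e) \<in> set S \<and> colouring g (region g A) c' \<and> agree g (compl g A) c' c \<and> cost g c' \<le> cost g c)))"

definition restrict_to :: "graph \<Rightarrow> nat set \<Rightarrow> colours \<Rightarrow> colours" where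
  "restrict_to g X c = map (\<lambda>v. if v \<in> X then colour c v else 0) [0..<length g]"

lemma colour_restrict_to: "colour (restrict_to g X c) v = (if v < length g \<and> v \<in> X then colour c v else 0)"
  by (simp add: restrict_to_def nth_or_def)

lemma colouring_restrict_to: "colouring g Y c \<Longrightarrow> X \<subseteq> Y \<Longrightarrow> colouring g X (restrict_to g X c)"
  by (auto simp: colouring_def bounded_def colour_restrict_to) (simp add: restrict_to_def)

lemma merge_restrict_to:
  assumes "colouring g (X \<union> Y) c"
  shows "merge g (restrict_to g X c) (restrict_to g Y c) = c"
  by (rule colouring_eqI) (use assms in \<open>auto simp: colouring_def bounded_def colour_merge colour_restrict_to\<close>)

text \<open>
  Let \<open>b\<close> be the part of a solution on one half \<open>B\<close> of a set, \<open>c\<close> its part on the other half \<open>Y\<close> and \<open>e\<close>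
  the assumption about the rest. From the point of view of \<open>B\<close>, the colouring of everything else is
  equivalent to some representative \<open>e'\<close>, and the table has an entry for \<open>B\<close> and \<open>e'\<close>.
\<close>

lemma half_solution:
  assumes S: "table_complete g limit F k S" and nov: "\<not> overflow g limit F"
    and B: "B \<in> set F" "card (region g B) \<le> k"
    and b: "colouring g (region g B) b" and c: "colouring g Y c" and e: "colouring g ({..<length g} - (region g B \<union> Y)) e"
    and Y: "region g B \<inter> Y = {}" "Y \<subseteq> {..<length g}"
    and adm: "\<And>v. v \<in> region g B \<Longrightarrow> fits g (merge g (merge g b c) e) v"
  shows "\<exists>b' e'. (b', e') \<in> set S \<and> colouring g (region g B) b' \<and> agree g (compl g B) b' b \<and>
    cost g b' \<le> cost g b \<and> (\<forall>v\<in>region g B. same g (merge g c e) e' v)"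
proof -
  have regB: "region g B \<subseteq> {..<length g}" by (auto simp: region_def)
  have "colouring g (Y \<union> ({..<length g} - (region g B \<union> Y))) (merge g c e)"
    by (rule colouring_merge[OF c e])
  moreover have "Y \<union> ({..<length g} - (region g B \<union> Y)) = {..<length g} - region g B" using Y by auto
  ultimately have ce: "colouring g (region g (compl g B)) (merge g c e)" by (simp add: region_compl)
  have "reps g limit (compl g B) \<noteq> []" using nov B(1) by (auto simp: overflow_def)
  from reps_complete[OF this ce] obtain e' where e': "e' \<in> set (reps g limit (compl g B))"
    "agree g (compl g (compl g B)) (merge g c e) e'" by blast
  have same: "same g (merge g c e) e' v" if "v \<in> region g B" for v
    using agreeD[OF e'(2), of v] that regB by (auto simp: region_compl)
  have e'c: "colouring g ({..<length g} - region g B) e'" using reps_sound[OF e'(1)] by (simp add: region_compl)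
  have "admissible g (region g B) b e'"
    unfolding admissible_def
  proof
    fix v assume v: "v \<in> region g B"
    then have "v < length g" using regB by auto
    then show "fits g (merge g b e') v"
      using admissible_join[OF b e'c c e Y v _ same[OF v]] adm[OF v] by simp
  qed
  then show ?thesis using S B e'(1) b same unfolding table_complete_def by metis
qed

text \<open>
  A solution \<open>c\<close> on \<open>A = B \<union> C\<close> splits into \<open>c1\<close> and \<open>c2\<close>. The table has substitutes \<open>b1\<close> and \<open>b2\<close> that
  cost no more. They were found under assumptions made for \<open>c1\<close> and \<open>c2\<close>, but remain joinable: outside its
  domain a substitute cannot be distinguished from the original, so replacing \<open>c2\<close> by \<open>b2\<close> does not
  affect what the vertices of \<open>B\<close> see, and vice versa.
\<close>

lemma table_complete_sweep:
  assumes F: "decomposes g F" and nov: "\<not> overflow g limit F"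
    and snd: "table_sound g S" and S: "table_complete g limit F k S"
  shows "table_complete g limit F (Suc k) (sweep g limit F S)"
  unfolding table_complete_def
proof (intro ballI impI allI, elim conjE)
  fix A e c assume A: "A \<in> set F" "card (region g A) \<le> Suc k" and e: "e \<in> set (reps g limit (compl g A))"
    and c: "colouring g (region g A) c" and adm: "admissible g (region g A) c e"
  have ec: "colouring g ({..<length g} - region g A) e" using reps_sound[OF e] by (simp add: region_compl)
  have "\<exists>c0\<in>cands g S A e. agree g (compl g A) c0 c \<and> cost g c0 \<le> cost g c"
  proof (cases "\<exists>v. region g A = {v}")
    case True
    then obtain v where v: "region g A = {v}" by blast
    then have "c \<in> cands g S A e" using leaf_cands_complete[OF v] c adm by (simp add: cands_def)
    then show ?thesis using agree_refl by blast
  next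
    case False
    then obtain B C where BC: "B \<in> set F" "C \<in> set F" "region g A = region g B \<union> region g C"
      "region g B \<inter> region g C = {}"
      using F A(1) unfolding decomposes_def by blast
    have ne: "region g B \<noteq> {}" "region g C \<noteq> {}" using F BC(1,2) unfolding decomposes_def by blast+
    have fin: "finite (region g X)" "region g X \<subseteq> {..<length g}" for X by (auto simp: region_def)
    have "card (region g A) = card (region g B) + card (region g C)"
      unfolding BC(3) using BC(4) fin by (intro card_Un_disjoint) auto
    moreover have "card (region g B) \<noteq> 0" "card (region g C) \<noteq> 0" using ne fin by auto
    ultimately have k: "card (region g B) \<le> k" "card (region g C) \<le> k" using A(2) by linarith+
    define c1 where "c1 = restrict_to g (region g B) c"
    define c2 where "c2 = restrict_to g (region g C) c"
    have c1: "colouring g (region g B) c1" and c2: "colouring g (region g C) c2"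
      unfolding c1_def c2_def using c BC(3) by (auto intro: colouring_restrict_to)
    have m: "merge g c1 c2 = c" unfolding c1_def c2_def using c BC(3) by (simp add: merge_restrict_to)
    have dj: "disj g c1 c2" by (rule colouring_disj[OF c1 c2 BC(4)])
    have m': "merge g c2 c1 = c" using m merge_commute[OF dj] by simp
    have ec': "colouring g ({..<length g} - (region g B \<union> region g C)) e"
      "colouring g ({..<length g} - (region g C \<union> region g B)) e" using ec BC(3) by (simp_all add: Un_commute)
    have CB: "region g C \<inter> region g B = {}" using BC(4) by auto
    obtain b1 e1 where b1: "(b1, e1) \<in> set S" "colouring g (region g B) b1" "agree g (compl g B) b1 c1"
      "cost g b1 \<le> cost g c1" and s1: "\<forall>v\<in>region g B. same g (merge g c2 e) e1 v"
      using half_solution[OF S nov BC(1) k(1) c1 c2 ec'(1) BC(4) fin(2)] adm m BC(3)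
      unfolding admissible_def by auto
    obtain b2 e2 where b2: "(b2, e2) \<in> set S" "colouring g (region g C) b2" "agree g (compl g C) b2 c2"
      "cost g b2 \<le> cost g c2" and s2: "\<forall>v\<in>region g C. same g (merge g c1 e) e2 v"
      using half_solution[OF S nov BC(2) k(2) c2 c1 ec'(2) CB fin(2)] adm m' BC(3)
      unfolding admissible_def by auto
    have de: "disj g b e" if "colouring g Y b" "Y \<subseteq> region g A" for b Y
      by (rule colouring_disj[OF that(1) ec]) (use that(2) in auto)
    have sub: "region g B \<subseteq> region g A" "region g C \<subseteq> region g A" using BC(3) by auto
    have db: "disj g b1 b2" by (rule colouring_disj[OF b1(2) b2(2) BC(4)])
    \<comment> \<open>the vertices of \<open>B\<close> do not notice that \<open>c2\<close> is replaced by \<open>b2\<close>\<close>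
    have t1: "same g (merge g b2 e) e1 v" if "v \<in> region g B" for v
    proof -
      have "v < length g" "v \<notin> region g C" using that fin(2) BC(4) by auto
      then have "same g b2 c2 v" using agreeD[OF b2(3)] by blast
      then have "same g (merge g b2 e) (merge g c2 e) v"
        using de[OF b2(2) sub(2)] de[OF c2 sub(2)] by (intro same_merge) auto
      then show ?thesis using s1 that same_trans by blast
    qed
    have t2: "same g (merge g b1 e) e2 v" if "v \<in> region g C" for v
    proof -
      have "v < length g" "v \<notin> region g B" using that fin(2) BC(4) by auto
      then have "same g b1 c1 v" using agreeD[OF b1(3)] by blast
      then have "same g (merge g b1 e) (merge g c1 e) v"
        using de[OF b1(2) sub(1)] de[OF c1 sub(1)] by (intro same_merge) auto
      then show ?thesis using s2 that same_trans by blast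
    qed
    have "joinable g A e (b1, e1) (b2, e2)"
      unfolding joinable_def
    proof (intro ballI)
      fix v assume "v \<in> set [0..<length g]"
      then have v: "v < length g" by simp
      have "member A v \<longleftrightarrow> v \<in> region g A" using v by (simp add: region_def)
      then show "member A v = (colour (fst (b1, e1)) v \<noteq> 0 \<or> colour (fst (b2, e2)) v \<noteq> 0) \<and>
        (colour (fst (b1, e1)) v = 0 \<or> colour (fst (b2, e2)) v = 0) \<and>
        (colour (fst (b1, e1)) v \<noteq> 0 \<longrightarrow> same g (merge g (fst (b2, e2)) e) (snd (b1, e1)) v) \<and>
        (colour (fst (b2, e2)) v \<noteq> 0 \<longrightarrow> same g (merge g (fst (b1, e1)) e) (snd (b2, e2)) v)"
        using colouring_colour[OF b1(2) v] colouring_colour[OF b2(2) v] t1[of v] t2[of v] BC(3) BC(4)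
        by auto
    qed
    then have "merge g b1 b2 \<in> set (join_cands g S A e)"
      unfolding join_cands_def using b1(1) b2(1) by force
    moreover have "agree g (compl g A) (merge g b1 b2) c"
    proof (rule agreeI)
      fix v assume v: "v < length g" "v \<notin> region g A"
      then have "same g b1 c1 v" "same g b2 c2 v"
        using agreeD[OF b1(3)] agreeD[OF b2(3)] BC(3) by auto
      then show "same g (merge g b1 b2) c v"
        unfolding m[symmetric] using db dj by (intro same_merge)
    qed
    moreover have "cost g (merge g b1 b2) \<le> cost g c"
      unfolding m[symmetric] cost_merge[OF db] cost_merge[OF dj] using b1(4) b2(4) by simp
    ultimately show ?thesis by (auto simp: cands_def)
  qed
  then obtain c0 where c0: "c0 \<in> cands g S A e" "agree g (compl g A) c0 c" "cost g c0 \<le> cost g c" by blast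
  have "reps g limit A \<noteq> []" using nov A(1) by (auto simp: overflow_def)
  from reps_complete[OF this c] obtain r where r: "r \<in> set (reps g limit A)" "agree g (compl g A) c r" by blast
  let ?cs = "filter (\<lambda>c. agree g (compl g A) c r) (leaf_cands g A e @ join_cands g S A e)"
  have "c0 \<in> set ?cs" using c0 agree_trans[OF c0(2) r(2)] by (auto simp: cands_def)
  from cheapest_optimal[OF this, of g] obtain c' where c': "c' \<in> set (cheapest g ?cs)" "cost g c' \<le> cost g c0" by blast
  then have "(c', e) \<in> set (sweep g limit F S)" unfolding in_sweep using A(1) r(1) e by blast
  moreover have "c' \<in> set ?cs" using c'(1) set_cheapest by blast
  then have "c' \<in> cands g S A e" "agree g (compl g A) c' r" by (auto simp: cands_def)
  moreover from this have "agree g (compl g A) c' c" using agree_trans agree_sym[OF r(2)] by blast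
  moreover have "colouring g (region g A) c'" using cands_sound[OF snd e] calculation(2) by blast
  ultimately show "\<exists>c'. (c', e) \<in> set (sweep g limit F S) \<and> colouring g (region g A) c' \<and>
      agree g (compl g A) c' c \<and> cost g c' \<le> cost g c"
    using c'(2) c0(3) by (meson le_trans)
qed

lemma solve_correct:
  assumes F: "decomposes g F" and nov: "\<not> overflow g limit F"
  shows "table_sound g (solve g limit F)" "table_complete g limit F (length g) (solve g limit F)"
proof -
  have "table_sound g (fold (\<lambda>_. sweep g limit F) xs []) \<and>
    table_complete g limit F (length xs) (fold (\<lambda>_. sweep g limit F) xs [])" for xs :: "nat list"
  proof (induction xs rule: rev_induct)
    case Nil
    have "finite (region g A)" for A by (simp add: region_def)
    then show ?case using F by (auto simp: table_sound_def table_complete_def decomposes_def)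
  next
    case (snoc x xs)
    then show ?case using table_sound_sweep table_complete_sweep[OF F nov] by simp
  qed
  from this[of "[0..<length g]"] show "table_sound g (solve g limit F)"
    "table_complete g limit F (length g) (solve g limit F)" by (simp_all add: solve_def)
qed

definition solution :: "graph \<Rightarrow> colours \<Rightarrow> bool" where
  "solution g c \<longleftrightarrow> colouring g {..<length g} c \<and> (\<forall>v<length g. fits g c v)"

text \<open>
  For the whole vertex set the complement is empty, whose only representative is the blank colouring;
  so no assumption about other vertices remains.
\<close>

theorem best_correct:
  assumes F: "decomposes g F" and V: "A \<in> set F" "region g A = {..<length g}"
    and nov: "\<not> overflow g limit F" and cs: "cs = best g limit F"
  shows "(cs = [] \<and> (\<nexists>c. solution g c)) \<or>
    (\<exists>c. cs = [c] \<and> solution g c \<and> (\<forall>c'. solution g c' \<longrightarrow> cost g c \<le> cost g c'))"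
proof -
  note cs = cs[unfolded best_def]
  note solve = solve_correct[OF F nov]
  have "region g (compl g A) = {}" using V(2) by (simp add: region_compl)
  then have blank: "reps g limit (compl g A) = [blank g]" by (rule reps_empty)
  have fits_blank: "fits g (merge g c e) v \<longleftrightarrow> fits g c v" if "colouring g {..<length g} c" for c e v
  proof -
    have "merge g c e = c"
      by (rule colouring_eqI) (use that in \<open>auto simp: colour_merge colouring_def bounded_def\<close>)
    then show ?thesis by simp
  qed
  have sound: "solution g c" if "c \<in> set cs" for c
  proof -
    have "c \<in> set (filter (full g) (map fst (solve g limit F)))" using that cs set_cheapest by blast
    then obtain e where e: "(c, e) \<in> set (solve g limit F)" "full g c" by auto
    then obtain X where X: "X \<subseteq> {..<length g}" "colouring g X c" "admissible g X c e"
      using solve(1) by (auto simp: table_sound_def)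
    have "{..<length g} \<subseteq> X" using e(2) colouring_colour[OF X(2)] by (auto simp: full_def)
    then have "X = {..<length g}" using X(1) by auto
    then show ?thesis using X(2,3) fits_blank by (auto simp: solution_def admissible_def)
  qed
  have complete: "\<exists>c\<in>set cs. cost g c \<le> cost g c'" if "solution g c'" for c'
  proof -
    have c': "colouring g (region g A) c'" "admissible g (region g A) c' (blank g)"
      using that fits_blank unfolding V(2) solution_def admissible_def by auto
    have "card (region g A) \<le> length g" using V(2) by simp
    then obtain c where c: "(c, blank g) \<in> set (solve g limit F)" "colouring g (region g A) c" "cost g c \<le> cost g c'"
      using solve(2) V(1) blank c' unfolding table_complete_def by (metis list.set_intros(1))
    have "full g c" using c(2) V(2) by (auto simp: full_def colouring_def)
    then have "c \<in> set (filter (full g) (map fst (solve g limit F)))" using c(1) by force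
    from cheapest_optimal[OF this, of g] show ?thesis using c(3) cs le_trans by blast
  qed
  consider "cs = []" | c where "cs = [c]" using cs cheapest_cases by blast
  then show ?thesis using sound complete by cases auto
qed

end

section \<open>Encoded inputs and their cuts\<close>

definition matrix :: "nat pair_pre_digraph \<Rightarrow> graph" where
  "matrix G = map (\<lambda>u. map (\<lambda>v. (u, v) \<in> parcs G) [0..<card (pverts G)]) [0..<card (pverts G)]"

lemma enc_list_map: "enc_list f (map h xs) = enc_list (\<lambda>x. f (h x)) xs"
  by (induction xs) simp_all

lemma enc_matrix: "enc (matrix G) = enc_graph G"
  by (simp add: matrix_def enc_graph_def enc_list_inst enc_bool_inst enc_list_map)

lemma enc_input_eq: "enc_input G T L = enc (matrix G, matrix T, map L [0..<card (pverts G)])"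
  by (simp add: enc_input_def enc_matrix) (simp add: enc_list_inst enc_nat_inst enc_list_map)

lemma length_matrix [simp]: "length (matrix G) = card (pverts G)"
  by (simp add: matrix_def)

lemma adj_matrix:
  assumes "pair_wf_digraph G" "numbered G"
  shows "adj (matrix G) u v \<longleftrightarrow> (u, v) \<in> parcs G"
proof -
  have "u < card (pverts G) \<and> v < card (pverts G)" if "(u, v) \<in> parcs G"
    using pair_wf_digraph.in_arcsD1[OF assms(1) that] pair_wf_digraph.in_arcsD2[OF assms(1) that] assms(2)
    unfolding numbered_def by blast
  then show ?thesis by (auto simp: adj_def matrix_def nth_or_def)
qed

text \<open>
  After \<open>k\<close> steps of growth the vertices at distance at most \<open>k\<close> are found.
\<close>

lemma member_component:
  assumes t: "\<And>u v. adj t u v \<longleftrightarrow> (u, v) \<in> E" and E: "E \<subseteq> {..<length t} \<times> {..<length t}"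
    and x: "x < length t"
  shows "member (component t x y) z \<longleftrightarrow> z \<in> side E x y"
proof -
  let ?m = "length t"
  define R where "R = E - {(x, y), (y, x)}"
  have RE: "R \<subseteq> {..<?m} \<times> {..<?m}" using E by (auto simp: R_def)
  have grow: "member (grow t x y C) z \<longleftrightarrow> z < ?m \<and> (member C z \<or> (\<exists>u. member C u \<and> (u, z) \<in> R))" for C z
  proof -
    have "(\<exists>u\<in>set [0..<?m]. member C u \<and> adj t u z \<and> \<not> (u = x \<and> z = y) \<and> \<not> (u = y \<and> z = x)) \<longleftrightarrow>
        (\<exists>u. member C u \<and> (u, z) \<in> R)"
    proof
      assume "\<exists>u. member C u \<and> (u, z) \<in> R"
      then obtain u where u: "member C u" "(u, z) \<in> R" by blast
      moreover from this have "u \<in> set [0..<?m]" using RE by auto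
      ultimately show "\<exists>u\<in>set [0..<?m]. member C u \<and> adj t u z \<and> \<not> (u = x \<and> z = y) \<and> \<not> (u = y \<and> z = x)"
        unfolding t R_def by blast
    qed (auto simp: t R_def)
    then show ?thesis by (simp add: grow_def nth_or_def)
  qed
  have iter: "member (fold (\<lambda>_. grow t x y) xs (map (\<lambda>z. z = x) [0..<?m])) z \<longleftrightarrow>
      (\<exists>k\<le>length xs. (x, z) \<in> R ^^ k)" for xs :: "nat list" and z
  proof (induction xs arbitrary: z rule: rev_induct)
    case Nil
    then show ?case using x by (auto simp: nth_or_def)
  next
    case (snoc a xs)
    have "(\<exists>k\<le>Suc (length xs). (x, z) \<in> R ^^ k) \<longleftrightarrow>
        (\<exists>k\<le>length xs. (x, z) \<in> R ^^ k) \<or> (\<exists>u. (\<exists>k\<le>length xs. (x, u) \<in> R ^^ k) \<and> (u, z) \<in> R)"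
    proof (intro iffI)
      assume "\<exists>k\<le>Suc (length xs). (x, z) \<in> R ^^ k"
      then obtain k where k: "k \<le> Suc (length xs)" "(x, z) \<in> R ^^ k" by blast
      then show "(\<exists>k\<le>length xs. (x, z) \<in> R ^^ k) \<or> (\<exists>u. (\<exists>k\<le>length xs. (x, u) \<in> R ^^ k) \<and> (u, z) \<in> R)"
        by (cases k) auto
    next
      assume "(\<exists>k\<le>length xs. (x, z) \<in> R ^^ k) \<or> (\<exists>u. (\<exists>k\<le>length xs. (x, u) \<in> R ^^ k) \<and> (u, z) \<in> R)"
      then show "\<exists>k\<le>Suc (length xs). (x, z) \<in> R ^^ k"
        by (meson Suc_le_mono le_SucI relpow_Suc_I)
    qed
    moreover have "z < ?m" if "(x, z) \<in> R ^^ k" for k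
      using that RE x by (cases k) auto
    ultimately show ?case using snoc by (auto simp: grow)
  qed
  have "finite R" "card R \<le> ?m * ?m"
    using RE finite_subset card_mono[of "{..<?m} \<times> {..<?m}" R] by auto
  then have "R\<^sup>* = (\<Union>k\<in>{k. k \<le> card R}. R ^^ k)" by (simp add: rtrancl_finite_eq_relpow)
  then have "(x, z) \<in> R\<^sup>* \<longleftrightarrow> (\<exists>k\<le>?m * ?m. (x, z) \<in> R ^^ k)"
    using \<open>card R \<le> ?m * ?m\<close> by (auto simp: relpow_imp_rtrancl) (meson le_trans)
  moreover have "length (concat (map (\<lambda>_. [0..<?m]) [0..<?m])) = ?m * ?m"
    by (simp add: length_concat comp_def sum_list_triv)
  ultimately show ?thesis
    unfolding component_def iter side_def R_def by simp
qed

text \<open>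
  The admissible inputs of the problem statement.
\<close>

locale decomposed_digraph =
  fixes G T :: "nat pair_pre_digraph" and L :: "nat \<Rightarrow> nat"
  assumes G: "pair_fin_digraph G" and numbered: "numbered G" "numbered T"
    and bd: "branch_decomposition G T L"
begin

abbreviation "n \<equiv> card (pverts G)"
abbreviation "cut_list \<equiv> cuts (matrix G) (matrix T) (map L [0..<n])"

lemma lessThan_n: "{..<n} = pverts G"
  using numbered by (simp add: numbered_def)

lemma mem_pverts: "v \<in> pverts G \<longleftrightarrow> v < n"
  unfolding lessThan_iff[symmetric] lessThan_n ..

lemma adj_G: "adj (matrix G) u v \<longleftrightarrow> (u, v) \<in> parcs G"
  using G numbered by (intro adj_matrix) (auto simp: pair_fin_digraph_def)

lemma subcubic: "subcubic_tree T"
  using bd by (simp add: branch_decomposition_def)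

lemma adj_T: "adj (matrix T) u v \<longleftrightarrow> (u, v) \<in> parcs T"
proof (rule adj_matrix[OF _ numbered(2)])
  show "pair_wf_digraph T"
    using subcubic_tree_arcs(4)[OF subcubic] by unfold_locales auto
qed

lemma region_cut:
  assumes "(x, y) \<in> parcs T"
  shows "region (matrix G) (cut (matrix G) (matrix T) (map L [0..<n]) x y) = cut_side G T L (x, y)"
proof -
  have E: "parcs T \<subseteq> {..<length (matrix T)} \<times> {..<length (matrix T)}"
    using subcubic_tree_arcs(4)[OF subcubic] numbered(2) by (simp add: numbered_def)
  then have "x < length (matrix T)" using assms by auto
  note mem = member_component[OF adj_T E this]
  show ?thesis
    unfolding cut_side_eq[OF bd assms]
    by (auto simp: region_def cut_def mem mem_pverts)
qed

lemma set_cut_list: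
  "set cut_list = insert (map (\<lambda>_. True) [0..<n])
     ((\<lambda>(x, y). cut (matrix G) (matrix T) (map L [0..<n]) x y) ` parcs T)"
proof -
  have "parcs T \<subseteq> {..<card (pverts T)} \<times> {..<card (pverts T)}"
    using subcubic_tree_arcs(4)[OF subcubic] numbered(2) by (simp add: numbered_def)
  then have arcs: "parcs T = {(x, y). x < card (pverts T) \<and> y < card (pverts T) \<and> adj (matrix T) x y}"
    unfolding adj_T by auto
  have "set (concat (map (\<lambda>x. map (\<lambda>y. h x y) (filter (\<lambda>y. P x y) [0..<m])) [0..<m])) =
      (\<lambda>(x, y). h x y) ` {(x, y). x < m \<and> y < m \<and> P x y}" for h :: "nat \<Rightarrow> nat \<Rightarrow> bool list" and P m
    by force
  then show ?thesis unfolding cuts_def arcs by (simp only: list.set length_matrix)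
qed

lemma region_all: "region (matrix G) (map (\<lambda>_. True) [0..<n]) = pverts G"
  by (auto simp: region_def mem_pverts)

lemma regions: "region (matrix G) ` set cut_list = insert (pverts G) (cut_side G T L ` parcs T)"
  unfolding set_cut_list image_insert region_all image_image
  by (intro arg_cong2[of _ _ _ _ insert] refl image_cong) (auto simp: region_cut)

lemma decomposes_cut_list: "decomposes (matrix G) cut_list"
proof -
  let ?P = "\<lambda>X. \<exists>Y \<in> region (matrix G) ` set cut_list. \<exists>Z \<in> region (matrix G) ` set cut_list.
    X = Y \<union> Z \<and> Y \<inter> Z = {}"
  have split: "X \<noteq> {} \<and> ((\<exists>v. X = {v}) \<or> ?P X)" if "X \<in> region (matrix G) ` set cut_list" for X
  proof -
    consider "X = pverts G" | x y where "(x, y) \<in> parcs T" "X = cut_side G T L (x, y)"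
      using \<open>X \<in> _\<close> unfolding regions by auto
    then show ?thesis
    proof cases
      case 1
      obtain x y where xy: "(x, y) \<in> parcs T" using subcubic_tree_arc_exists[OF subcubic] .
      have "pverts G \<noteq> {}" using branch_decomposition_card(2)[OF bd] by auto
      then show ?thesis using cut_side_opposite[OF bd xy] xy unfolding 1 regions by blast
    next
      case 2
      from bd 2(1) show ?thesis
      proof (cases rule: cut_side_cases)
        case (singleton v)
        then show ?thesis using 2(2) by simp
      next
        case (union e e')
        then show ?thesis using cut_side_nonempty[OF bd 2(1)] unfolding 2(2) regions by blast
      qed
    qed
  qed
  show ?thesis
    unfolding decomposes_def
  proof
    fix A assume "A \<in> set cut_list"
    from split[OF imageI[OF this]] show "region (matrix G) A \<noteq> {} \<and> ((\<exists>v. region (matrix G) A = {v}) \<or>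
        (\<exists>B\<in>set cut_list. \<exists>C\<in>set cut_list. region (matrix G) A = region (matrix G) B \<union> region (matrix G) C \<and>
          region (matrix G) B \<inter> region (matrix G) C = {}))"
      unfolding bex_simps .
  qed
qed

lemma induced_matching_number_empty:
  assumes "parcs H = {}" shows "induced_matching_number H = 0"
proof -
  have "{card M |M. induced_matching H M} = {0}"
    using assms by (auto simp: induced_matching_def)
  then show ?thesis by (simp add: induced_matching_number_def)
qed

text \<open>
  No arc crosses the cut of the whole vertex set, which is the member of the family that does not come
  from an edge of the tree.
\<close>

lemma bimim_region:
  assumes "A \<in> set cut_list"
  shows "bimim G (region (matrix G) A) \<le> bimim_width G T L"
proof -
  consider "region (matrix G) A = pverts G" | e where "e \<in> parcs T" "region (matrix G) A = cut_side G T L e"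
    using imageI[OF assms, of "region (matrix G)"] unfolding regions by auto
  then show ?thesis
  proof cases
    case 1
    then show ?thesis by (simp add: bimim_def induced_matching_number_empty bip_digraph_def)
  next
    case 2
    then show ?thesis using bimim_cut_side_le[OF bd] by simp
  qed
qed

lemma bimim_opposite: "A \<subseteq> pverts G \<Longrightarrow> bimim G (pverts G - A) = bimim G A"
  by (simp add: bimim_def double_diff add.commute)

lemma outdeg_matrix: "outdeg (matrix G) c v j = out_count G (colour c) v j"
  and indeg_matrix: "indeg (matrix G) c v j = in_count G (colour c) v j"
proof -
  have arcs: "(u, w) \<in> parcs G \<Longrightarrow> u < n \<and> w < n" for u w
    using pair_wf_digraph.in_arcsD1[of G u w] pair_wf_digraph.in_arcsD2[of G u w] G mem_pverts
    by (auto simp: pair_fin_digraph_def)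
  have len: "length (filter P [0..<n]) = card {u. u < n \<and> P u}" for P
    using distinct_card[of "filter P [0..<n]"] by (simp add: conj_commute)
  show "outdeg (matrix G) c v j = out_count G (colour c) v j"
    unfolding out_count_def outdeg_def length_matrix len adj_G by (rule arg_cong[of _ _ card]) (auto dest: arcs)
  show "indeg (matrix G) c v j = in_count G (colour c) v j"
    unfolding in_count_def indeg_def length_matrix len adj_G by (rule arg_cong[of _ _ card]) (auto dest: arcs)
qed

end

section \<open>Time in terms of the bi-mim-width\<close>

context lcvp begin

lemma reps_cut_nonempty:
  assumes dec: "decomposed_digraph G T L" and A: "region (matrix G) A = X" "X \<subseteq> pverts G"
    and w: "bimim G X \<le> w" and limit: "((card (pverts G) + 1) ^ (d * w)) ^ (2 * q) \<le> limit"
  shows "reps (matrix G) limit A \<noteq> []"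
proof (rule reps_nonempty)
  interpret decomposed_digraph G T L by fact
  fix S assume S: "finite S" "\<And>c. c \<in> S \<Longrightarrow> \<exists>Y\<subseteq>region (matrix G) A. colouring (matrix G) Y c"
    and ind: "independent (matrix G) (compl (matrix G) A) S"
  have "card S \<le> ((n + 1) ^ (d * w)) ^ (2 * q)"
  proof (rule card_inequivalent_colourings[OF G A(2) w S(1), where col = colour])
    fix c u assume "c \<in> S" "colour c u \<noteq> 0"
    then obtain Y where "Y \<subseteq> X" "colouring (matrix G) Y c" using S(2) A(1) by blast
    moreover from this have "u < n"
      using \<open>colour c u \<noteq> 0\<close> colouring_length[of "matrix G" Y c] by (simp add: nth_or_def split: if_splits)
    ultimately show "u \<in> X" using \<open>colour c u \<noteq> 0\<close> by (auto simp: colouring_def)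
  next
    fix c c' assume "c \<in> S" "c' \<in> S" "c \<noteq> c'"
    then have "\<not> agree (matrix G) (compl (matrix G) A) c c'" using ind by (simp add: independent_def)
    then obtain b where b: "b < n" "b \<notin> X" "\<not> same (matrix G) c c' b"
      using agreeI[of "matrix G" A c c'] A(1) by auto
    then have "b \<in> pverts G - X" by (simp add: mem_pverts)
    then show "\<exists>b\<in>pverts G - X. \<exists>j\<in>{1..q}.
        min d (in_count G (colour c) b j) \<noteq> min d (in_count G (colour c') b j) \<or>
        min d (out_count G (colour c) b j) \<noteq> min d (out_count G (colour c') b j)"
      using b(3) unfolding same_def outdeg_matrix indeg_matrix by blast
  qed
  then show "card S \<le> limit" using limit by (rule le_trans)
qed

text \<open>
  The representatives of the complement of a region are bounded like those of the region, because
  \<open>bimim\<close> agrees on the two sides of a cut.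
\<close>

lemma no_overflow:
  assumes "decomposed_digraph G T L"
    and "((card (pverts G) + 1) ^ (d * bimim_width G T L)) ^ (2 * q) \<le> limit"
  shows "\<not> overflow (matrix G) limit (cuts (matrix G) (matrix T) (map L [0..<card (pverts G)]))"
proof -
  interpret decomposed_digraph G T L by fact
  have "reps (matrix G) limit A \<noteq> [] \<and> reps (matrix G) limit (compl (matrix G) A) \<noteq> []" if A: "A \<in> set cut_list" for A
  proof
    have sub: "region (matrix G) A \<subseteq> pverts G" by (auto simp: region_def mem_pverts)
    show "reps (matrix G) limit A \<noteq> []"
      by (rule reps_cut_nonempty[OF assms(1) refl sub bimim_region[OF A] assms(2)])
    show "reps (matrix G) limit (compl (matrix G) A) \<noteq> []"
    proof (rule reps_cut_nonempty[OF assms(1) _ _ _ assms(2)])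
      show "region (matrix G) (compl (matrix G) A) = pverts G - region (matrix G) A"
        by (simp add: region_compl lessThan_n)
      show "bimim G (pverts G - region (matrix G) A) \<le> bimim_width G T L"
        using bimim_region[OF A] bimim_opposite[OF sub] by simp
    qed simp
  qed
  then show ?thesis unfolding overflow_def by blast
qed

definition right_answer :: "nat pair_pre_digraph \<Rightarrow> colours list \<Rightarrow> bool" where
  "right_answer G cs \<longleftrightarrow> (cs = [] \<and> (\<nexists>c. solution (matrix G) c)) \<or>
    (\<exists>c. cs = [c] \<and> solution (matrix G) c \<and> (\<forall>c'. solution (matrix G) c' \<longrightarrow> cost (matrix G) c \<le> cost (matrix G) c'))"

lemma best_right:
  assumes "decomposed_digraph G T L"
    and "\<not> overflow (matrix G) limit (cuts (matrix G) (matrix T) (map L [0..<card (pverts G)]))"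
  shows "right_answer G (best (matrix G) limit (cuts (matrix G) (matrix T) (map L [0..<card (pverts G)])))"
proof -
  interpret decomposed_digraph G T L by fact
  show ?thesis
    unfolding right_answer_def
    by (rule best_correct[OF decomposes_cut_list _ _ assms(2) refl, of "map (\<lambda>_. True) [0..<n]"])
      (use region_all set_cut_list lessThan_n in auto)
qed

end

text \<open>
  The constants of the polynomial bound are absorbed into the exponent by \<open>2 \<le> n\<close>; the summand \<open>2\<close>
  matches the form of the time bound for searches.
\<close>

lemma sz_input_le:
  assumes "decomposed_digraph G T L"
  shows "sz (matrix G, matrix T, map L [0..<card (pverts G)]) + 2 \<le> card (pverts G) ^ 7"
proof -
  interpret decomposed_digraph G T L by fact
  have mat: "sz (matrix H) \<le> 1 + k * (2 + 4 * k)" if "card (pverts H) \<le> k" for H k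
  proof -
    have "sz (map (\<lambda>v. (u, v) \<in> parcs H) [0..<card (pverts H)]) \<le> 1 + 4 * k" for u
    proof -
      have "sz (map (\<lambda>v. (u, v) \<in> parcs H) [0..<card (pverts H)]) \<le> 1 + length [0..<card (pverts H)] * (3 + 1)"
        by (rule sz_map_le) (rule sz_bool_le)
      then show ?thesis using that by simp
    qed
    then have "sz (matrix H) \<le> 1 + length [0..<card (pverts H)] * ((1 + 4 * k) + 1)"
      unfolding matrix_def by (intro sz_map_le)
    also have "\<dots> \<le> 1 + k * (2 + 4 * k)"
      using mult_le_mono1[OF that, of "2 + 4 * k"] by simp
    finally show ?thesis .
  qed
  have m: "card (pverts T) \<le> 2 * n" and n2: "2 \<le> n" using branch_decomposition_card[OF bd] by auto
  have "L v < 2 * n" if "v < n" for v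
  proof -
    have "L v \<in> pverts T" using bd that mem_pverts by (auto simp: branch_decomposition_def bij_betw_def tree_leaves_def)
    then have "L v < card (pverts T)" using numbered(2) unfolding numbered_def by (metis lessThan_iff)
    then show ?thesis using m by linarith
  qed
  then have "sz (map L [0..<n]) \<le> 1 + length [0..<n] * ((4 * n + 1) + 1)"
    by (intro sz_map_le) fastforce
  then have "sz (map L [0..<n]) \<le> 1 + n * (4 * n + 2)" by simp
  moreover have "sz (matrix G) \<le> 1 + n * (2 + 4 * n)" by (rule mat) simp
  moreover have "sz (matrix T) \<le> 1 + (2 * n) * (2 + 4 * (2 * n))" by (rule mat[OF m])
  ultimately have "sz (matrix G, matrix T, map L [0..<n]) + 2 \<le>
      7 + n * (2 + 4 * n) + (2 * n) * (2 + 4 * (2 * n)) + n * (4 * n + 2)"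
    by (simp only: sz_simps)
  also have "\<dots> = 7 + 8 * n + 24 * (n * n)" by (simp add: algebra_simps)
  also have "\<dots> \<le> 32 * (n * n)"
    using mult_le_mono[OF n2 n2] mult_le_mono1[OF n2, of n] by linarith
  also have "\<dots> \<le> n ^ 5 * (n * n)"
    using power_mono[OF n2, of 5] by (intro mult_right_mono) simp_all
  also have "\<dots> = n ^ 7" by (simp add: eval_nat_numeral)
  finally show ?thesis .
qed

context lcvp begin

text \<open>
  The limit \<open>N = (n + 1) ^ (2 q d w)\<close> suffices by the bound on the number of classes, although the
  program does not know \<open>w\<close>. Since \<open>n + 1 \<le> n\<^sup>2\<close>, everything is bounded by a power of \<open>n\<close> whose exponent
  is linear in \<open>w\<close>.
\<close>

theorem right_answer_in_time:
  fixes post :: "graph \<Rightarrow> colours list \<Rightarrow> 'r::enc"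
  assumes post: "ptime (\<lambda>p. post (fst p) (snd p))"
  shows "\<exists>f p. \<forall>G T L. decomposed_digraph G T L \<longrightarrow>
    (\<exists>cs t. computes p (enc_input G T L) (enc (post (matrix G) cs)) t \<and> right_answer G cs \<and>
      t \<le> card (pverts G) ^ f (bimim_width G T L))"
proof -
  define run :: "graph \<times> graph \<times> nat list \<Rightarrow> nat \<Rightarrow> 'r option"
    where "run x limit = (if overflow (fst x) limit (cuts (fst x) (fst (snd x)) (snd (snd x))) then None
      else Some (post (fst x) (best (fst x) limit (cuts (fst x) (fst (snd x)) (snd (snd x))))))" for x limit
  have "ptime (\<lambda>p. run (fst p) (snd p))"
    unfolding run_def by (intro ptime_intros ptime_comp2[OF post])
  from retry_program[OF this] obtain p e where pe: "\<And>x N. run x N \<noteq> None \<Longrightarrow>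
    \<exists>M r t. run x M = Some r \<and> computes p (enc x) (enc r) t \<and> t \<le> (sz x + N + 2) ^ e"
    by blast
  define f where "f w = (8 + 4 * q * d * w) * e" for w
  have "\<exists>cs t. computes p (enc_input G T L) (enc (post (matrix G) cs)) t \<and> right_answer G cs \<and>
      t \<le> card (pverts G) ^ f (bimim_width G T L)" if dec: "decomposed_digraph G T L" for G T L
  proof -
    interpret decomposed_digraph G T L by fact
    let ?w = "bimim_width G T L"
    let ?x = "(matrix G, matrix T, map L [0..<n])"
    define N where "N = ((n + 1) ^ (d * ?w)) ^ (2 * q)"
    have n2: "2 \<le> n" using branch_decomposition_card[OF bd] by simp
    have "run ?x N \<noteq> None" using no_overflow[OF dec, of N] by (simp add: run_def N_def)
    from pe[OF this] obtain M r t where r: "run ?x M = Some r" "computes p (enc ?x) (enc r) t"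
      "t \<le> (sz ?x + N + 2) ^ e" by blast
    have nov: "\<not> overflow (matrix G) M cut_list" and r_eq: "r = post (matrix G) (best (matrix G) M cut_list)"
      using r(1) by (auto simp: run_def split: if_splits)
    have "n + 1 \<le> n ^ 2" using mult_le_mono1[OF n2, of n] n2 unfolding power2_eq_square by linarith
    then have "N \<le> ((n ^ 2) ^ (d * ?w)) ^ (2 * q)" unfolding N_def by (intro power_mono) simp_all
    also have "\<dots> = n ^ (4 * q * d * ?w)"
      unfolding power_mult[symmetric] by (rule arg_cong[of _ _ "power n"]) simp
    also have "\<dots> \<le> n ^ (7 + 4 * q * d * ?w)" using n2 by (intro power_increasing) simp_all
    finally have "sz ?x + N + 2 \<le> n ^ 7 + n ^ (7 + 4 * q * d * ?w)" using sz_input_le[OF dec] by linarith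
    also have "n ^ 7 \<le> n ^ (7 + 4 * q * d * ?w)" using n2 by (intro power_increasing) simp_all
    also have "n ^ (7 + 4 * q * d * ?w) + n ^ (7 + 4 * q * d * ?w) \<le> n * n ^ (7 + 4 * q * d * ?w)"
      using mult_le_mono1[OF n2, of "n ^ (7 + 4 * q * d * ?w)"] by (simp only: mult_2)
    also have "\<dots> = n ^ (8 + 4 * q * d * ?w)" by (simp only: power_Suc[symmetric]) simp
    finally have "sz ?x + N + 2 \<le> n ^ (8 + 4 * q * d * ?w)" by simp
    then have "(sz ?x + N + 2) ^ e \<le> (n ^ (8 + 4 * q * d * ?w)) ^ e" by (rule power_mono) (rule le0)
    then have "t \<le> n ^ f ?w" using r(3) by (simp add: f_def power_mult)
    then show ?thesis using r(2) best_right[OF dec nov] unfolding r_eq enc_input_eq by blast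
  qed
  then show ?thesis by blast
qed

end

section \<open>Capping of finite and co-finite sets\<close>

lemma fin_or_cofin_threshold:
  assumes "fin_or_cofin A"
  shows "\<exists>d. \<forall>d'\<ge>d. \<forall>k. k \<in> A \<longleftrightarrow> min d' k \<in> A"
proof -
  from assms obtain B where B: "finite B" "B = A \<or> B = - A" by (auto simp: fin_or_cofin_def)
  then obtain d where d: "\<forall>k\<in>B. k < d" using finite_nat_set_iff_bounded by auto
  have "k \<in> B \<longleftrightarrow> min d' k \<in> B" if "d \<le> d'" for d' k
    using d that by (cases "k \<le> d'") (auto simp: min_def)
  then show ?thesis using B(2) by auto
qed

lemma common_threshold:
  assumes "finite \<A>" "\<forall>A\<in>\<A>. fin_or_cofin A"
  shows "\<exists>d. \<forall>A\<in>\<A>. \<forall>k. k \<in> A \<longleftrightarrow> min d k \<in> A"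
proof -
  from assms obtain t where t: "\<And>A d k. A \<in> \<A> \<Longrightarrow> t A \<le> d \<Longrightarrow> k \<in> A \<longleftrightarrow> min d k \<in> A"
    using fin_or_cofin_threshold by metis
  have "t A \<le> sum t \<A>" if "A \<in> \<A>" for A using member_le_sum[of A \<A> t] that assms(1) by simp
  then show ?thesis using t by blast
qed

lemma lcvp_exists:
  assumes "1 \<le> q" "K \<noteq> 0"
    and "\<forall>i\<in>{1..q}. \<forall>j\<in>{1..q}. fin_or_cofin (fst (D i j)) \<and> fin_or_cofin (snd (D i j))"
  shows "\<exists>d. lcvp q D d K"
proof -
  let ?I = "{1..q} \<times> {1..q}"
  let ?A = "(\<lambda>(i, j). fst (D i j)) ` ?I \<union> (\<lambda>(i, j). snd (D i j)) ` ?I"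
  obtain d where d: "\<forall>A\<in>?A. \<forall>k. k \<in> A \<longleftrightarrow> min d k \<in> A"
  proof -
    have "finite ?A" "\<forall>A\<in>?A. fin_or_cofin A" using assms(3) by auto
    from common_threshold[OF this] show ?thesis using that by blast
  qed
  have "lcvp q D d K"
  proof
    fix i j k assume ij: "i \<in> {1..q}" "j \<in> {1..q}"
    then have "fst (D i j) \<in> ?A" "snd (D i j) \<in> ?A" by force+
    then show "(k \<in> fst (D i j) \<longleftrightarrow> min d k \<in> fst (D i j)) \<and> (k \<in> snd (D i j) \<longleftrightarrow> min d k \<in> snd (D i j))"
      using bspec[OF d, of "fst (D i j)"] bspec[OF d, of "snd (D i j)"] by simp
  qed (use assms in auto)
  then show ?thesis ..
qed

section \<open>The two families of problems as colouring problems\<close>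

definition colour_class :: "nat pair_pre_digraph \<Rightarrow> nat list \<Rightarrow> nat \<Rightarrow> nat set" where
  "colour_class G c j = {v \<in> pverts G. colour c v = j}"

lemma (in lcvp) solution_iff:
  assumes dec: "decomposed_digraph G T L"
  shows "solution (matrix G) c \<longleftrightarrow> length c = card (pverts G) \<and> (\<forall>v\<in>pverts G. colour c v \<in> {1..q}) \<and>
    lcvp_partition q D G (colour_class G c)"
proof -
  interpret decomposed_digraph G T L by fact
  have arcs: "(u, w) \<in> parcs G \<Longrightarrow> u < n \<and> w < n" for u w
    using pair_wf_digraph.in_arcsD1[of G u w] pair_wf_digraph.in_arcsD2[of G u w] G mem_pverts
    by (auto simp: pair_fin_digraph_def)
  have deg: "card (out_nbrs G v \<inter> colour_class G c j) = outdeg (matrix G) c v j"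
    "card (in_nbrs G v \<inter> colour_class G c j) = indeg (matrix G) c v j" for v j
    unfolding outdeg_matrix indeg_matrix out_count_def in_count_def
    by (intro arg_cong[of _ _ card]; auto simp: out_nbrs_def in_nbrs_def colour_class_def mem_pverts dest: arcs)+
  have col: "colouring (matrix G) {..<n} c \<longleftrightarrow> length c = n \<and> (\<forall>v<n. colour c v \<in> {1..q})"
  proof
    assume "length c = n \<and> (\<forall>v<n. colour c v \<in> {1..q})"
    moreover from this have "colour c v \<le> q" for v by (cases "v < n") (auto simp: nth_or_def)
    ultimately show "colouring (matrix G) {..<n} c" by (auto simp: colouring_def bounded_def Suc_le_eq)
  qed (auto simp: colouring_def bounded_def Suc_le_eq)
  have part: "lcvp_partition q D G (colour_class G c) \<longleftrightarrow> (\<forall>v<n. fits (matrix G) c v)"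
    if "\<forall>v<n. colour c v \<in> {1..q}"
  proof -
    have "(\<Union>i\<in>{1..q}. colour_class G c i) = pverts G" "disjoint_family_on (colour_class G c) {1..q}"
      using that by (auto simp: colour_class_def disjoint_family_on_def mem_pverts)
    then show ?thesis
      unfolding lcvp_partition_def deg fits_def by (auto simp: colour_class_def mem_pverts)
  qed
  show ?thesis
    unfolding solution_def length_matrix col using part by (auto simp: mem_pverts)
qed

text \<open>
  A partition into \<open>X 1, \<dots>, X q\<close> is the same as a colouring; the sets \<open>X j\<close> for other \<open>j\<close> are arbitrary.
\<close>

lemma lcvp_partition_colour_class:
  assumes X: "lcvp_partition q D G X" and V: "\<And>v. v \<in> pverts G \<longleftrightarrow> v < card (pverts G)"
  shows "\<exists>c. length c = card (pverts G) \<and> (\<forall>v\<in>pverts G. colour c v \<in> {1..q}) \<and>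
    (\<forall>j\<in>{1..q}. colour_class G c j = X j)"
proof -
  have cov: "(\<Union>i\<in>{1..q}. X i) = pverts G" and dis: "disjoint_family_on X {1..q}"
    using X by (auto simp: lcvp_partition_def)
  have "\<forall>v\<in>pverts G. \<exists>i. i \<in> {1..q} \<and> v \<in> X i" using cov by blast
  then obtain h where h: "\<And>v. v \<in> pverts G \<Longrightarrow> h v \<in> {1..q} \<and> v \<in> X (h v)" by metis
  have uniq: "v \<in> X j \<Longrightarrow> j \<in> {1..q} \<Longrightarrow> h v = j" if "v \<in> pverts G" for v j
    using dis h[OF that] unfolding disjoint_family_on_def by blast
  let ?c = "map h [0..<card (pverts G)]"
  have c: "colour ?c v = h v" if "v \<in> pverts G" for v
    using that V by simp
  have "colour_class G ?c j = X j" if "j \<in> {1..q}" for j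
  proof -
    have "X j \<subseteq> pverts G" using cov that by blast
    moreover have "v \<in> X j \<longleftrightarrow> colour ?c v = j" if v: "v \<in> pverts G" for v
      using c[OF v] h[OF v] uniq[OF v _ \<open>j \<in> {1..q}\<close>] by metis
    ultimately show ?thesis unfolding colour_class_def by blast
  qed
  then show ?thesis using c h by (intro exI[of _ ?c]) auto
qed

lemma lcvp_partition_cong:
  assumes "\<And>j. j \<in> {1..q} \<Longrightarrow> X j = Y j" "lcvp_partition q D G X"
  shows "lcvp_partition q D G Y"
  using assms unfolding lcvp_partition_def disjoint_family_on_def by simp

lemma solves_in_timeI:
  assumes "\<And>G T L. decomposed_digraph G T L \<Longrightarrow>
    \<exists>r t. computes p (enc_input G T L) (enc_out G r) t \<and> answer G r \<and> t \<le> card (pverts G) ^ f (bimim_width G T L)"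
  shows "solves_in_time p f enc_out answer"
  unfolding solves_in_time_def
  by (intro exI[of _ 1] allI impI) (use assms in \<open>simp add: decomposed_digraph_def\<close>)

theorem lcvp_in_time:
  assumes "1 \<le> q" "\<forall>i\<in>{1..q}. \<forall>j\<in>{1..q}. fin_or_cofin (fst (D i j)) \<and> fin_or_cofin (snd (D i j))"
  shows "\<exists>f p. solves_in_time p f (\<lambda>_. enc_bool) (lcvp_answer q D)"
proof -
  obtain d where "lcvp q D d 1" using lcvp_exists[OF assms(1) _ assms(2), of 1] by auto
  then interpret lcvp q D d 1 .
  have "ptime (\<lambda>p. (\<lambda>(_::graph) (cs::colours list). cs \<noteq> []) (fst p) (snd p))"
    by (intro ptime_intros)
  from right_answer_in_time[OF this] obtain f p where fp: "\<And>G T L. decomposed_digraph G T L \<Longrightarrow>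
    \<exists>cs t. computes p (enc_input G T L) (enc (cs \<noteq> [])) t \<and> right_answer G cs \<and>
      t \<le> card (pverts G) ^ f (bimim_width G T L)" by blast
  have "solves_in_time p f (\<lambda>_. enc_bool) (lcvp_answer q D)"
  proof (rule solves_in_timeI)
    fix G T L assume dec: "decomposed_digraph G T L"
    interpret decomposed_digraph G T L by fact
    obtain cs t where cs: "computes p (enc_input G T L) (enc (cs \<noteq> [])) t" "right_answer G cs"
      "t \<le> n ^ f (bimim_width G T L)" using fp[OF dec] by blast
    have "(\<exists>X. lcvp_partition q D G X) \<longleftrightarrow> (\<exists>c. solution (matrix G) c)"
      using lcvp_partition_colour_class[OF _ mem_pverts] lcvp_partition_cong solution_iff[OF dec] by metis
    also have "\<dots> \<longleftrightarrow> cs \<noteq> []" using cs(2) unfolding right_answer_def by auto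
    finally have "lcvp_answer q D G (cs \<noteq> [])" by (simp add: lcvp_answer_def)
    then show "\<exists>r t. computes p (enc_input G T L) (enc_bool r) t \<and> lcvp_answer q D G r \<and>
        t \<le> n ^ f (bimim_width G T L)"
      using cs(1,3) unfolding enc_bool_inst by blast
  qed
  then show ?thesis by blast
qed

text \<open>
  Colour \<open>1\<close> is the chosen set and colour \<open>2\<close> its complement, towards which nothing is required.
\<close>

definition lcvs_matrix :: "nat set \<Rightarrow> nat set \<Rightarrow> nat set \<Rightarrow> nat set \<Rightarrow> nat \<Rightarrow> nat \<Rightarrow> nat set \<times> nat set" where
  "lcvs_matrix \<sigma>p \<sigma>m \<rho>p \<rho>m i j =
     (if j = 1 then if i = 1 then (\<sigma>p, \<sigma>m) else (\<rho>p, \<rho>m) else (UNIV, UNIV))"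

lemma lcvs_feasible_iff_partition:
  assumes "X 1 \<subseteq> pverts G" "X 2 = pverts G - X 1"
  shows "lcvp_partition 2 (lcvs_matrix \<sigma>p \<sigma>m \<rho>p \<rho>m) G X \<longleftrightarrow> lcvs_feasible \<sigma>p \<sigma>m \<rho>p \<rho>m G (X 1)"
proof -
  have I: "{1..2} = {1, 2::nat}" by auto
  have "(\<Union>i\<in>{1..2}. X i) = pverts G" "disjoint_family_on X {1..2}"
    using assms unfolding I by (auto simp: disjoint_family_on_def)
  then show ?thesis
    using assms unfolding lcvp_partition_def I lcvs_feasible_def by (simp add: lcvs_matrix_def)
qed

theorem lcvs_in_time:
  assumes "fin_or_cofin \<sigma>p" "fin_or_cofin \<sigma>m" "fin_or_cofin \<rho>p" "fin_or_cofin \<rho>m"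
  shows "\<exists>f p. solves_in_time p f enc_opt_set (lcvs_answer \<sigma>p \<sigma>m \<rho>p \<rho>m obj)"
proof -
  let ?D = "lcvs_matrix \<sigma>p \<sigma>m \<rho>p \<rho>m"
  \<comment> \<open>maximizing the chosen set is minimizing its complement\<close>
  define K :: nat where "K = (case obj of Minimize \<Rightarrow> 1 | Maximize \<Rightarrow> 2)"
  have "fin_or_cofin UNIV" by (simp add: fin_or_cofin_def)
  then have "\<forall>i\<in>{1..2::nat}. \<forall>j\<in>{1..2::nat}. fin_or_cofin (fst (?D i j)) \<and> fin_or_cofin (snd (?D i j))"
    using assms by (auto simp: lcvs_matrix_def)
  moreover have "K \<noteq> 0" by (cases obj) (simp_all add: K_def)
  ultimately obtain d where "lcvp 2 ?D d K"
    using lcvp_exists[of 2 K ?D] by (meson one_le_numeral)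
  then interpret lcvp 2 ?D d K .
  define post where "post g cs = (if cs = [] then None
    else Some (map (\<lambda>v. colour (nth_or [] cs 0) v = 1) [0..<length g]))" for g :: "graph" and cs :: "colours list"
  have "ptime (\<lambda>p. post (fst p) (snd p))"
    unfolding post_def by (intro ptime_intros)
  from right_answer_in_time[OF this] obtain f p where fp: "\<And>G T L. decomposed_digraph G T L \<Longrightarrow>
    \<exists>cs t. computes p (enc_input G T L) (enc (post (matrix G) cs)) t \<and> right_answer G cs \<and>
      t \<le> card (pverts G) ^ f (bimim_width G T L)" by blast
  have "solves_in_time p f enc_opt_set (lcvs_answer \<sigma>p \<sigma>m \<rho>p \<rho>m obj)"
  proof (rule solves_in_timeI)
    fix G T L assume dec: "decomposed_digraph G T L"
    interpret decomposed_digraph G T L by fact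
    obtain cs t where cs: "computes p (enc_input G T L) (enc (post (matrix G) cs)) t" "right_answer G cs"
      "t \<le> n ^ f (bimim_width G T L)" using fp[OF dec] by blast
    let ?S = "\<lambda>c. colour_class G c 1"
    let ?feasible = "lcvs_feasible \<sigma>p \<sigma>m \<rho>p \<rho>m G"
    have classes: "?S c \<subseteq> pverts G \<and> colour_class G c 2 = pverts G - ?S c"
      if "\<forall>v\<in>pverts G. colour c v \<in> {1..2}" for c
      using that by (force simp: colour_class_def)
    have to_set: "?feasible (?S c)" if "solution (matrix G) c" for c
      using that classes[of c] lcvs_feasible_iff_partition[of "colour_class G c"]
      unfolding solution_iff[OF dec] by auto
    have from_set: "\<exists>c. solution (matrix G) c \<and> ?S c = S" if "?feasible S" for S
    proof -
      let ?c = "map (\<lambda>v. if v \<in> S then 1 else 2) [0..<n]"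
      have c: "\<forall>v\<in>pverts G. colour ?c v \<in> {1..2}" by (auto simp: mem_pverts)
      have "S \<subseteq> pverts G" using that by (simp add: lcvs_feasible_def)
      then have S: "?S ?c = S" unfolding colour_class_def by (auto simp: mem_pverts)
      then have "lcvp_partition 2 ?D G (colour_class G ?c)"
        using that classes[OF c] lcvs_feasible_iff_partition[of "colour_class G ?c"] by auto
      then have "solution (matrix G) ?c" unfolding solution_iff[OF dec] using c by simp
      then show ?thesis using S by blast
    qed
    have cost: "cost (matrix G) c = card (colour_class G c K)" for c
      using distinct_card[of "filter (\<lambda>v. colour c v = K) [0..<n]"]
      unfolding cost_def colour_class_def by (simp add: mem_pverts conj_commute)
    have better: "at_least_as_good obj (?S c) (?S c')"
      if "solution (matrix G) c" "solution (matrix G) c'" "cost (matrix G) c \<le> cost (matrix G) c'" for c c'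
    proof (cases obj)
      case Minimize
      then show ?thesis using that(3) unfolding cost by (simp add: K_def)
    next
      case Maximize
      have fin: "finite (pverts G)" using finite_lessThan[of n] unfolding lessThan_n .
      have "card (colour_class G b 2) + card (?S b) = n" if "solution (matrix G) b" for b
      proof -
        have "?S b \<subseteq> pverts G" "colour_class G b 2 = pverts G - ?S b"
          using classes[of b] that unfolding solution_iff[OF dec] by auto
        then show ?thesis using fin by (simp add: card_Diff_subset finite_subset card_mono)
      qed
      from this[OF that(1)] this[OF that(2)] show ?thesis
        using that(3) Maximize unfolding cost by (simp add: K_def)
    qed
    from cs(2) consider "cs = []" "\<nexists>c. solution (matrix G) c"
      | c where "cs = [c]" "solution (matrix G) c" "\<forall>c'. solution (matrix G) c' \<longrightarrow> cost (matrix G) c \<le> cost (matrix G) c'"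
      unfolding right_answer_def by blast
    then show "\<exists>r t. computes p (enc_input G T L) (enc_opt_set G r) t \<and> lcvs_answer \<sigma>p \<sigma>m \<rho>p \<rho>m obj G r \<and>
        t \<le> n ^ f (bimim_width G T L)"
    proof cases
      case 1
      then have "lcvs_answer \<sigma>p \<sigma>m \<rho>p \<rho>m obj G None" using from_set by auto
      moreover have "enc_opt_set G None = enc (post (matrix G) cs)" using 1 by (simp add: post_def)
      ultimately show ?thesis using cs(1,3) by metis
    next
      case 2
      have "at_least_as_good obj (?S c) S'" if "?feasible S'" for S'
        using from_set[OF that] better[OF 2(2)] 2(3) by blast
      then have "lcvs_answer \<sigma>p \<sigma>m \<rho>p \<rho>m obj G (Some (?S c))" using to_set[OF 2(2)] by auto
      moreover have "enc_opt_set G (Some (?S c)) = enc (post (matrix G) cs)"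
      proof -
        have "nth_or [] cs 0 = c" unfolding 2(1) by (simp add: nth_or_def)
        then have "post (matrix G) cs = Some (map (\<lambda>v. colour c v = 1) [0..<n])"
          unfolding post_def length_matrix using 2(1) by (simp only: list.distinct if_False)
        also have "map (\<lambda>v. colour c v = 1) [0..<n] = map (\<lambda>v. v \<in> ?S c) [0..<n]"
          by (rule map_cong) (simp_all add: colour_class_def mem_pverts)
        finally show ?thesis
          by (simp only: enc_opt_set.simps enc_option.simps enc_list_inst enc_bool_inst enc_list_map)
      qed
      ultimately show ?thesis using cs(1,3) by metis
    qed
  qed
  then show ?thesis by blast
qed

theorem theorem1:
  shows "(\<forall>\<sigma>p \<sigma>m \<rho>p \<rho>m obj.
            fin_or_cofin \<sigma>p \<and> fin_or_cofin \<sigma>m \<and> fin_or_cofin \<rho>p \<and> fin_or_cofin \<rho>m \<longrightarrow>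
            (\<exists>f p. solves_in_time p f enc_opt_set (lcvs_answer \<sigma>p \<sigma>m \<rho>p \<rho>m obj)))
       \<and> (\<forall>q D. q \<ge> 1 \<and>
            (\<forall>i\<in>{1..q}. \<forall>j\<in>{1..q}. fin_or_cofin (fst (D i j)) \<and> fin_or_cofin (snd (D i j))) \<longrightarrow>
            (\<exists>f p. solves_in_time p f (\<lambda>_. enc_bool) (lcvp_answer q D)))"
  using lcvs_in_time lcvp_in_time by blast

end
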